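(* The category of Real spectra, $C_2\ltimes\mathsf{Sp}^{\mathbf U}$, is equivalent to the category $C_2\ltimes\mathcal E_1^{\mathbf R}$.
   Context: $C_2=\{1,g\}$ acts on $\mathbb C^k$, $\mathrm U(k)$ and $S^{2k}=S^{\mathbb C^k}$ (one-point compactification) by complex conjugation. Spaces are based compactly generated weak Hausdorff spaces, and $C_2\mathsf{Top}_*$ is the category of based $C_2$-spaces. A Real spectrum $X$ is a sequence $\{X_k\}_{k\in\mathbb N}$ of based spaces, $X_k$ with an action of $C_2\ltimes\mathrm U(k)$, together with structure maps $\sigma_k:X_k\wedge S^2\to X_{k+1}$ such that the iterated structure maps $\sigma_k^m:X_k\wedge S^{2m}\to X_{k+m}$ are $(C_2\ltimes(\mathrm U(k)\times\mathrm U(m)))$-equivariant. A map of Real spectra is a collection of (equivariant) maps $f_k:X_k\to Y_k$ compatible with the structure maps. The resulting category is $C_2\ltimes\mathsf{Sp}^{\mathbf U}$. Objects of $\mathcal J_1^{\mathbf R}$: finite-dimensional complex inner product subspaces of $\mathbb C\otimes_{\mathbb R}\mathbb R^\infty$ of the form $\mathbb C\otimes_{\mathbb R}V'$ with $V'\subset\mathbb R^\infty$. The morphism space $\mathcal J_1^{\mathbf R}(U,V)$ is the Thom space of the bundle $\{(f,x): f:U\to V\text{ a complex-linear isometry},\ x\in f(U)^\perp\subset V\}$ over the Stiefel manifold of complex-linear isometries. Composition is $(f,x)\circ(h,y)=(fh,x+f(y))$, and $g$ acts by $(f,x)\mapsto(u\mapsto\overline{f(\bar u)},\bar x)$. $C_2\ltimes\mathcal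 E_1^{\mathbf R}$ is the category of $C_2\mathsf{Top}_*$-enriched functors $\mathcal J_1^{\mathbf R}\to C_2\mathsf{Top}_*$ and $C_2$-equivariant enriched natural transformations (where $C_2$ acts on mapping spaces in $C_2\mathsf{Top}_*$ by conjugation). *)

theory Defs
  imports
    "HOL-Analysis.Analysis"
    "HOL-Algebra.Group_Action"
    "HOL-Library.Function_Algebras"
begin

section \<open>Categories and equivalence of categories\<close>

text \<open>Hom-sets belonging to different pairs of objects need not be disjoint, so composition
  \<open>Cmp C X Y Z g f\<close> (of \<open>f : X \<rightarrow> Y\<close> and \<open>g : Y \<rightarrow> Z\<close>) takes the objects as arguments.\<close>

record ('o, 'm) cat =
  Obj :: "'o set"
  Hom :: "'o \<Rightarrow> 'o \<Rightarrow> 'm set"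
  Cmp :: "'o \<Rightarrow> 'o \<Rightarrow> 'o \<Rightarrow> 'm \<Rightarrow> 'm \<Rightarrow> 'm"
  Idt :: "'o \<Rightarrow> 'm"

definition is_category :: "('o, 'm) cat \<Rightarrow> bool" where
  "is_category C \<longleftrightarrow>
     (\<forall>X\<in>Obj C. Idt C X \<in> Hom C X X) \<and>
     (\<forall>X\<in>Obj C. \<forall>Y\<in>Obj C. \<forall>Z\<in>Obj C. \<forall>f\<in>Hom C X Y. \<forall>g\<in>Hom C Y Z.
        Cmp C X Y Z g f \<in> Hom C X Z) \<and>
     (\<forall>X\<in>Obj C. \<forall>Y\<in>Obj C. \<forall>f\<in>Hom C X Y.
        Cmp C X X Y f (Idt C X) = f \<and> Cmp C X Y Y (Idt C Y) f = f) \<and>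
     (\<forall>W\<in>Obj C. \<forall>X\<in>Obj C. \<forall>Y\<in>Obj C. \<forall>Z\<in>Obj C.
        \<forall>f\<in>Hom C W X. \<forall>g\<in>Hom C X Y. \<forall>h\<in>Hom C Y Z.
        Cmp C W X Z (Cmp C X Y Z h g) f = Cmp C W Y Z h (Cmp C W X Y g f))"

definition is_iso :: "('o, 'm) cat \<Rightarrow> 'o \<Rightarrow> 'o \<Rightarrow> 'm \<Rightarrow> bool" where
  "is_iso C X Y f \<longleftrightarrow> f \<in> Hom C X Y \<and>
     (\<exists>g\<in>Hom C Y X. Cmp C X Y X g f = Idt C X \<and> Cmp C Y X Y f g = Idt C Y)"

record ('o, 'm, 'p, 'n) ftor =
  onObj :: "'o \<Rightarrow> 'p"
  onHom :: "'o \<Rightarrow> 'o \<Rightarrow> 'm \<Rightarrow> 'n"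

definition is_functor :: "('o, 'm) cat \<Rightarrow> ('p, 'n) cat \<Rightarrow> ('o, 'm, 'p, 'n) ftor \<Rightarrow> bool" where
  "is_functor C D F \<longleftrightarrow>
     (\<forall>X\<in>Obj C. onObj F X \<in> Obj D) \<and>
     (\<forall>X\<in>Obj C. \<forall>Y\<in>Obj C. \<forall>f\<in>Hom C X Y. onHom F X Y f \<in> Hom D (onObj F X) (onObj F Y)) \<and>
     (\<forall>X\<in>Obj C. onHom F X X (Idt C X) = Idt D (onObj F X)) \<and>
     (\<forall>X\<in>Obj C. \<forall>Y\<in>Obj C. \<forall>Z\<in>Obj C. \<forall>f\<in>Hom C X Y. \<forall>g\<in>Hom C Y Z.
        onHom F X Z (Cmp C X Y Z g f) =
        Cmp D (onObj F X) (onObj F Y) (onObj F Z) (onHom F Y Z g) (onHom F X Y f))"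

definition id_ftor :: "('o, 'm, 'o, 'm) ftor" where
  "id_ftor = \<lparr>onObj = (\<lambda>X. X), onHom = (\<lambda>X Y f. f)\<rparr>"

definition comp_ftor ::
  "('p, 'n, 'q, 'l) ftor \<Rightarrow> ('o, 'm, 'p, 'n) ftor \<Rightarrow> ('o, 'm, 'q, 'l) ftor" where
  "comp_ftor G F = \<lparr>onObj = (\<lambda>X. onObj G (onObj F X)),
     onHom = (\<lambda>X Y f. onHom G (onObj F X) (onObj F Y) (onHom F X Y f))\<rparr>"

definition natural_iso ::
  "('o, 'm) cat \<Rightarrow> ('p, 'n) cat \<Rightarrow> ('o, 'm, 'p, 'n) ftor \<Rightarrow> ('o, 'm, 'p, 'n) ftor \<Rightarrow> ('o \<Rightarrow> 'n) \<Rightarrow> bool"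
  where
  "natural_iso C D F G \<eta> \<longleftrightarrow>
     (\<forall>X\<in>Obj C. is_iso D (onObj F X) (onObj G X) (\<eta> X)) \<and>
     (\<forall>X\<in>Obj C. \<forall>Y\<in>Obj C. \<forall>f\<in>Hom C X Y.
        Cmp D (onObj F X) (onObj F Y) (onObj G Y) (\<eta> Y) (onHom F X Y f) =
        Cmp D (onObj F X) (onObj G X) (onObj G Y) (onHom G X Y f) (\<eta> X))"

definition equivalent_categories :: "('o, 'm) cat \<Rightarrow> ('p, 'n) cat \<Rightarrow> bool" where
  "equivalent_categories C D \<longleftrightarrow> is_category C \<and> is_category D \<and>
     (\<exists>F G \<eta> \<epsilon>. is_functor C D F \<and> is_functor D C G \<and>
        natural_iso C C id_ftor (comp_ftor G F) \<eta> \<and>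
        natural_iso D D (comp_ftor F G) id_ftor \<epsilon>)"


section \<open>Compactly generated weak Hausdorff spaces\<close>

text \<open>The spaces under consideration have points in an arbitrary fixed type \<open>'a\<close>.
  Test maps \<open>u : K \<rightarrow> X\<close> are maps from compact Hausdorff spaces \<open>K\<close>, which we take
  with points in the type \<open>'a set set\<close>.  This is no restriction for detecting whether \<open>X\<close> is weak
  Hausdorff: if \<open>D \<subseteq> K\<close> meets each nonempty fibre of \<open>u\<close> in exactly one point then the closure of \<open>D\<close>
  is compact Hausdorff, has the same image as \<open>K\<close>, and embeds into the double powerset of \<open>D\<close> via
  \<open>z \<mapsto> {N \<inter> D | N a neighbourhood of z}\<close>.  And if \<open>X\<close> is weak Hausdorff, each test map from an arbitrary
  compact Hausdorff space factors through its image, a compact Hausdorff subspace of \<open>X\<close>, so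
  that these \<open>K\<close> also suffice to define the k-ification and the compact-open topology.\<close>

definition test_map :: "'a set set topology \<Rightarrow> 'a topology \<Rightarrow> ('a set set \<Rightarrow> 'a) \<Rightarrow> bool" where
  "test_map K X u \<longleftrightarrow> compact_space K \<and> Hausdorff_space K \<and> continuous_map K X u"

definition weak_Hausdorff :: "'a topology \<Rightarrow> bool" where
  "weak_Hausdorff X \<longleftrightarrow> (\<forall>K u. test_map K X u \<longrightarrow> closedin X (u ` topspace K))"

text \<open>The library's \<open>kification\<close> and \<open>k_space\<close> test against all compact subsets instead, not only against
  images of compact Hausdorff spaces; for weak Hausdorff spaces the two notions differ (on the
  square of the one-point compactification of the rationals, for instance).\<close>

definition kify :: "'a topology \<Rightarrow> 'a topology" where
  "kify X = topology (\<lambda>U. U \<subseteq> topspace X \<and>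
     (\<forall>K u. test_map K X u \<longrightarrow> openin K {z \<in> topspace K. u z \<in> U}))"

lemma openin_kify:
  "openin (kify X) U \<longleftrightarrow> U \<subseteq> topspace X \<and>
     (\<forall>K u. test_map K X u \<longrightarrow> openin K {z \<in> topspace K. u z \<in> U})"
proof -
  have "istopology (\<lambda>U. U \<subseteq> topspace X \<and>
     (\<forall>K u. test_map K X u \<longrightarrow> openin K {z \<in> topspace K. u z \<in> U}))" (is "istopology ?P")
    unfolding istopology_def
  proof (intro conjI allI impI)
    fix S T assume S: "?P S" and T: "?P T"
    show "S \<inter> T \<subseteq> topspace X" using S by blast
    fix K u assume "test_map K X u"
    with S T have "openin K ({z \<in> topspace K. u z \<in> S} \<inter> {z \<in> topspace K. u z \<in> T})"
      by blast
    moreover have "{z \<in> topspace K. u z \<in> S} \<inter> {z \<in> topspace K. u z \<in> T} =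
      {z \<in> topspace K. u z \<in> S \<inter> T}" by blast
    ultimately show "openin K {z \<in> topspace K. u z \<in> S \<inter> T}" by simp
  next
    fix \<U> assume A: "\<forall>S\<in>\<U>. ?P S"
    show "\<Union>\<U> \<subseteq> topspace X" using A by blast
    fix K u assume "test_map K X u"
    with A have "openin K (\<Union>S\<in>\<U>. {z \<in> topspace K. u z \<in> S})"
      by blast
    moreover have "(\<Union>S\<in>\<U>. {z \<in> topspace K. u z \<in> S}) = {z \<in> topspace K. u z \<in> \<Union>\<U>}" by blast
    ultimately show "openin K {z \<in> topspace K. u z \<in> \<Union>\<U>}" by simp
  qed
  then show ?thesis
    by (simp add: kify_def topology_inverse')
qed

definition cgwh :: "'a topology \<Rightarrow> bool" where
  "cgwh X \<longleftrightarrow> weak_Hausdorff X \<and> kify X = X"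

definition kprod :: "'a topology \<Rightarrow> 'b topology \<Rightarrow> ('a \<times> 'b) topology" where
  "kprod X Y = kify (prod_topology X Y)"

definition quot_topology :: "'a topology \<Rightarrow> ('a \<Rightarrow> 'b) \<Rightarrow> 'b topology" where
  "quot_topology X q = topology (\<lambda>U. U \<subseteq> q ` topspace X \<and> openin X {x \<in> topspace X. q x \<in> U})"

lemma openin_quot_topology:
  "openin (quot_topology X q) U \<longleftrightarrow> U \<subseteq> q ` topspace X \<and> openin X {x \<in> topspace X. q x \<in> U}"
proof -
  have "istopology (\<lambda>U. U \<subseteq> q ` topspace X \<and> openin X {x \<in> topspace X. q x \<in> U})"
    (is "istopology ?P")
    unfolding istopology_def
  proof (intro conjI allI impI)
    fix S T assume S: "?P S" and T: "?P T"
    show "S \<inter> T \<subseteq> q ` topspace X" using S by blast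
    have "openin X ({x \<in> topspace X. q x \<in> S} \<inter> {x \<in> topspace X. q x \<in> T})"
      using S T by blast
    moreover have "{x \<in> topspace X. q x \<in> S} \<inter> {x \<in> topspace X. q x \<in> T} =
      {x \<in> topspace X. q x \<in> S \<inter> T}" by blast
    ultimately show "openin X {x \<in> topspace X. q x \<in> S \<inter> T}" by simp
  next
    fix \<U> assume A: "\<forall>S\<in>\<U>. ?P S"
    show "\<Union>\<U> \<subseteq> q ` topspace X" using A by blast
    have "openin X (\<Union>S\<in>\<U>. {x \<in> topspace X. q x \<in> S})"
      using A by blast
    moreover have "(\<Union>S\<in>\<U>. {x \<in> topspace X. q x \<in> S}) = {x \<in> topspace X. q x \<in> \<Union>\<U>}" by blast
    ultimately show "openin X {x \<in> topspace X. q x \<in> \<Union>\<U>}" by simp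
  qed
  then show ?thesis
    by (simp add: quot_topology_def topology_inverse')
qed


section \<open>Based spaces with a group action\<close>

record 'a bspace =
  Sp :: "'a topology"
  Pt :: 'a

abbreviation points :: "('a, 'r) bspace_scheme \<Rightarrow> 'a set" where
  "points X \<equiv> topspace (Sp X)"

definition based_maps ::
  "('a, 'r) bspace_scheme \<Rightarrow> ('b, 's) bspace_scheme \<Rightarrow> ('a \<Rightarrow> 'b) set" where
  "based_maps X Y = {f \<in> extensional (points X). continuous_map (Sp X) (Sp Y) f \<and> f (Pt X) = Pt Y}"

text \<open>Points of the smash product: \<open>None\<close> is the class of the wedge, and \<open>Some (x, y)\<close> with
  \<open>x\<close>, \<open>y\<close> not the base points are the remaining points.\<close>

definition smash_pt ::
  "('a, 'r) bspace_scheme \<Rightarrow> ('b, 's) bspace_scheme \<Rightarrow> 'a \<Rightarrow> 'b \<Rightarrow> ('a \<times> 'b) option" where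
  "smash_pt X Y x y = (if x = Pt X \<or> y = Pt Y then None else Some (x, y))"

definition smash ::
  "('a, 'r) bspace_scheme \<Rightarrow> ('b, 's) bspace_scheme \<Rightarrow> ('a \<times> 'b) option bspace" where
  "smash X Y = \<lparr>Sp = quot_topology (kprod (Sp X) (Sp Y)) (\<lambda>(x, y). smash_pt X Y x y), Pt = None\<rparr>"

record 'g topgroup = "'g monoid" +
  gtop :: "'g topology"

record ('g, 'a) gspace = "'a bspace" +
  Act :: "'g \<Rightarrow> 'a \<Rightarrow> 'a"

definition based_gspace :: "'g topgroup \<Rightarrow> ('g, 'a) gspace \<Rightarrow> bool" where
  "based_gspace G X \<longleftrightarrow>
     cgwh (Sp X) \<and> Pt X \<in> points X \<and>
     group_action G (points X) (Act X) \<and>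
     Act X \<in> extensional (carrier G) \<and>
     continuous_map (kprod (gtop G) (Sp X)) (Sp X) (\<lambda>(g, x). Act X g x) \<and>
     (\<forall>g\<in>carrier G. Act X g (Pt X) = Pt X)"

definition gmaps :: "'g topgroup \<Rightarrow> ('g, 'a) gspace \<Rightarrow> ('g, 'b) gspace \<Rightarrow> ('a \<Rightarrow> 'b) set" where
  "gmaps G X Y = {f \<in> based_maps X Y.
     \<forall>g\<in>carrier G. \<forall>x\<in>points X. f (Act X g x) = Act Y g (f x)}"

text \<open>The group \<open>C\<^sub>2\<close>, with \<open>True\<close> the generator \<open>g\<close>.\<close>

definition C2 :: "bool topgroup" where
  "C2 = \<lparr>carrier = UNIV, mult = (\<noteq>), one = False, gtop = discrete_topology UNIV\<rparr>"

definition compact_open ::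
  "('a, 'r) bspace_scheme \<Rightarrow> ('b, 's) bspace_scheme \<Rightarrow> ('a \<Rightarrow> 'b) topology" where
  "compact_open X Y = topology_generated_by
     {{f \<in> based_maps X Y. \<forall>z\<in>topspace K. f (u z) \<in> U} | K u U.
        test_map K (Sp X) u \<and> openin (Sp Y) U}"

text \<open>The mapping space of all (not necessarily equivariant) based maps, with \<open>C\<^sub>2\<close> acting by
  conjugation; note that \<open>s\<close> is its own inverse.\<close>

definition map_space :: "(bool, 'a) gspace \<Rightarrow> (bool, 'b) gspace \<Rightarrow> (bool, 'a \<Rightarrow> 'b) gspace" where
  "map_space X Y = \<lparr>Sp = kify (compact_open X Y), Pt = (\<lambda>x\<in>points X. Pt Y),
     Act = (\<lambda>s. \<lambda>f\<in>based_maps X Y. \<lambda>x\<in>points X. Act Y s (f (Act X s x)))\<rparr>"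


section \<open>Complex inner product spaces with complex conjugation\<close>

text \<open>\<open>\<complex> \<otimes> \<real>\<^sup>\<infinity>\<close> is the space of finitely supported sequences of complex numbers.
  All subspaces and spaces of linear maps that occur are finite-dimensional, so their topology is
  the one induced by the product topology (given by the type class instance for functions).\<close>

type_synonym vec = "nat \<Rightarrow> complex"

definition vscale :: "complex \<Rightarrow> vec \<Rightarrow> vec" where
  "vscale c v = (\<lambda>i. c * v i)"

definition vinner :: "vec \<Rightarrow> vec \<Rightarrow> complex" where
  "vinner v w = (\<Sum>i\<in>{i. v i \<noteq> 0}. v i * cnj (w i))"

text \<open>The action of \<open>s \<in> C\<^sub>2\<close> by complex conjugation, on vectors and on maps with domain \<open>U\<close>.\<close>

definition vconj :: "bool \<Rightarrow> vec \<Rightarrow> vec" where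
  "vconj s v = (\<lambda>i. if s then cnj (v i) else v i)"

definition mconj :: "bool \<Rightarrow> vec set \<Rightarrow> (vec \<Rightarrow> vec) \<Rightarrow> vec \<Rightarrow> vec" where
  "mconj s U f = (\<lambda>u\<in>U. vconj s (f (vconj s u)))"

definition isometries :: "vec set \<Rightarrow> vec set \<Rightarrow> (vec \<Rightarrow> vec) set" where
  "isometries U V = {f \<in> U \<rightarrow>\<^sub>E V.
     (\<forall>u\<in>U. \<forall>v\<in>U. f (u + v) = f u + f v) \<and>
     (\<forall>c. \<forall>u\<in>U. f (vscale c u) = vscale c (f u)) \<and>
     (\<forall>u\<in>U. \<forall>v\<in>U. vinner (f u) (f v) = vinner u v)}"

definition CC :: "nat \<Rightarrow> vec set" where
  "CC k = {v. \<forall>i\<ge>k. v i = 0}"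

definition unitary :: "nat \<Rightarrow> (vec \<Rightarrow> vec) set" where
  "unitary k = isometries (CC k) (CC k)"

definition sphere_of :: "vec set \<Rightarrow> vec option bspace" where
  "sphere_of V = \<lparr>Sp = Alexandroff_compactification (subtopology euclidean V), Pt = None\<rparr>"

text \<open>The semidirect product \<open>C\<^sub>2 \<ltimes> U(k)\<close>; the pair \<open>(s, A)\<close> acts on \<open>\<complex>\<^sup>k\<close> as \<open>v \<mapsto> A (s v)\<close>.\<close>

definition C2U :: "nat \<Rightarrow> (bool \<times> (vec \<Rightarrow> vec)) topgroup" where
  "C2U k = \<lparr>carrier = UNIV \<times> unitary k,
     mult = (\<lambda>(s, A) (t, B). (s \<noteq> t, compose (CC k) A (mconj s (CC k) B))),
     one = (False, \<lambda>v\<in>CC k. v),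
     gtop = prod_topology (discrete_topology UNIV) (subtopology euclidean (unitary k))\<rparr>"

definition sphere_act :: "bool \<Rightarrow> (vec \<Rightarrow> vec) \<Rightarrow> vec option \<Rightarrow> vec option" where
  "sphere_act s B = map_option (\<lambda>v. B (vconj s v))"

text \<open>\<open>\<complex>\<^sup>k\<^sup>+\<^sup>m = \<complex>\<^sup>k \<oplus> \<complex>\<^sup>m\<close>: the first \<open>k\<close> coordinates, and the last \<open>m\<close> coordinates.\<close>

definition vtake :: "nat \<Rightarrow> vec \<Rightarrow> vec" where
  "vtake k v = (\<lambda>i. if i < k then v i else 0)"

definition vdrop :: "nat \<Rightarrow> vec \<Rightarrow> vec" where
  "vdrop k v = (\<lambda>i. v (k + i))"

definition block_sum :: "nat \<Rightarrow> nat \<Rightarrow> (vec \<Rightarrow> vec) \<Rightarrow> (vec \<Rightarrow> vec) \<Rightarrow> vec \<Rightarrow> vec" where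
  "block_sum k m A B =
     (\<lambda>v\<in>CC (k + m). \<lambda>i. if i < k then A (vtake k v) i else B (vdrop k v) (i - k))"


section \<open>Real spectra\<close>

record 'a rspectrum =
  Lev :: "nat \<Rightarrow> (bool \<times> (vec \<Rightarrow> vec), 'a) gspace"
  Str :: "nat \<Rightarrow> ('a \<times> vec option) option \<Rightarrow> 'a"

text \<open>The iterated structure map \<open>X\<^sub>k \<and> S\<^sup>2\<^sup>m \<rightarrow> X\<^sub>k\<^sub>+\<^sub>m\<close>, where \<open>S\<^sup>2\<^sup>m\<close> is identified with
  \<open>S\<^sup>2 \<and> \<dots> \<and> S\<^sup>2\<close> by \<open>\<complex>\<^sup>m = \<complex> \<oplus> \<dots> \<oplus> \<complex>\<close>: the first coordinate is fed into \<open>Str X k\<close>,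
  the next one into \<open>Str X (k + 1)\<close>, and so on.  The case \<open>m = 0\<close> is the isomorphism
  \<open>X\<^sub>k \<and> S\<^sup>0 \<cong> X\<^sub>k\<close>.\<close>

primrec iter_str :: "'a rspectrum \<Rightarrow> nat \<Rightarrow> nat \<Rightarrow> ('a \<times> vec option) option \<Rightarrow> 'a" where
  "iter_str X k 0 z = (case z of Some (x, Some v) \<Rightarrow> x | _ \<Rightarrow> Pt (Lev X k))"
| "iter_str X k (Suc m) z = (case z of
     Some (x, Some v) \<Rightarrow> Str X (k + m)
       (smash_pt (Lev X (k + m)) (sphere_of (CC 1))
         (iter_str X k m (Some (x, Some (vtake m v)))) (Some (vdrop m v)))
   | _ \<Rightarrow> Pt (Lev X (k + Suc m)))"

definition real_spectrum :: "'a rspectrum \<Rightarrow> bool" where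
  "real_spectrum X \<longleftrightarrow>
     (\<forall>k. based_gspace (C2U k) (Lev X k)) \<and>
     (\<forall>k. Str X k \<in> based_maps (smash (Lev X k) (sphere_of (CC 1))) (Lev X (Suc k))) \<and>
     (\<forall>k m s. \<forall>A\<in>unitary k. \<forall>B\<in>unitary m.
        \<forall>x\<in>points (Lev X k). \<forall>v\<in>points (sphere_of (CC m)).
        iter_str X k m (smash_pt (Lev X k) (sphere_of (CC m))
          (Act (Lev X k) (s, A) x) (sphere_act s B v)) =
        Act (Lev X (k + m)) (s, block_sum k m A B)
          (iter_str X k m (smash_pt (Lev X k) (sphere_of (CC m)) x v)))"

definition rspectrum_maps :: "'a rspectrum \<Rightarrow> 'a rspectrum \<Rightarrow> (nat \<Rightarrow> 'a \<Rightarrow> 'a) set" where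
  "rspectrum_maps X Y = {f.
     (\<forall>k. f k \<in> gmaps (C2U k) (Lev X k) (Lev Y k)) \<and>
     (\<forall>k. \<forall>x\<in>points (Lev X k). \<forall>v\<in>points (sphere_of (CC 1)).
        f (Suc k) (Str X k (smash_pt (Lev X k) (sphere_of (CC 1)) x v)) =
        Str Y k (smash_pt (Lev Y k) (sphere_of (CC 1)) (f k x) v))}"

definition Real_Spectra :: "('a rspectrum, nat \<Rightarrow> 'a \<Rightarrow> 'a) cat" where
  "Real_Spectra = \<lparr>Obj = Collect real_spectrum, Hom = rspectrum_maps,
     Cmp = (\<lambda>X Y Z g f k. compose (points (Lev X k)) (g k) (f k)),
     Idt = (\<lambda>X k. \<lambda>x\<in>points (Lev X k). x)\<rparr>"


section \<open>The category \<open>J\<^sub>1\<^sup>R\<close> and enriched functors on it\<close>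

definition real_span :: "(nat \<Rightarrow> real) set \<Rightarrow> (nat \<Rightarrow> real) set" where
  "real_span = module.span (\<lambda>c v i. c * v i)"

definition complexification :: "(nat \<Rightarrow> real) set \<Rightarrow> vec set" where
  "complexification W = {\<lambda>i. Complex (a i) (b i) | a b. a \<in> W \<and> b \<in> W}"

definition J_obj :: "vec set set" where
  "J_obj = {complexification (real_span B) | B.
     finite B \<and> (\<forall>b\<in>B. finite {i. b i \<noteq> 0})}"

text \<open>The Stiefel manifold is compact, so the Thom space is the one-point
  compactification of the total space.\<close>

type_synonym jmor = "((vec \<Rightarrow> vec) \<times> vec) option"

definition J_bundle :: "vec set \<Rightarrow> vec set \<Rightarrow> ((vec \<Rightarrow> vec) \<times> vec) set" where
  "J_bundle U V = {(f, x). f \<in> isometries U V \<and> x \<in> V \<and> (\<forall>u\<in>U. vinner x (f u) = 0)}"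

definition J_mor :: "vec set \<Rightarrow> vec set \<Rightarrow> (bool, jmor) gspace" where
  "J_mor U V = \<lparr>Sp = Alexandroff_compactification (subtopology euclidean (J_bundle U V)), Pt = None,
     Act = (\<lambda>s. \<lambda>\<phi>\<in>insert None (Some ` J_bundle U V).
       map_option (\<lambda>(f, x). (mconj s U f, vconj s x)) \<phi>)\<rparr>"

text \<open>Composition \<open>\<phi> \<circ> \<psi>\<close>, for \<open>\<psi>\<close> with domain \<open>U\<close>.\<close>

definition J_comp :: "vec set \<Rightarrow> jmor \<Rightarrow> jmor \<Rightarrow> jmor" where
  "J_comp U \<phi> \<psi> = (case (\<phi>, \<psi>) of
     (Some (f, x), Some (h, y)) \<Rightarrow> Some (compose U f h, x + f y) | _ \<Rightarrow> None)"

definition J_id :: "vec set \<Rightarrow> jmor" where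
  "J_id U = Some (\<lambda>u\<in>U. u, 0)"

record 'a efunctor =
  FOb :: "vec set \<Rightarrow> (bool, 'a) gspace"
  FMor :: "vec set \<Rightarrow> vec set \<Rightarrow> jmor \<Rightarrow> 'a \<Rightarrow> 'a"

definition enriched_functor :: "'a efunctor \<Rightarrow> bool" where
  "enriched_functor F \<longleftrightarrow>
     FOb F \<in> extensional J_obj \<and>
     (\<forall>U V. U \<notin> J_obj \<or> V \<notin> J_obj \<longrightarrow> FMor F U V = undefined) \<and>
     (\<forall>U\<in>J_obj. based_gspace C2 (FOb F U)) \<and>
     (\<forall>U\<in>J_obj. \<forall>V\<in>J_obj. FMor F U V \<in> gmaps C2 (J_mor U V) (map_space (FOb F U) (FOb F V))) \<and>
     (\<forall>U\<in>J_obj. FMor F U U (J_id U) = (\<lambda>x\<in>points (FOb F U). x)) \<and>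
     (\<forall>U\<in>J_obj. \<forall>V\<in>J_obj. \<forall>W\<in>J_obj.
        \<forall>\<psi>\<in>points (J_mor U V). \<forall>\<phi>\<in>points (J_mor V W).
        FMor F U W (J_comp U \<phi> \<psi>) = compose (points (FOb F U)) (FMor F V W \<phi>) (FMor F U V \<psi>))"

definition enriched_nats :: "'a efunctor \<Rightarrow> 'a efunctor \<Rightarrow> (vec set \<Rightarrow> 'a \<Rightarrow> 'a) set" where
  "enriched_nats F G = {\<alpha> \<in> extensional J_obj.
     (\<forall>U\<in>J_obj. \<alpha> U \<in> gmaps C2 (FOb F U) (FOb G U)) \<and>
     (\<forall>U\<in>J_obj. \<forall>V\<in>J_obj. \<forall>\<phi>\<in>points (J_mor U V).
        compose (points (FOb F U)) (\<alpha> V) (FMor F U V \<phi>) =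
        compose (points (FOb F U)) (FMor G U V \<phi>) (\<alpha> U))}"

definition C2_E1 :: "('a efunctor, vec set \<Rightarrow> 'a \<Rightarrow> 'a) cat" where
  "C2_E1 = \<lparr>Obj = Collect enriched_functor, Hom = enriched_nats,
     Cmp = (\<lambda>F G H \<beta> \<alpha>. \<lambda>U\<in>J_obj. compose (points (FOb F U)) (\<beta> U) (\<alpha> U)),
     Idt = (\<lambda>F. \<lambda>U\<in>J_obj. \<lambda>x\<in>points (FOb F U). x)\<rparr>"

end

theory Submission
  imports Defs
begin

text \<open>A point \<open>(f, y)\<close> of \<open>J(\<complex>\<^sup>k, \<complex>\<^sup>k\<^sup>+\<^sup>m)\<close> can be written as \<open>(A restricted to \<complex>\<^sup>k, A (0 \<oplus> v))\<close>
  with \<open>A\<close> unitary, uniquely up to replacing \<open>(A, v)\<close> by \<open>(A (1 \<oplus> B), B\<^sup>-\<^sup>1 v)\<close>. So a Real spectrum \<open>X\<close> with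
  iterated structure maps \<open>\<sigma>\<close> gives an enriched functor on the objects \<open>\<complex>\<^sup>k\<close>, where \<open>(f, y)\<close> acts as
  \<open>x \<mapsto> A \<cdot> \<sigma>(x \<and> v)\<close>: equivariance of \<open>\<sigma>\<close> under \<open>U(k) \<times> U(m)\<close> makes this independent of the choice, and it is
  continuous because \<open>J(\<complex>\<^sup>k, \<complex>\<^sup>k\<^sup>+\<^sup>m)\<close> is a quotient of the compact Hausdorff space \<open>U(k+m) \<times> S\<^sup>2\<^sup>m\<close>.
  It extends to all objects along chosen conjugation-invariant isometries \<open>\<complex>\<^sup>k \<rightarrow> U\<close>. Conversely an enriched functor \<open>E\<close>
  gives the spectrum \<open>E(\<complex>\<^sup>k)\<close>, on which \<open>(s, A)\<close> acts as \<open>x \<mapsto> E(A, 0) (s x)\<close> and whose structure maps are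
  \<open>x \<and> v \<mapsto> E(inclusion, 0 \<oplus> v) x\<close>. If the chosen isometries are identities on \<open>\<complex>\<^sup>k\<close>, one composite is
  the identity, and \<open>E\<close> of the chosen isometries is a natural isomorphism from the other to the identity.\<close>

section \<open>Compact Hausdorff test spaces of arbitrary type\<close>

text \<open>Three obstacles shape the proof. (1) Products and mapping spaces are k-ified, and
  \<open>test_map\<close> admits test spaces of one type only, while products, pullbacks and matrix
  groups live in other types. Continuity is therefore restated for compact Hausdorff spaces of any
  type, over which pairing, evaluation and currying behave as for locally compact spaces. (2) The
  unitary \<open>A\<close> extending an isometry comes from completing an orthonormal family, which
  gives no continuous choice. So continuity in the morphism is proved upstairs on U(k+m) x S^2m,
  where \<open>A\<close> is a coordinate, and descends because a continuous surjection from a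
  compact onto a Hausdorff space is a quotient map. Spheres and Thom spaces are one-point
  compactifications, and maps between them are continuous by properness: isometries preserve norms,
  so preimages of bounded sets are bounded. (3) The C_2-action must survive the passage to
  coordinates. This is why each object, being a complexification, gets a frame of real vectors: the
  resulting isomorphisms in J are fixed by conjugation, and an enriched functor sends them to
  equivariant maps.\<close>

definition compact_Hausdorff :: "'k topology \<Rightarrow> bool" where
  "compact_Hausdorff K \<longleftrightarrow> compact_space K \<and> Hausdorff_space K"

lemma homeomorphic_compact_Hausdorff:
  assumes "homeomorphic_map X Y f" shows "compact_Hausdorff X \<longleftrightarrow> compact_Hausdorff Y"
proof -
  have "X homeomorphic_space Y" using assms by (rule homeomorphic_map_imp_homeomorphic_space)
  then show ?thesis
    by (simp add: compact_Hausdorff_def homeomorphic_compact_space homeomorphic_Hausdorff_space)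
qed

lemma quotient_map_quot_topology: "quotient_map X (quot_topology X q) q"
proof -
  have "topspace (quot_topology X q) = q ` topspace X"
  proof
    show "topspace (quot_topology X q) \<subseteq> q ` topspace X"
      unfolding topspace_def openin_quot_topology by auto
    have "{x \<in> topspace X. q x \<in> q ` topspace X} = topspace X"
      by auto
    then have "openin (quot_topology X q) (q ` topspace X)"
      by (simp add: openin_quot_topology)
    then show "q ` topspace X \<subseteq> topspace (quot_topology X q)"
      by (rule openin_subset)
  qed
  then show ?thesis
    by (auto simp: quotient_map_def openin_quot_topology)
qed

lemma topspace_quot_topology [simp]: "topspace (quot_topology X q) = q ` topspace X"
  using quotient_imp_surjective_map[OF quotient_map_quot_topology] by metis

text \<open>Along an injection the quotient is a homeomorphic copy with points in another type. Test
  spaces are moved into the type demanded by \<open>test_map\<close> in this way.\<close>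

lemma homeomorphic_map_quot_topology:
  "inj_on q (topspace X) \<Longrightarrow> homeomorphic_map X (quot_topology X q) q"
  using injective_quotient_map quotient_map_quot_topology
  by (metis bijective_open_imp_homeomorphic_map)

lemma topspace_kify [simp]: "topspace (kify X) = topspace X"
proof
  show "topspace (kify X) \<subseteq> topspace X"
    unfolding topspace_def[of "kify X"] openin_kify by auto
  have "openin (kify X) (topspace X)"
    unfolding openin_kify
  proof (intro conjI allI impI)
    fix K :: "'a set set topology" and u
    assume "test_map K X u"
    then have "{z \<in> topspace K. u z \<in> topspace X} = topspace K"
      by (auto simp: test_map_def continuous_map_def)
    then show "openin K {z \<in> topspace K. u z \<in> topspace X}" by simp
  qed simp
  then show "topspace X \<subseteq> topspace (kify X)" by (rule openin_subset)
qed

lemma openin_kify_if_openin: "openin X U \<Longrightarrow> openin (kify X) U"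
  unfolding openin_kify test_map_def
  by (auto dest: openin_subset intro: openin_continuous_map_preimage)

lemma continuous_map_kify_id: "continuous_map (kify X) X (\<lambda>x. x)"
  unfolding continuous_map_def
proof (intro conjI allI impI)
  fix U assume U: "openin X U"
  then have "{x \<in> topspace (kify X). x \<in> U} = U" by (auto dest: openin_subset)
  then show "openin (kify X) {x \<in> topspace (kify X). x \<in> U}"
    using openin_kify_if_openin[OF U] by simp
qed auto

text \<open>\<open>kify X\<close> carries the final topology for the test maps into
  \<open>X\<close>, so a map out of it is tested along them.\<close>

lemma continuous_map_from_kify:
  assumes "\<And>K u. test_map K X u \<Longrightarrow> continuous_map K Y (\<lambda>z. f (u z))"
    and "\<And>x. x \<in> topspace X \<Longrightarrow> f x \<in> topspace Y"
  shows "continuous_map (kify X) Y f"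
  unfolding continuous_map_def
proof (intro conjI allI impI)
  show "f \<in> topspace (kify X) \<rightarrow> topspace Y" using assms(2) by auto
  fix U assume U: "openin Y U"
  show "openin (kify X) {x \<in> topspace (kify X). f x \<in> U}"
    unfolding openin_kify
  proof (intro conjI allI impI)
    fix K :: "'a set set topology" and u
    assume t: "test_map K X u"
    then have "{z \<in> topspace K. u z \<in> {x \<in> topspace (kify X). f x \<in> U}} = {z \<in> topspace K. f (u z) \<in> U}"
      by (auto simp: test_map_def continuous_map_def)
    then show "openin K {z \<in> topspace K. u z \<in> {x \<in> topspace (kify X). f x \<in> U}}"
      using openin_continuous_map_preimage[OF assms(1)[OF t] U] by simp
  qed auto
qed

text \<open>The closure of a transversal \<open>D\<close> of the fibres of \<open>u\<close> has the same image as \<open>u\<close>, and sending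
  \<open>z\<close> to the traces on \<open>D\<close> of its neighbourhoods (transported along \<open>u\<close>) embeds it into the double
  powerset of \<open>X\<close>.\<close>

lemma weak_Hausdorff_closed_image:
  fixes X :: "'a topology" and J :: "'j topology"
  assumes X: "weak_Hausdorff X" and J: "compact_Hausdorff J" and u: "continuous_map J X u"
  shows "closedin X (u ` topspace J)"
proof -
  define s where "s = (\<lambda>x. SOME z. z \<in> topspace J \<and> u z = x)"
  have s: "s x \<in> topspace J \<and> u (s x) = x" if "x \<in> u ` topspace J" for x
    unfolding s_def by (rule someI_ex) (use that in auto)
  define D where "D = s ` u ` topspace J"
  have DJ: "D \<subseteq> topspace J" using s by (auto simp: D_def)
  have injD: "inj_on u D" using s by (auto simp: D_def inj_on_def)
  have uD: "u ` D = u ` topspace J" using s by (simp add: D_def image_image)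
  define L where "L = J closure_of D"
  have DL: "D \<subseteq> L" using DJ closure_of_subset L_def by metis
  have LJ: "L \<subseteq> topspace J" unfolding L_def by (rule closure_of_subset_topspace)
  have uL: "u ` L = u ` topspace J" using uD DL LJ by blast
  define e :: "'j \<Rightarrow> 'a set set" where "e = (\<lambda>z. {u ` (N \<inter> D) | N. openin J N \<and> z \<in> N})"
  have "inj_on e L"
  proof (rule inj_onI, rule ccontr)
    fix z z' assume z: "z \<in> L" "z' \<in> L" and eq: "e z = e z'" and ne: "z \<noteq> z'"
    obtain N N' where N: "openin J N" "openin J N'" "z \<in> N" "z' \<in> N'" "disjnt N N'"
      using J ne z LJ unfolding compact_Hausdorff_def Hausdorff_space_def by (meson subsetD)
    have "u ` (N \<inter> D) \<in> e z" using N by (auto simp: e_def)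
    then obtain M where M: "openin J M" "z' \<in> M" "u ` (N \<inter> D) = u ` (M \<inter> D)"
      unfolding eq by (auto simp: e_def)
    then have "N \<inter> D = M \<inter> D"
      using inj_on_image_eq_iff[OF injD, of "N \<inter> D" "M \<inter> D"] by simp
    \<comment> \<open>As \<open>z'\<close> lies in the closure of \<open>D\<close>, its
      neighbourhood \<open>M \<inter> N'\<close> contains some \<open>d\<close> in \<open>D\<close>.
      Then \<open>d\<close> is in \<open>M \<inter> D = N \<inter> D\<close>, contradicting the
      disjointness of \<open>N\<close> and \<open>N'\<close>.\<close>
    moreover have "openin J (M \<inter> N')" "z' \<in> M \<inter> N'" using M N by auto
    then obtain d where "d \<in> D" "d \<in> M" "d \<in> N'"
      using z(2) unfolding L_def in_closure_of by blast
    ultimately show False using N(5) by (auto simp: disjnt_iff)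
  qed
  define JL where "JL = subtopology J L"
  have tJL: "topspace JL = L" using LJ by (auto simp: JL_def)
  define K where "K = quot_topology JL e"
  have hom: "homeomorphic_map JL K e"
    unfolding K_def by (rule homeomorphic_map_quot_topology) (simp add: tJL \<open>inj_on e L\<close>)
  have cL: "compact_space JL"
    using J closedin_compact_space[of J L] closedin_closure_of[of J D]
    by (simp add: JL_def L_def compact_Hausdorff_def compact_space_subtopology)
  have hL: "Hausdorff_space JL"
    using J by (simp add: JL_def Hausdorff_space_subtopology compact_Hausdorff_def)
  have K: "compact_space K" "Hausdorff_space K"
    using homeomorphic_compact_Hausdorff[OF hom] cL hL by (auto simp: compact_Hausdorff_def)
  obtain d where d: "continuous_map K JL d" "\<And>z. z \<in> L \<Longrightarrow> d (e z) = z"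
    using hom unfolding homeomorphic_map_maps homeomorphic_maps_def tJL by metis
  have "continuous_map K X (u \<circ> d)"
    using continuous_map_compose[OF d(1), of X u] continuous_map_from_subtopology[OF u, of L] by (simp add: JL_def)
  then have "test_map K X (u \<circ> d)" using K by (simp add: test_map_def)
  then have "closedin X ((u \<circ> d) ` topspace K)" using X unfolding weak_Hausdorff_def by blast
  moreover have "topspace K = e ` L"
    unfolding K_def topspace_quot_topology tJL ..
  then have "(u \<circ> d) ` topspace K = u ` L"
    using d(2) by (simp add: image_image)
  ultimately show ?thesis using uL by simp
qed

text \<open>Closed subsets of \<open>J\<close> are again compact Hausdorff, so \<open>u\<close> is a
  closed map onto its image. Normality passes along closed continuous surjections, and images of
  points are closed; a normal T1 space is Hausdorff.\<close>

lemma weak_Hausdorff_Hausdorff_image: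
  assumes X: "weak_Hausdorff X" and J: "compact_Hausdorff J" and u: "continuous_map J X u"
  shows "Hausdorff_space (subtopology X (u ` topspace J))"
proof -
  let ?I = "subtopology X (u ` topspace J)"
  have tI: "topspace ?I = u ` topspace J"
    using u by (auto simp: continuous_map_def)
  have cl: "closedin X (u ` C)" if "closedin J C" for C
  proof -
    have C: "compact_Hausdorff (subtopology J C)"
      using J that by (simp add: compact_Hausdorff_def Hausdorff_space_subtopology
          closedin_compact_space compact_space_subtopology)
    have "topspace (subtopology J C) = C" using closedin_subset[OF that] by auto
    then show ?thesis
      using weak_Hausdorff_closed_image[OF X C continuous_map_from_subtopology[OF u]] by simp
  qed
  have clI: "closed_map J ?I u"
    unfolding closed_map_def
  proof (intro allI impI)
    fix C assume C: "closedin J C"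
    show "closedin ?I (u ` C)"
      using cl[OF C] closedin_subset[OF C] by (simp add: closedin_subset_topspace image_mono)
  qed
  have "normal_space J"
    using J compact_Hausdorff_or_regular_imp_normal_space compact_Hausdorff_def by blast
  moreover have "continuous_map J ?I u"
    using u by (simp add: continuous_map_in_subtopology)
  ultimately have "normal_space ?I"
    using clI tI by (metis normal_space_continuous_closed_map_image)
  moreover have "t1_space ?I"
    unfolding t1_space_closedin_singleton
  proof
    fix x assume "x \<in> topspace ?I"
    then obtain z where z: "z \<in> topspace J" "x = u z" using tI by auto
    then have "closedin J {z}" using J closedin_Hausdorff_singleton compact_Hausdorff_def by metis
    then show "closedin ?I {x}" using clI z by (force simp: closed_map_def)
  qed
  ultimately show ?thesis by (rule normal_t1_imp_Hausdorff_space)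
qed

lemma compact_Hausdorff_image:
  assumes "compact_space J" "continuous_map J X u"
    and "Hausdorff_space (subtopology X (u ` topspace J))"
  shows "compact_Hausdorff (subtopology X (u ` topspace J))"
  using assms image_compactin[of J "topspace J" X u]
  by (simp add: compact_Hausdorff_def compact_space_subtopology compact_space_def[of J])

text \<open>The points of \<open>S\<close> already live in the type of \<open>X\<close>, so
  \<open>x \<mapsto> {{x}}\<close> turns a compact Hausdorff subspace into an admissible test
  space.\<close>

lemma test_map_of_subspace:
  fixes X :: "'a topology"
  assumes "compact_Hausdorff (subtopology X S)" "S \<subseteq> topspace X"
  obtains K :: "'a set set topology" and d where "test_map K X d" "d ` topspace K = S"
    "homeomorphic_map (subtopology X S) K (\<lambda>x. {{x}})" "\<And>x. x \<in> S \<Longrightarrow> d {{x}} = x"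
proof -
  let ?S = "subtopology X S"
  define K :: "'a set set topology" where "K = quot_topology ?S (\<lambda>x. {{x}})"
  have tS: "topspace ?S = S" using assms by auto
  have hom: "homeomorphic_map ?S K (\<lambda>x. {{x}})"
    unfolding K_def by (rule homeomorphic_map_quot_topology) (auto simp: inj_on_def)
  obtain d where d: "continuous_map K ?S d" "\<And>z. z \<in> S \<Longrightarrow> d {{z}} = z"
    using hom unfolding homeomorphic_map_maps homeomorphic_maps_def tS by metis
  have "compact_space K" "Hausdorff_space K"
    using homeomorphic_compact_Hausdorff[OF hom] assms(1) by (auto simp: compact_Hausdorff_def)
  moreover have "continuous_map K X d"
    using d(1) continuous_map_into_fulltopology by blast
  ultimately have "test_map K X d" by (simp add: test_map_def)
  moreover have "topspace K = (\<lambda>x. {{x}}) ` S"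
    unfolding K_def topspace_quot_topology tS ..
  then have "d ` topspace K = S"
    using d(2) by (simp add: image_image)
  ultimately show thesis using hom d(2) by (rule that)
qed

text \<open>The map factors through its image, which is compact Hausdorff and hence a copy of a test
  space; test maps pull open sets of \<open>kify X\<close> back to open sets. Hausdorffness is asked
  of the image alone because \<open>continuous_map_curry\<close> applies this to a compact-open
  topology.\<close>

lemma continuous_map_kify_gen:
  fixes X :: "'a topology"
  assumes J: "compact_space J" and u: "continuous_map J X u"
    and H: "Hausdorff_space (subtopology X (u ` topspace J))"
  shows "continuous_map J (kify X) u"
  unfolding continuous_map_def
proof (intro conjI allI impI)
  let ?I = "subtopology X (u ` topspace J)"
  show "u \<in> topspace J \<rightarrow> topspace (kify X)" using u by (auto simp: continuous_map_def)
  have sub: "u ` topspace J \<subseteq> topspace X" using u by (auto simp: continuous_map_def)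
  obtain K :: "'a set set topology" and d where
    K: "test_map K X d" "homeomorphic_map ?I K (\<lambda>x. {{x}})" "\<And>x. x \<in> u ` topspace J \<Longrightarrow> d {{x}} = x"
    by (rule test_map_of_subspace[OF compact_Hausdorff_image[OF J u H] sub]) blast
  have v: "continuous_map J K (\<lambda>z. {{u z}})"
    using continuous_map_compose[of J ?I u K "\<lambda>x. {{x}}"] u homeomorphic_imp_continuous_map[OF K(2)]
    by (simp add: o_def continuous_map_in_subtopology)
  fix U assume "openin (kify X) U"
  then have "openin K {z \<in> topspace K. d z \<in> U}" using K(1) by (simp add: openin_kify)
  then have "openin J {z \<in> topspace J. {{u z}} \<in> {z \<in> topspace K. d z \<in> U}}"
    by (rule openin_continuous_map_preimage[OF v])
  moreover have "{z \<in> topspace J. {{u z}} \<in> {z \<in> topspace K. d z \<in> U}} = {z \<in> topspace J. u z \<in> U}"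
    using K(3) v by (auto simp: continuous_map_def)
  ultimately show "openin J {z \<in> topspace J. u z \<in> U}" by simp
qed

lemma continuous_map_kify:
  assumes "weak_Hausdorff X" "compact_Hausdorff J" "continuous_map J X u"
  shows "continuous_map J (kify X) u"
  using assms continuous_map_kify_gen weak_Hausdorff_Hausdorff_image compact_Hausdorff_def by metis

section \<open>Continuity on k-ified products\<close>

lemma Hausdorff_imp_weak_Hausdorff: "Hausdorff_space X \<Longrightarrow> weak_Hausdorff X"
  unfolding weak_Hausdorff_def test_map_def
  by (metis compact_space_def compactin_imp_closedin image_compactin)

text \<open>The image of \<open>u\<close> is compact and lies in the product of its two projections.
  These are closed and Hausdorff, so the image is closed in their product, and that product is
  closed in the whole space.\<close>

lemma weak_Hausdorff_prod_topology:
  assumes X: "weak_Hausdorff X" and Y: "weak_Hausdorff Y"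
  shows "weak_Hausdorff (prod_topology X Y)"
  unfolding weak_Hausdorff_def
proof (intro allI impI)
  fix K :: "('a \<times> 'b) set set topology" and u assume t: "test_map K (prod_topology X Y) u"
  then have K: "compact_Hausdorff K" and u: "continuous_map K (prod_topology X Y) u"
    by (auto simp: test_map_def compact_Hausdorff_def)
  have u1: "continuous_map K X (fst \<circ> u)" and u2: "continuous_map K Y (snd \<circ> u)"
    using u by (auto simp: continuous_map_pairwise)
  let ?A = "(fst \<circ> u) ` topspace K" and ?B = "(snd \<circ> u) ` topspace K"
  have "Hausdorff_space (prod_topology (subtopology X ?A) (subtopology Y ?B))"
    using weak_Hausdorff_Hausdorff_image[OF X K u1] weak_Hausdorff_Hausdorff_image[OF Y K u2]
    by (simp add: Hausdorff_space_prod_topology)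
  then have H: "Hausdorff_space (subtopology (prod_topology X Y) (?A \<times> ?B))"
    unfolding subtopology_Times .
  have "compactin (prod_topology X Y) (u ` topspace K)"
    using K u by (auto simp: compact_Hausdorff_def compact_space_def intro: image_compactin)
  moreover have sub: "u ` topspace K \<subseteq> ?A \<times> ?B" by (simp add: image_subset_iff mem_Times_iff)
  ultimately have "compactin (subtopology (prod_topology X Y) (?A \<times> ?B)) (u ` topspace K)"
    by (simp add: compactin_subtopology)
  then have "closedin (subtopology (prod_topology X Y) (?A \<times> ?B)) (u ` topspace K)"
    using H compactin_imp_closedin by blast
  moreover have "closedin (prod_topology X Y) (?A \<times> ?B)"
    using weak_Hausdorff_closed_image[OF X K u1] weak_Hausdorff_closed_image[OF Y K u2]
    by (simp add: closedin_prod_Times_iff)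
  ultimately show "closedin (prod_topology X Y) (u ` topspace K)"
    using closedin_trans_full by blast
qed

lemma topspace_kprod [simp]: "topspace (kprod X Y) = topspace X \<times> topspace Y"
  by (simp add: kprod_def)

lemma continuous_map_kprod_comp:
  assumes h: "continuous_map (kprod X Y) Z h" and K: "compact_Hausdorff K"
    and X: "weak_Hausdorff X" "continuous_map K X a" and Y: "weak_Hausdorff Y" "continuous_map K Y b"
  shows "continuous_map K Z (\<lambda>z. h (a z, b z))"
proof -
  have "continuous_map K (kprod X Y) (\<lambda>z. (a z, b z))"
    unfolding kprod_def
    using X Y K by (intro continuous_map_kify weak_Hausdorff_prod_topology)
      (auto simp: continuous_map_pairwise o_def)
  then show ?thesis using continuous_map_compose[OF _ h] by (simp add: o_def)
qed

text \<open>Together with \<open>continuous_map_kprod_comp\<close> this reduces continuity on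
  \<open>kprod\<close> to pairs of maps out of one compact Hausdorff space; from here on the
  topology of \<open>kprod\<close> is accessed only through these two rules.\<close>

lemma continuous_map_from_kprod:
  assumes "\<And>(K :: ('a \<times> 'b) set set topology) a b. \<lbrakk>compact_Hausdorff K; continuous_map K X a; continuous_map K Y b\<rbrakk>
      \<Longrightarrow> continuous_map K Z (\<lambda>z. h (a z, b z))"
    and "\<And>x y. x \<in> topspace X \<Longrightarrow> y \<in> topspace Y \<Longrightarrow> h (x, y) \<in> topspace Z"
  shows "continuous_map (kprod (X :: 'a topology) (Y :: 'b topology)) Z h"
  unfolding kprod_def
proof (rule continuous_map_from_kify)
  fix K u assume "test_map K (prod_topology X Y) u"
  then have "continuous_map K Z (\<lambda>z. h (fst (u z), snd (u z)))"
    by (intro assms(1)) (auto simp: test_map_def compact_Hausdorff_def continuous_map_pairwise o_def)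
  then show "continuous_map K Z (\<lambda>z. h (u z))" by simp
qed (use assms(2) in auto)

text \<open>A continuous surjection from a compact space onto a Hausdorff space is a quotient
  map.\<close>

lemma continuous_map_from_surjection:
  assumes "compact_space P" "Hausdorff_space J" "continuous_map P J q" "q ` topspace P = topspace J"
    and "continuous_map P Y (\<lambda>p. f (q p))"
  shows "continuous_map J Y f"
  using continuous_compose_quotient_map[OF continuous_imp_quotient_map[OF assms(3,1,2,4)], of Y f] assms(5)
  by (simp add: o_def)


section \<open>Mapping spaces\<close>

lemma topspace_compact_open [simp]: "topspace (compact_open X Y) = based_maps X Y"
proof -
  \<comment> \<open>With the empty test space the condition on \<open>f\<close> is void, so the
    whole of \<open>based_maps X Y\<close> is one of the generating sets.\<close>
  let ?K = "trivial_topology :: 'a set set topology"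
  have "test_map ?K (Sp X) (\<lambda>z. undefined)"
    by (simp add: test_map_def)
  then have "based_maps X Y \<in> {{f \<in> based_maps X Y. \<forall>z\<in>topspace K. f (u z) \<in> U} | K u U.
        test_map K (Sp X) u \<and> openin (Sp Y) U}"
    by (intro CollectI exI[of _ ?K] exI[of _ "\<lambda>z. undefined"] exI[of _ "{}"]) auto
  then show ?thesis unfolding compact_open_def topology_generated_by_topspace by blast
qed

text \<open>The condition depends on \<open>b\<close> only through its image, a compact Hausdorff
  subspace, which can be replaced by a test space of the admissible type.\<close>

lemma openin_compact_open_image:
  assumes X: "weak_Hausdorff (Sp X)" and N: "compact_Hausdorff N" and b: "continuous_map N (Sp X) b"
    and V: "openin (Sp Y) V"
  shows "openin (compact_open X Y) {f \<in> based_maps X Y. \<forall>z\<in>topspace N. f (b z) \<in> V}"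
proof -
  have sub: "b ` topspace N \<subseteq> topspace (Sp X)" using b by (auto simp: continuous_map_def)
  have "compact_Hausdorff (subtopology (Sp X) (b ` topspace N))"
    using N b compact_Hausdorff_image weak_Hausdorff_Hausdorff_image[OF X N b] compact_Hausdorff_def by blast
  then obtain K :: "'a set set topology" and d where
    K: "test_map K (Sp X) d" "d ` topspace K = b ` topspace N"
    by (rule test_map_of_subspace[OF _ sub])
  have "(\<forall>z\<in>topspace N. f (b z) \<in> V) \<longleftrightarrow> (\<forall>z\<in>topspace K. f (d z) \<in> V)" for f
    using ball_simps(9)[of b "topspace N" "\<lambda>x. f x \<in> V"] ball_simps(9)[of d "topspace K" "\<lambda>x. f x \<in> V"]
    unfolding K(2) by simp
  then have "{f \<in> based_maps X Y. \<forall>z\<in>topspace N. f (b z) \<in> V} =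
      {f \<in> based_maps X Y. \<forall>z\<in>topspace K. f (d z) \<in> V}"
    by simp
  moreover have "openin (compact_open X Y) {f \<in> based_maps X Y. \<forall>z\<in>topspace K. f (d z) \<in> V}"
    unfolding compact_open_def
    by (rule topology_generated_by_Basis) (use K V in blast)
  ultimately show ?thesis by simp
qed

text \<open>Evaluation need not be continuous for the compact-open topology, but over a compact
  Hausdorff \<open>K\<close> it is: regularity gives a closed neighbourhood \<open>N\<close> of
  \<open>z0\<close> on which \<open>a z0 (b z)\<close> stays in \<open>V\<close>, and by continuity
  of \<open>a\<close> the maps \<open>a z\<close> for nearby \<open>z\<close> also send
  \<open>b\<close> of this same \<open>N\<close> into \<open>V\<close>.\<close>

lemma continuous_map_eval:
  assumes X: "weak_Hausdorff (Sp X)" and K: "compact_Hausdorff K"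
    and a: "continuous_map K (compact_open X Y) a" and b: "continuous_map K (Sp X) b"
  shows "continuous_map K (Sp Y) (\<lambda>z. a z (b z))"
  unfolding continuous_map_def
proof (intro conjI allI impI)
  have am: "a z \<in> based_maps X Y" if "z \<in> topspace K" for z
    using a that by (auto simp: continuous_map_def)
  have bm: "b z \<in> points X" if "z \<in> topspace K" for z
    using b that by (auto simp: continuous_map_def)
  show "(\<lambda>z. a z (b z)) \<in> topspace K \<rightarrow> topspace (Sp Y)"
    using am bm by (auto simp: based_maps_def continuous_map_def)
  fix V assume V: "openin (Sp Y) V"
  show "openin K {z \<in> topspace K. a z (b z) \<in> V}"
  proof (subst openin_subopen, intro ballI)
    fix z0 assume z0: "z0 \<in> {z \<in> topspace K. a z (b z) \<in> V}"
    have "continuous_map K (Sp Y) (\<lambda>z. a z0 (b z))"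
      using am[of z0] z0 continuous_map_compose[OF b, of "Sp Y" "a z0"] by (auto simp: based_maps_def o_def)
    then have o: "openin K {z \<in> topspace K. a z0 (b z) \<in> V}"
      by (rule openin_continuous_map_preimage[OF _ V])
    have "regular_space K"
      using K compact_Hausdorff_def compact_Hausdorff_imp_regular_space by metis
    moreover have "z0 \<in> {z \<in> topspace K. a z0 (b z) \<in> V}" using z0 by simp
    ultimately obtain M N where MN: "openin K M" "closedin K N" "z0 \<in> M" "M \<subseteq> N"
        "N \<subseteq> {z \<in> topspace K. a z0 (b z) \<in> V}"
      using o unfolding neighbourhood_base_of_closedin[symmetric] neighbourhood_base_of by meson
    have tN: "topspace (subtopology K N) = N" using closedin_subset[OF MN(2)] by auto
    have "openin (compact_open X Y) {f \<in> based_maps X Y. \<forall>z\<in>topspace (subtopology K N). f (b z) \<in> V}"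
      using K MN(2) by (intro openin_compact_open_image X V continuous_map_from_subtopology b)
        (auto simp: compact_Hausdorff_def Hausdorff_space_subtopology closedin_compact_space compact_space_subtopology)
    then have "openin K {z \<in> topspace K. a z \<in> {f \<in> based_maps X Y. \<forall>z\<in>N. f (b z) \<in> V}}"
      unfolding tN by (rule openin_continuous_map_preimage[OF a])
    then have "openin K (M \<inter> {z \<in> topspace K. a z \<in> {f \<in> based_maps X Y. \<forall>z\<in>N. f (b z) \<in> V}})"
      using MN(1) by blast
    moreover have "z0 \<in> M \<inter> {z \<in> topspace K. a z \<in> {f \<in> based_maps X Y. \<forall>z\<in>N. f (b z) \<in> V}}"
      using MN z0 am by auto
    moreover have "M \<inter> {z \<in> topspace K. a z \<in> {f \<in> based_maps X Y. \<forall>z\<in>N. f (b z) \<in> V}}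
        \<subseteq> {z \<in> topspace K. a z (b z) \<in> V}"
      using MN(4) by auto
    ultimately show "\<exists>T. openin K T \<and> z0 \<in> T \<and> T \<subseteq> {z \<in> topspace K. a z (b z) \<in> V}"
      by (intro exI[of _ "M \<inter> {z \<in> topspace K. a z \<in> {f \<in> based_maps X Y. \<forall>z\<in>N. f (b z) \<in> V}}"] conjI)
  qed
qed

text \<open>The adjoint of \<open>h\<close> is continuous into the compact-open topology by the tube
  lemma. To pass to the k-ification it suffices that the image of the compact space \<open>J\<close>
  be Hausdorff, which holds because evaluation at a point has Hausdorff image in the weak Hausdorff
  space \<open>Y\<close>.\<close>

lemma continuous_map_curry:
  assumes X: "weak_Hausdorff (Sp X)" and Y: "weak_Hausdorff (Sp Y)" and J: "compact_Hausdorff J"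
    and h: "continuous_map (kprod J (Sp X)) (Sp Y) h"
    and g: "\<And>j. j \<in> topspace J \<Longrightarrow> g j \<in> based_maps X Y"
    and gh: "\<And>j x. j \<in> topspace J \<Longrightarrow> x \<in> points X \<Longrightarrow> g j x = h (j, x)"
  shows "continuous_map J (kify (compact_open X Y)) g"
proof (rule continuous_map_kify_gen)
  show cJ: "compact_space J" using J by (simp add: compact_Hausdorff_def)
  show c: "continuous_map J (compact_open X Y) g"
    unfolding compact_open_def
  proof (rule continuous_on_generated_topo)
    show "g ` topspace J \<subseteq> \<Union> {{f \<in> based_maps X Y. \<forall>z\<in>topspace K. f (u z) \<in> U} | K u U.
        test_map K (Sp X) u \<and> openin (Sp Y) U}"
      using g topspace_compact_open[of X Y] unfolding compact_open_def topology_generated_by_topspace by auto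
    fix S assume "S \<in> {{f \<in> based_maps X Y. \<forall>z\<in>topspace K. f (u z) \<in> U} | K u U.
        test_map K (Sp X) u \<and> openin (Sp Y) U}"
    then obtain K u U where S: "S = {f \<in> based_maps X Y. \<forall>z\<in>topspace K. f (u z) \<in> U}"
      and t: "test_map K (Sp X) u" and U: "openin (Sp Y) U" by auto
    have K: "compact_Hausdorff K" and u: "continuous_map K (Sp X) u"
      using t by (auto simp: test_map_def compact_Hausdorff_def)
    have um: "u z \<in> points X" if "z \<in> topspace K" for z
      using u that by (auto simp: continuous_map_def)
    let ?P = "prod_topology J K"
    have "compact_Hausdorff ?P"
      using J K by (auto simp: compact_Hausdorff_def compact_space_prod_topology Hausdorff_space_prod_topology)
    moreover have "continuous_map ?P (Sp X) (\<lambda>p. u (snd p))"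
      using continuous_map_compose[OF continuous_map_snd u] by (simp add: o_def)
    ultimately have "continuous_map ?P (Sp Y) (\<lambda>p. h (fst p, u (snd p)))"
      using Hausdorff_imp_weak_Hausdorff[of J] J X
      by (intro continuous_map_kprod_comp[OF h] continuous_map_fst) (auto simp: compact_Hausdorff_def)
    then have W: "openin ?P {p \<in> topspace ?P. h (fst p, u (snd p)) \<in> U}"
      by (rule openin_continuous_map_preimage[OF _ U])
    show "openin J (g -` S \<inter> topspace J)"
    proof (subst openin_subopen, intro ballI)
      fix j assume j: "j \<in> g -` S \<inter> topspace J"
      have "{j} \<times> topspace K \<subseteq> {p \<in> topspace ?P. h (fst p, u (snd p)) \<in> U}"
        using j gh um by (auto simp: S)
      then obtain A B where "openin J A" "openin K B" "j \<in> A" "topspace K \<subseteq> B"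
          "A \<times> B \<subseteq> {p \<in> topspace ?P. h (fst p, u (snd p)) \<in> U}"
        using tube_lemma_right[OF W, of "topspace K" j] K j by (auto simp: compact_Hausdorff_def compact_space_def)
      then have "openin J A \<and> j \<in> A \<and> A \<subseteq> g -` S \<inter> topspace J"
        using g gh um openin_subset[of J A] by (fastforce simp: S subset_iff)
      then show "\<exists>T. openin J T \<and> j \<in> T \<and> T \<subseteq> g -` S \<inter> topspace J" by blast
    qed
  qed
  show "Hausdorff_space (subtopology (compact_open X Y) (g ` topspace J))"
    unfolding Hausdorff_space_def
  proof (intro allI impI)
    let ?G = "subtopology (compact_open X Y) (g ` topspace J)"
    have tG: "topspace ?G = g ` topspace J" using g by auto
    fix f f' assume f: "f \<in> topspace ?G \<and> f' \<in> topspace ?G \<and> f \<noteq> f'"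
    then have "f \<in> based_maps X Y" "f' \<in> based_maps X Y" by auto
    \<comment> \<open>Elements of \<open>based_maps\<close> are extensional, so distinct ones differ
      at a point \<open>x\<close> of \<open>X\<close>; separating the two values separates the
      functions.\<close>
    then obtain x where x: "x \<in> points X" "f x \<noteq> f' x"
      using f by (auto simp: based_maps_def intro: extensionalityI)
    let ?E = "subtopology (Sp Y) ((\<lambda>j. g j x) ` topspace J)"
    have ev: "continuous_map J (Sp Y) (\<lambda>j. g j x)"
      using x by (intro continuous_map_eval[OF X J c]) auto
    then have H: "Hausdorff_space ?E" by (rule weak_Hausdorff_Hausdorff_image[OF Y J])
    have mem: "f x \<in> topspace ?E" "f' x \<in> topspace ?E"
      using f ev unfolding tG by (auto simp: continuous_map_def)
    obtain U V where UV: "openin ?E U" "openin ?E V" "f x \<in> U" "f' x \<in> V" "disjnt U V"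
      using H mem x unfolding Hausdorff_space_def by meson
    then obtain U' V' where U': "openin (Sp Y) U'" "U = U' \<inter> (\<lambda>j. g j x) ` topspace J"
      and V': "openin (Sp Y) V'" "V = V' \<inter> (\<lambda>j. g j x) ` topspace J"
      by (auto simp: openin_subtopology)
    let ?O = "\<lambda>W. {f \<in> based_maps X Y. f x \<in> W}"
    have op: "openin ?G (?O W \<inter> g ` topspace J)" if W: "openin (Sp Y) W" for W
    proof -
      \<comment> \<open>A one-point compact space shows that the conditions
        \<open>f x \<in> W\<close> are open.\<close>
      let ?N = "discrete_topology {()}"
      have "openin (compact_open X Y) {f \<in> based_maps X Y. \<forall>z\<in>topspace ?N. f ((\<lambda>_. x) z) \<in> W}"
        using x W by (intro openin_compact_open_image X)
          (auto simp: compact_Hausdorff_def compact_space_discrete_topology)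
      then show ?thesis by (simp add: openin_subtopology_Int)
    qed
    have "disjnt (?O U' \<inter> g ` topspace J) (?O V' \<inter> g ` topspace J)"
      using UV(5) U'(2) V'(2) by (auto simp: disjnt_iff)
    moreover have "f \<in> ?O U' \<inter> g ` topspace J" "f' \<in> ?O V' \<inter> g ` topspace J"
      using f UV U' V' unfolding tG by (auto simp: g)
    ultimately show "\<exists>U V. openin ?G U \<and> openin ?G V \<and> f \<in> U \<and> f' \<in> V \<and> disjnt U V"
      using op[OF U'(1)] op[OF V'(1)] by blast
  qed
qed

section \<open>One-point compactifications\<close>

lemma continuous_map_the:
  "continuous_map (subtopology (Alexandroff_compactification X) (Some ` topspace X)) X the"
  unfolding continuous_map_def
proof (intro conjI allI impI)
  let ?S = "subtopology (Alexandroff_compactification X) (Some ` topspace X)"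
  show "the \<in> topspace ?S \<rightarrow> topspace X" by auto
  fix U assume U: "openin X U"
  have "{z \<in> topspace ?S. the z \<in> U} = Some ` U \<inter> Some ` topspace X"
    using openin_subset[OF U] by auto
  moreover have "openin ?S (Some ` U \<inter> Some ` topspace X)"
    using U by (intro openin_subtopology_Int) simp
  ultimately show "openin ?S {z \<in> topspace ?S. the z \<in> U}" by simp
qed

text \<open>Here \<open>r\<close> is the finite part of \<open>f\<close>, defined on the open set
  \<open>W\<close>. Assumption \<open>T\<close> is properness: the preimage of a closed compact
  \<open>C\<close> stays inside a subset of \<open>W\<close> that is closed in all of
  \<open>P\<close>, so it does not accumulate at the points sent to infinity.\<close>

lemma continuous_map_into_Alexandroff:
  assumes W: "openin P W" and r: "continuous_map (subtopology P W) B r"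
    and T: "\<And>C. \<lbrakk>compactin B C; closedin B C\<rbrakk> \<Longrightarrow> \<exists>T. closedin P T \<and> T \<subseteq> W \<and> (\<forall>z\<in>W. r z \<in> C \<longrightarrow> z \<in> T)"
    and f: "\<And>z. z \<in> W \<Longrightarrow> f z = Some (r z)" "\<And>z. \<lbrakk>z \<in> topspace P; z \<notin> W\<rbrakk> \<Longrightarrow> f z = None"
  shows "continuous_map P (Alexandroff_compactification B) f"
  unfolding continuous_map_def
proof (intro conjI allI impI)
  have WP: "W \<subseteq> topspace P" using W by (rule openin_subset)
  have rB: "r z \<in> topspace B" if "z \<in> W" for z
    using r that WP by (auto simp: continuous_map_def)
  show "f \<in> topspace P \<rightarrow> topspace (Alexandroff_compactification B)"
  proof
    fix z assume "z \<in> topspace P"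
    then show "f z \<in> topspace (Alexandroff_compactification B)"
      using f rB by (cases "z \<in> W") auto
  qed
  fix V assume "openin (Alexandroff_compactification B) V"
  then consider U where "openin B U" "V = Some ` U"
    | C where "compactin B C" "closedin B C" "V = insert None (Some ` (topspace B - C))"
    unfolding openin_Alexandroff_compactification by blast
  then show "openin P {z \<in> topspace P. f z \<in> V}"
  proof cases
    case 1
    have "openin (subtopology P W) {z \<in> topspace (subtopology P W). r z \<in> U}"
      using r 1(1) by (rule openin_continuous_map_preimage)
    then have "openin P {z \<in> topspace (subtopology P W). r z \<in> U}"
      by (rule openin_trans_full[OF _ W])
    moreover have "{z \<in> topspace (subtopology P W). r z \<in> U} = {z \<in> topspace P. f z \<in> V}"
    proof (rule Set.set_eqI)
      fix z
      show "z \<in> {z \<in> topspace (subtopology P W). r z \<in> U} \<longleftrightarrow> z \<in> {z \<in> topspace P. f z \<in> V}"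
        using f[of z] WP 1(2) by (cases "z \<in> W") auto
    qed
    ultimately show ?thesis by simp
  next
    case 2
    obtain T where T': "closedin P T" "T \<subseteq> W" "\<And>z. z \<in> W \<Longrightarrow> r z \<in> C \<Longrightarrow> z \<in> T"
      using T[OF 2(1,2)] by blast
    \<comment> \<open>This preimage is so far closed only in \<open>W\<close>; intersecting with
      \<open>T\<close>, which contains it and lies in \<open>W\<close>, makes it closed in
      \<open>P\<close>.\<close>
    have "closedin (subtopology P W) {z \<in> topspace (subtopology P W). r z \<in> C}"
      using r 2(2) by (rule closedin_continuous_map_preimage)
    then obtain D where D: "closedin P D" "{z \<in> topspace (subtopology P W). r z \<in> C} = D \<inter> W"
      by (auto simp: closedin_subtopology)
    have "D \<inter> T = {z \<in> W. r z \<in> C}"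
      using D(2) T' WP by auto
    moreover have "closedin P (D \<inter> T)" using D(1) T'(1) by (rule closedin_Int)
    ultimately have "openin P (topspace P - {z \<in> W. r z \<in> C})" by (simp add: closedin_def)
    moreover have "topspace P - {z \<in> W. r z \<in> C} = {z \<in> topspace P. f z \<in> V}"
    proof (rule Set.set_eqI)
      fix z
      show "z \<in> topspace P - {z \<in> W. r z \<in> C} \<longleftrightarrow> z \<in> {z \<in> topspace P. f z \<in> V}"
        using f[of z] rB[of z] 2(3) by (cases "z \<in> W") auto
    qed
    ultimately show ?thesis by simp
  qed
qed


section \<open>Orthonormal families of finitely supported vectors\<close>

definition ax :: "nat \<Rightarrow> vec" where
  "ax i = (\<lambda>j. if j = i then 1 else 0)"

definition lincomb :: "(nat \<Rightarrow> vec) \<Rightarrow> nat \<Rightarrow> vec \<Rightarrow> vec" where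
  "lincomb e n c = (\<lambda>j. \<Sum>i<n. c i * e i j)"

definition shift :: "nat \<Rightarrow> vec \<Rightarrow> vec" where
  "shift k v = (\<lambda>i. if i < k then 0 else v (i - k))"

text \<open>Finite dimension is expressed by a common bound on the supports, which suffices for
  spaces of finitely supported sequences and hands out an ambient \<open>CC n\<close>.\<close>

definition fd_subspace :: "vec set \<Rightarrow> bool" where
  "fd_subspace V \<longleftrightarrow> 0 \<in> V \<and> (\<forall>u\<in>V. \<forall>v\<in>V. u + v \<in> V) \<and> (\<forall>c. \<forall>u\<in>V. vscale c u \<in> V) \<and> (\<exists>n. V \<subseteq> CC n)"

definition orthonormal :: "nat \<Rightarrow> (nat \<Rightarrow> vec) \<Rightarrow> bool" where
  "orthonormal n e \<longleftrightarrow> (\<forall>i<n. \<forall>j<n. vinner (e i) (e j) = (if i = j then 1 else 0))"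

lemma fd_subspaceD:
  assumes "fd_subspace V"
  shows "0 \<in> V" "\<And>u v. u \<in> V \<Longrightarrow> v \<in> V \<Longrightarrow> u + v \<in> V" "\<And>c u. u \<in> V \<Longrightarrow> vscale c u \<in> V"
  using assms by (auto simp: fd_subspace_def)

lemma fd_subspace_CC [simp]: "fd_subspace (CC n)"
  by (auto simp: fd_subspace_def CC_def vscale_def)

lemma CC_mono: "m \<le> n \<Longrightarrow> CC m \<subseteq> CC n"
  by (auto simp: CC_def)

lemma CC_inj: "CC m = CC n \<Longrightarrow> m = n"
proof (rule ccontr)
  have *: "ax a \<in> CC b \<and> ax a \<notin> CC a" if "a < b" for a b
    using that by (auto simp: CC_def ax_def)
  assume "CC m = CC n" "m \<noteq> n"
  then show False using *[of m n] *[of n m] by (metis linorder_neqE_nat)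
qed

lemma ax_in_CC [simp]: "ax i \<in> CC n \<longleftrightarrow> i < n"
  by (auto simp: ax_def CC_def not_le)

lemma zero_in_CC [simp]: "0 \<in> CC n" by (simp add: CC_def)

lemma add_in_CC [simp]: "u \<in> CC n \<Longrightarrow> v \<in> CC n \<Longrightarrow> u + v \<in> CC n" by (simp add: CC_def)

lemma vscale_in_CC [simp]: "u \<in> CC n \<Longrightarrow> vscale c u \<in> CC n" by (simp add: CC_def vscale_def)

lemma vtake_in_CC [simp]: "vtake k v \<in> CC k" by (simp add: CC_def vtake_def)

lemma vdrop_in_CC: "v \<in> CC (k + m) \<Longrightarrow> vdrop k v \<in> CC m" by (simp add: CC_def vdrop_def)

lemma shift_in_CC: "v \<in> CC m \<Longrightarrow> shift k v \<in> CC (k + m)" by (auto simp: CC_def shift_def)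

lemma vdrop_shift [simp]: "vdrop k (shift k v) = v" by (simp add: vdrop_def shift_def)

lemma vtake_shift [simp]: "vtake k (shift k v) = 0" by (auto simp: vtake_def shift_def)

lemma vtake_id: "v \<in> CC k \<Longrightarrow> vtake k v = v" by (auto simp: CC_def vtake_def)

lemma vdrop_CC: "v \<in> CC k \<Longrightarrow> vdrop k v = 0" by (auto simp: CC_def vdrop_def)

lemma vtake_plus_shift_vdrop: "vtake k v + shift k (vdrop k v) = v"
  by (auto simp: vtake_def shift_def vdrop_def)

lemma shift_add: "shift k (u + v) = shift k u + shift k v" by (auto simp: shift_def)

lemma shift_vscale: "shift k (vscale c u) = vscale c (shift k u)" by (auto simp: shift_def vscale_def)

lemma shift_0 [simp]: "shift k 0 = 0" by (auto simp: shift_def)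

lemma CC_0: "CC 0 = {0}" by (auto simp: CC_def)

lemma vconj_in_CC [simp]: "v \<in> CC k \<Longrightarrow> vconj s v \<in> CC k" by (simp add: CC_def vconj_def)

lemma vconj_vconj [simp]: "vconj s (vconj t v) = vconj (s \<noteq> t) v" by (auto simp: vconj_def)

lemma vconj_False [simp]: "vconj False v = v" by (simp add: vconj_def)

lemma vconj_0 [simp]: "vconj s 0 = 0" by (auto simp: vconj_def)

lemma vconj_add: "vconj s (u + v) = vconj s u + vconj s v" by (auto simp: vconj_def)

lemma vconj_shift: "vconj s (shift k v) = shift k (vconj s v)" by (auto simp: vconj_def shift_def)

lemma vscale_1 [simp]: "vscale 1 u = u" by (simp add: vscale_def)

lemma vscale_zero [simp]: "vscale 0 u = 0" "vscale c 0 = 0" by (auto simp: vscale_def)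

text \<open>The range of summation in \<open>vinner\<close> is the support of its first argument and
  so changes with it. Over a common \<open>CC n\<close> the range is fixed, which is why
  sesquilinearity below is stated for vectors in some \<open>CC n\<close>.\<close>

lemma vinner_CC:
  assumes "v \<in> CC n" shows "vinner v w = (\<Sum>i<n. v i * cnj (w i))"
  unfolding vinner_def
  by (rule sum.mono_neutral_left) (use assms in \<open>auto simp: CC_def not_le intro: ccontr\<close>)

lemma vinner_add_left:
  "u \<in> CC n \<Longrightarrow> v \<in> CC n \<Longrightarrow> vinner (u + v) w = vinner u w + vinner v w"
  by (simp add: vinner_CC[of u n] vinner_CC[of v n] vinner_CC[of "u + v" n] distrib_right sum.distrib)

lemma vinner_add_right:
  "u \<in> CC n \<Longrightarrow> vinner u (v + w) = vinner u v + vinner u w"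
  by (simp add: vinner_CC distrib_left sum.distrib)

lemma vinner_vscale_left: "u \<in> CC n \<Longrightarrow> vinner (vscale c u) w = c * vinner u w"
  unfolding vinner_CC[OF vscale_in_CC] by (simp add: vinner_CC vscale_def sum_distrib_left mult.assoc)

lemma vinner_vscale_right: "u \<in> CC n \<Longrightarrow> vinner u (vscale c w) = cnj c * vinner u w"
  by (simp add: vinner_CC vscale_def sum_distrib_left ac_simps)

lemma vinner_commute: "u \<in> CC n \<Longrightarrow> v \<in> CC n \<Longrightarrow> vinner v u = cnj (vinner u v)"
  by (simp add: vinner_CC mult.commute)

lemma vinner_0 [simp]: "vinner 0 w = 0" by (simp add: vinner_def)

lemma vinner_self: "v \<in> CC n \<Longrightarrow> vinner v v = complex_of_real (\<Sum>i<n. (cmod (v i))\<^sup>2)"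
  by (simp only: vinner_CC complex_norm_square[symmetric] of_real_sum)

lemma vinner_self_eq_0:
  assumes "v \<in> CC n" "vinner v v = 0" shows "v = 0"
proof
  fix i
  have "(\<Sum>i<n. (cmod (v i))\<^sup>2) = 0"
    using assms vinner_self[of v n] by (metis of_real_eq_0_iff)
  then have "\<forall>i\<in>{..<n}. (cmod (v i))\<^sup>2 = 0"
    by (subst (asm) sum_nonneg_eq_0_iff) auto
  then show "v i = 0 i" using assms(1) by (cases "i < n") (auto simp: CC_def)
qed

lemma vinner_ax_left: "vinner (ax i) w = cnj (w i)"
proof -
  have i: "ax i \<in> CC (Suc i)" by simp
  have "vinner (ax i) w = (\<Sum>j<Suc i. if j = i then cnj (w i) else 0)"
    unfolding vinner_CC[OF i] by (intro sum.cong) (auto simp: ax_def)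
  then show ?thesis by simp
qed

lemma vinner_ax_right: "v \<in> CC n \<Longrightarrow> vinner v (ax i) = v i"
proof -
  assume v: "v \<in> CC n"
  have "vinner v (ax i) = (\<Sum>j<n. if j = i then v i else 0)"
    unfolding vinner_CC[OF v] by (intro sum.cong) (auto simp: ax_def)
  then show ?thesis using v by (auto simp: CC_def)
qed

lemma vinner_vconj: "v \<in> CC n \<Longrightarrow> vinner (vconj s v) (vconj s w) = (if s then cnj (vinner v w) else vinner v w)"
  unfolding vinner_CC[OF vconj_in_CC] by (simp add: vinner_CC vconj_def)

lemma vinner_shift:
  assumes "v \<in> CC m" shows "vinner (shift k v) (shift k w) = vinner v w"
proof -
  have "vinner (shift k v) (shift k w) = (\<Sum>i<k + m. shift k v i * cnj (shift k w i))"
    by (rule vinner_CC[OF shift_in_CC[OF assms]])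
  also have "\<dots> = (\<Sum>i=k..<k + m. shift k v i * cnj (shift k w i))"
    by (rule sum.mono_neutral_right) (auto simp: shift_def)
  also have "\<dots> = (\<Sum>i<m. v i * cnj (w i))"
    by (rule sum.reindex_bij_witness[of _ "\<lambda>i. i + k" "\<lambda>i. i - k"]) (auto simp: shift_def)
  finally show ?thesis using vinner_CC[OF assms] by simp
qed

lemma vinner_CC_shift: "u \<in> CC k \<Longrightarrow> vinner u (shift k v) = 0"
  by (simp add: vinner_CC shift_def)

lemma vinner_shift_CC: "u \<in> CC k \<Longrightarrow> v \<in> CC m \<Longrightarrow> vinner (shift k v) u = 0"
  using vinner_commute[of u "k + m" "shift k v"] CC_mono[of k "k + m"] shift_in_CC[of v m k]
  by (simp add: vinner_CC_shift subset_iff)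

lemma vinner_block:
  assumes "u \<in> CC k" "u' \<in> CC k" "v \<in> CC m" 
  shows "vinner (u + shift k v) (u' + shift k v') = vinner u u' + vinner v v'"
proof -
  have u: "u \<in> CC (k + m)" and v: "shift k v \<in> CC (k + m)"
    using assms CC_mono[of k "k + m"] shift_in_CC by auto
  show ?thesis
    by (simp add: vinner_add_left[OF u v] vinner_add_right[OF u] vinner_add_right[OF v]
        vinner_CC_shift[OF assms(1)] vinner_shift_CC[OF assms(2,3)] vinner_shift[OF assms(3)])
qed

lemma orthogonal_CC_eq_shift:
  assumes "w \<in> CC (k + m)" "\<And>u. u \<in> CC k \<Longrightarrow> vinner w u = 0"
  shows "w = shift k (vdrop k w)"
proof -
  have "w i = 0" if "i < k" for i
    using assms(2)[of "ax i"] that vinner_ax_right[OF assms(1)] by simp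
  then show ?thesis by (auto simp: shift_def vdrop_def)
qed

lemma lincomb_Suc: "lincomb e (Suc n) c = lincomb e n c + vscale (c n) (e n)"
  by (auto simp: lincomb_def vscale_def)

lemma lincomb_0 [simp]: "lincomb e 0 c = 0" by (auto simp: lincomb_def)

lemma lincomb_cong: "(\<And>i. i < n \<Longrightarrow> e i = e' i) \<Longrightarrow> lincomb e n c = lincomb e' n c"
  by (auto simp: lincomb_def)

lemma lincomb_in:
  "fd_subspace V \<Longrightarrow> (\<And>i. i < n \<Longrightarrow> e i \<in> V) \<Longrightarrow> lincomb e n c \<in> V"
  by (induction n) (auto simp: lincomb_Suc fd_subspaceD)

lemma lincomb_add: "lincomb e n (c + d) = lincomb e n c + lincomb e n d"
  by (auto simp: lincomb_def distrib_right sum.distrib)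

lemma lincomb_vscale: "lincomb e n (vscale a c) = vscale a (lincomb e n c)"
  by (auto simp: lincomb_def vscale_def sum_distrib_left mult.assoc)

lemma vinner_lincomb_left:
  "(\<And>i. i < n \<Longrightarrow> e i \<in> CC N) \<Longrightarrow> vinner (lincomb e n c) w = (\<Sum>i<n. c i * vinner (e i) w)"
proof (induction n)
  case (Suc n)
  have l: "lincomb e n c \<in> CC N" "e n \<in> CC N" using Suc.prems by (auto intro: lincomb_in)
  show ?case
    using Suc unfolding lincomb_Suc vinner_add_left[OF l(1) vscale_in_CC[OF l(2)]] vinner_vscale_left[OF l(2)]
    by simp
qed simp

lemma vinner_lincomb_right:
  "w \<in> CC N \<Longrightarrow> vinner w (lincomb e n c) = (\<Sum>i<n. cnj (c i) * vinner w (e i))"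
proof (induction n)
  case 0 then show ?case by (simp add: vinner_CC)
next
  case (Suc n) then show ?case
    unfolding lincomb_Suc vinner_add_right[OF Suc.prems] vinner_vscale_right[OF Suc.prems] by simp
qed

lemma lincomb_ax: "v \<in> CC n \<Longrightarrow> lincomb ax n v = v"
proof
  fix j assume v: "v \<in> CC n"
  have "lincomb ax n v j = (\<Sum>i<n. if i = j then v j else 0)"
    unfolding lincomb_def by (rule sum.cong) (auto simp: ax_def)
  then show "lincomb ax n v j = v j" using v by (auto simp: CC_def)
qed

section \<open>Gram-Schmidt residuals and counting of orthonormal vectors\<close>

lemma sum_delta_if: "(\<Sum>i<(n::nat). f i * (if i = j then 1 else 0)) = (if j < n then f j else (0::complex))"
proof -
  have "(\<Sum>i<n. f i * (if i = j then 1 else 0)) = (\<Sum>i<n. if i = j then f i else 0)"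
    by (rule sum.cong) auto
  also have "\<dots> = (if j \<in> {..<n} then f j else 0)"
    by (rule sum.delta) simp
  finally show ?thesis by simp
qed

lemma vinner_lincomb_orthonormal:
  assumes "orthonormal k e" "\<And>i. i < k \<Longrightarrow> e i \<in> CC N" "j < k"
  shows "vinner (lincomb e k c) (e j) = c j"
proof -
  have "vinner (lincomb e k c) (e j) = (\<Sum>i<k. c i * (if i = j then 1 else 0))"
    using assms by (subst vinner_lincomb_left[of k e N]) (auto simp: orthonormal_def intro!: sum.cong)
  then show ?thesis using assms(3) by (simp only: sum_delta_if if_True)
qed

text \<open>This is the Gram-Schmidt residual of \<open>x\<close>. The last claim holds because the
  projection of \<open>x\<close> is orthogonal to \<open>w\<close>.\<close>

lemma orthonormal_residual:
  assumes e: "orthonormal k e" "\<And>i. i < k \<Longrightarrow> e i \<in> CC N" and x: "x \<in> CC N"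
  defines "w \<equiv> x + vscale (-1) (lincomb e k (\<lambda>i. vinner x (e i)))"
  shows "w \<in> CC N" "\<And>i. i < k \<Longrightarrow> vinner w (e i) = 0" "vinner w w = vinner w x"
proof -
  have l: "lincomb e k c \<in> CC N" for c using e(2) by (intro lincomb_in) auto
  show w: "w \<in> CC N" unfolding w_def using l x by simp
  show o: "vinner w (e i) = 0" if "i < k" for i
    unfolding w_def using vinner_lincomb_orthonormal[OF e that] l x
    by (simp add: vinner_add_left[of _ N] vinner_vscale_left[of _ N])
  have "vinner w w = vinner w x - vinner w (lincomb e k (\<lambda>i. vinner x (e i)))"
    using w by (subst (2) w_def) (simp add: vinner_add_right[of _ N] vinner_vscale_right[of _ N])
  then show "vinner w w = vinner w x" using o by (simp add: vinner_lincomb_right[OF w])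
qed

text \<open>The factor is real so that a conjugation-invariant vector remains invariant after
  normalisation, as \<open>real_frame_exists\<close> needs.\<close>

lemma exists_unit_multiple:
  assumes "w \<in> CC N" "w \<noteq> 0"
  obtains r :: real where "vinner (vscale (of_real r) w) (vscale (of_real r) w) = 1" "r \<noteq> 0"
proof -
  let ?s = "\<Sum>i<N. (cmod (w i))\<^sup>2"
  have "?s \<noteq> 0" using assms vinner_self[of w N] vinner_self_eq_0 by fastforce
  then have s: "?s > 0" using sum_nonneg[of "{..<N}" "\<lambda>i. (cmod (w i))\<^sup>2"] by simp
  define r where "r = 1 / sqrt ?s"
  have "vinner (vscale (of_real r) w) (vscale (of_real r) w) = of_real r * of_real r * of_real ?s"
    using assms(1) by (simp add: vinner_vscale_left[of _ N] vinner_vscale_right[of _ N] vinner_self[of w N])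
  also have "\<dots> = of_real (r * r * ?s)" by simp
  also have "r * r * ?s = 1" using s unfolding r_def by (simp add: power2_eq_square[symmetric] power_divide)
  finally show thesis using that[of r] s r_def by simp
qed

lemma orthonormal_extend_by:
  assumes e: "orthonormal k e" "\<And>i. i < k \<Longrightarrow> e i \<in> CC N"
    and w: "w \<in> CC N" "vinner w w = 1" "\<And>i. i < k \<Longrightarrow> vinner w (e i) = 0"
  shows "orthonormal (Suc k) (e(k := w))" "\<And>i. i < Suc k \<Longrightarrow> (e(k := w)) i \<in> CC N"
proof -
  have "vinner (e i) w = 0" if "i < k" for i
    using vinner_commute[OF w(1) e(2)[OF that]] w(3)[OF that] by simp
  then show "orthonormal (Suc k) (e(k := w))"
    using e w unfolding orthonormal_def by (auto simp: less_Suc_eq)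
  show "\<And>i. i < Suc k \<Longrightarrow> (e(k := w)) i \<in> CC N"
    using e w by (auto simp: less_Suc_eq)
qed

text \<open>Bessel's inequality for the coordinate vector \<open>ax j\<close>, whose coefficients
  are the conjugates of the entries \<open>e i j\<close>. The residual measures the defect exactly:
  its squared norm is its own \<open>j\<close>-th entry.\<close>

lemma orthonormal_column_le:
  assumes e: "orthonormal k e" "\<And>i. i < k \<Longrightarrow> e i \<in> CC N" and j: "j < N"
  defines "w \<equiv> ax j + vscale (-1) (lincomb e k (\<lambda>i. vinner (ax j) (e i)))"
  shows "vinner w w = of_real (1 - (\<Sum>i<k. (cmod (e i j))\<^sup>2))" "(\<Sum>i<k. (cmod (e i j))\<^sup>2) \<le> 1"
proof -
  note r = orthonormal_residual[OF e, of "ax j", folded w_def]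
  have "vinner w w = w j" using r(1,3) j vinner_ax_right[OF r(1)] by simp
  also have "\<dots> = 1 - (\<Sum>i<k. cnj (e i j) * e i j)"
  proof -
    have "w j = ax j j - lincomb e k (\<lambda>i. vinner (ax j) (e i)) j" by (simp add: w_def vscale_def)
    also have "ax j j = 1" by (simp add: ax_def)
    finally show ?thesis by (simp add: lincomb_def vinner_ax_left)
  qed
  also have "\<dots> = of_real (1 - (\<Sum>i<k. (cmod (e i j))\<^sup>2))"
    by (simp only: of_real_diff of_real_sum of_real_1 complex_norm_square mult.commute)
  finally show eq: "vinner w w = of_real (1 - (\<Sum>i<k. (cmod (e i j))\<^sup>2))" .
  have wN: "w \<in> CC N" using r(1) j by simp
  have "of_real (\<Sum>i<N. (cmod (w i))\<^sup>2) = (of_real (1 - (\<Sum>i<k. (cmod (e i j))\<^sup>2)) :: complex)"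
    using eq vinner_self[OF wN] by simp
  then have "(\<Sum>i<N. (cmod (w i))\<^sup>2) = 1 - (\<Sum>i<k. (cmod (e i j))\<^sup>2)" by (rule of_real_eq_iff[THEN iffD1])
  then show "(\<Sum>i<k. (cmod (e i j))\<^sup>2) \<le> 1"
    using sum_nonneg[of "{..<N}" "\<lambda>i. (cmod (w i))\<^sup>2"] by simp
qed

text \<open>Regrouped by vectors, each of norm 1, the sum counts the family. Compared with the
  column bounds of \<open>orthonormal_column_le\<close> this takes the place of a dimension
  argument.\<close>

lemma orthonormal_sum_columns:
  assumes e: "orthonormal k e" "\<And>i. i < k \<Longrightarrow> e i \<in> CC N"
  shows "(\<Sum>j<N. \<Sum>i<k. (cmod (e i j))\<^sup>2) = real k"
proof -
  have "(\<Sum>j<N. (cmod (e i j))\<^sup>2) = 1" if "i < k" for i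
  proof -
    have "vinner (e i) (e i) = 1" using e(1) that by (simp add: orthonormal_def)
    then show ?thesis using vinner_self[OF e(2)[OF that]] by (metis of_real_eq_1_iff)
  qed
  then show ?thesis by (subst sum.swap) simp
qed

lemma orthonormal_card_le:
  assumes e: "orthonormal k e" "\<And>i. i < k \<Longrightarrow> e i \<in> CC N"
  shows "k \<le> N"
proof -
  have "(\<Sum>j<N. \<Sum>i<k. (cmod (e i j))\<^sup>2) \<le> (\<Sum>j<N. 1)"
    by (rule sum_mono) (use orthonormal_column_le(2)[OF e] in auto)
  then show ?thesis using orthonormal_sum_columns[OF e] by simp
qed

text \<open>If all column sums were 1, their total would be \<open>N\<close> instead of
  \<open>k\<close>. So some \<open>ax j\<close> has a nonzero residual, which is normalised.\<close>

lemma orthonormal_extend1: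
  assumes e: "orthonormal k e" "\<And>i. i < k \<Longrightarrow> e i \<in> CC N" and k: "k < N"
  obtains w where "w \<in> CC N" "vinner w w = 1" "\<And>i. i < k \<Longrightarrow> vinner w (e i) = 0"
proof -
  have "\<exists>j<N. (\<Sum>i<k. (cmod (e i j))\<^sup>2) \<noteq> 1"
  proof (rule ccontr)
    assume "\<not> ?thesis"
    then have "(\<Sum>j<N. \<Sum>i<k. (cmod (e i j))\<^sup>2) = real N" by simp
    then show False using orthonormal_sum_columns[OF e] k by simp
  qed
  then obtain j where j: "j < N" "(\<Sum>i<k. (cmod (e i j))\<^sup>2) \<noteq> 1" by blast
  define w where "w = ax j + vscale (-1) (lincomb e k (\<lambda>i. vinner (ax j) (e i)))"
  have axj: "ax j \<in> CC N" using j by simp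
  note r = orthonormal_residual[OF e axj, folded w_def]
  have "vinner w w \<noteq> 0"
    using orthonormal_column_le(1)[OF e j(1), folded w_def] j(2) by (metis eq_iff_diff_eq_0 of_real_eq_0_iff)
  then have "w \<noteq> 0" by auto
  then obtain c :: real where c: "vinner (vscale (of_real c) w) (vscale (of_real c) w) = 1"
    using exists_unit_multiple[OF r(1)] by blast
  show thesis
    by (rule that[of "vscale (of_real c) w"]) (use c r in \<open>auto simp: vinner_vscale_left[of _ N]\<close>)
qed

lemma orthonormal_extend:
  assumes "orthonormal k e" "\<And>i. i < k \<Longrightarrow> e i \<in> CC N"
  shows "\<exists>e'. orthonormal N e' \<and> (\<forall>i<N. e' i \<in> CC N) \<and> (\<forall>i<k. e' i = e i)"
  using assms
proof (induction "N - k" arbitrary: k e)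
  case 0
  \<comment> \<open>Truncated subtraction yields only \<open>N \<le> k\<close>; the converse is
    \<open>orthonormal_card_le\<close>.\<close>
  then have "k = N" using orthonormal_card_le[OF 0(2,3)] by simp
  then show ?case using 0 by blast
next
  case (Suc d)
  have "k < N" using Suc.hyps(2) by linarith
  from orthonormal_extend1[OF Suc.prems this] obtain w where
    w: "w \<in> CC N" "vinner w w = 1" "\<And>i. i < k \<Longrightarrow> vinner w (e i) = 0" by blast
  have d: "d = N - Suc k" using Suc.hyps(2) by linarith
  obtain e' where e': "orthonormal N e'" "\<forall>i<N. e' i \<in> CC N" "\<forall>i<Suc k. e' i = (e(k := w)) i"
    using Suc.hyps(1)[OF d orthonormal_extend_by[OF Suc.prems w]] by blast
  then have "\<forall>i<k. e' i = e i" by simp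
  with e' show ?case by blast
qed

text \<open>A nonzero residual would give, once normalised, an orthonormal family of
  \<open>N + 1\<close> vectors in \<open>CC N\<close>.\<close>

lemma orthonormal_basis:
  assumes e: "orthonormal N e" "\<And>i. i < N \<Longrightarrow> e i \<in> CC N" and x: "x \<in> CC N"
  shows "x = lincomb e N (\<lambda>i. vinner x (e i))"
proof (rule ccontr)
  define w where "w = x + vscale (-1) (lincomb e N (\<lambda>i. vinner x (e i)))"
  note r = orthonormal_residual[OF e x, folded w_def]
  assume ne: "x \<noteq> lincomb e N (\<lambda>i. vinner x (e i))"
  have "w \<noteq> 0"
  proof
    assume "w = 0"
    then have "\<And>j. x j = lincomb e N (\<lambda>i. vinner x (e i)) j"
      by (auto simp: w_def vscale_def fun_eq_iff)
    then show False using ne by (auto simp: fun_eq_iff)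
  qed
  then obtain c :: real where c: "vinner (vscale (of_real c) w) (vscale (of_real c) w) = 1"
    using exists_unit_multiple[OF r(1)] by blast
  have "orthonormal (Suc N) (e(N := vscale (of_real c) w))"
    "\<And>i. i < Suc N \<Longrightarrow> (e(N := vscale (of_real c) w)) i \<in> CC N"
    by (rule orthonormal_extend_by[OF e]; use r c in \<open>auto simp: vinner_vscale_left[of _ N]\<close>)+
  then have "Suc N \<le> N" by (rule orthonormal_card_le)
  then show False by simp
qed

section \<open>Linear isometries\<close>

lemma isometriesD:
  assumes "f \<in> isometries U V"
  shows "u \<in> U \<Longrightarrow> f u \<in> V" "f \<in> extensional U"
    "u \<in> U \<Longrightarrow> v \<in> U \<Longrightarrow> f (u + v) = f u + f v"
    "u \<in> U \<Longrightarrow> f (vscale c u) = vscale c (f u)"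
    "u \<in> U \<Longrightarrow> v \<in> U \<Longrightarrow> vinner (f u) (f v) = vinner u v"
  using assms by (auto simp: isometries_def PiE_def)

lemma isometriesI:
  assumes "f \<in> extensional U" "\<And>u. u \<in> U \<Longrightarrow> f u \<in> V"
    "\<And>u v. u \<in> U \<Longrightarrow> v \<in> U \<Longrightarrow> f (u + v) = f u + f v"
    "\<And>c u. u \<in> U \<Longrightarrow> f (vscale c u) = vscale c (f u)"
    "\<And>u v. u \<in> U \<Longrightarrow> v \<in> U \<Longrightarrow> vinner (f u) (f v) = vinner u v"
  shows "f \<in> isometries U V"
  using assms by (auto simp: isometries_def PiE_def)

lemma isometry_0:
  assumes "f \<in> isometries U V" "fd_subspace U" shows "f 0 = 0"
  using isometriesD(4)[OF assms(1), of 0 0] fd_subspaceD(1)[OF assms(2)] by simp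

lemma isometry_lincomb:
  assumes f: "f \<in> isometries U V" and U: "fd_subspace U" and e: "\<And>i. i < n \<Longrightarrow> e i \<in> U"
  shows "f (lincomb e n c) = lincomb (\<lambda>i. f (e i)) n c"
  using e
proof (induction n)
  case 0 show ?case unfolding lincomb_0 by (rule isometry_0[OF f U])
next
  case (Suc n)
  have "lincomb e n c \<in> U" using U Suc.prems by (intro lincomb_in) auto
  moreover have "vscale (c n) (e n) \<in> U" using U Suc.prems by (simp add: fd_subspaceD)
  ultimately show "f (lincomb e (Suc n) c) = lincomb (\<lambda>i. f (e i)) (Suc n) c"
    using Suc unfolding lincomb_Suc by (simp add: isometriesD[OF f])
qed

lemma isometry_inj:
  assumes f: "f \<in> isometries U V" and U: "fd_subspace U"
  shows "inj_on f U"
proof (rule inj_onI)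
  fix u v assume uv: "u \<in> U" "v \<in> U" and eq: "f u = f v"
  define w where "w = u + vscale (-1) v"
  have w: "w \<in> U" using uv U unfolding w_def by (simp add: fd_subspaceD)
  have "f w = f u + vscale (-1) (f v)"
    using uv U unfolding w_def by (simp add: isometriesD[OF f] fd_subspaceD)
  then have "f w = 0" using eq by (auto simp: vscale_def)
  then have "vinner w w = 0" using isometriesD(5)[OF f w w] by simp
  moreover obtain n where "U \<subseteq> CC n" using U by (auto simp: fd_subspace_def)
  ultimately have "w = 0" using w vinner_self_eq_0 by blast
  then have "\<And>i. u i = v i" by (auto simp: w_def vscale_def fun_eq_iff)
  then show "u = v" by auto
qed

lemma isometry_compose:
  assumes g: "g \<in> isometries V W" and f: "f \<in> isometries U V" and U: "fd_subspace U"
  shows "compose U g f \<in> isometries U W"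
  by (rule isometriesI)
     (auto simp: compose_def isometriesD[OF f] isometriesD[OF g] fd_subspaceD[OF U])

lemma isometry_id:
  assumes "U \<subseteq> V" "fd_subspace U"
  shows "(\<lambda>u\<in>U. u) \<in> isometries U V"
  by (rule isometriesI) (use assms in \<open>auto simp: fd_subspaceD[OF assms(2)]\<close>)

lemma isometry_inverse:
  assumes f: "f \<in> isometries U V" and b: "bij_betw f U V" and U: "fd_subspace U" and V: "fd_subspace V"
  defines "g \<equiv> restrict (inv_into U f) V"
  shows "g \<in> isometries V U" "\<And>v. v \<in> V \<Longrightarrow> f (g v) = v" "\<And>u. u \<in> U \<Longrightarrow> g (f u) = u"
proof -
  have gU: "g v \<in> U" if "v \<in> V" for v
    using that b unfolding g_def by (simp add: bij_betw_def inv_into_into)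
  show fg: "f (g v) = v" if "v \<in> V" for v
    using that b unfolding g_def by (simp add: bij_betw_def f_inv_into_f)
  show gf: "g (f u) = u" if "u \<in> U" for u
    using that b isometriesD(1)[OF f] unfolding g_def by (simp add: bij_betw_def inv_into_f_f)
  show "g \<in> isometries V U"
  proof (rule isometriesI)
    show "g \<in> extensional V" by (simp add: g_def)
  next
    fix u v assume uv: "u \<in> V" "v \<in> V"
    have "f (g u + g v) = u + v" using isometriesD(3)[OF f] gU fg uv by simp
    then show "g (u + v) = g u + g v" using gf[of "g u + g v"] gU[OF uv(1)] gU[OF uv(2)] fd_subspaceD(2)[OF U] by simp
    show "vinner (g u) (g v) = vinner u v"
      using isometriesD(5)[OF f gU[OF uv(1)] gU[OF uv(2)]] fg uv by simp
  next
    fix c u assume u: "u \<in> V"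
    have "f (vscale c (g u)) = vscale c u" using isometriesD(4)[OF f] gU fg u by simp
    then show "g (vscale c u) = vscale c (g u)" using gf[of "vscale c (g u)"] gU[OF u] fd_subspaceD(3)[OF U] by simp
  qed (rule gU)
qed

lemma isometry_orthonormal:
  assumes "f \<in> isometries (CC k) V"
  shows "orthonormal k (\<lambda>i. f (ax i))" "\<And>i. i < k \<Longrightarrow> f (ax i) \<in> V"
  unfolding orthonormal_def
  using isometriesD(5)[OF assms] isometriesD(1)[OF assms]
  by (simp_all add: vinner_ax_left) (auto simp: ax_def)

lemma isometry_eq_lincomb:
  assumes "f \<in> isometries (CC k) V" "v \<in> CC k"
  shows "f v = lincomb (\<lambda>i. f (ax i)) k v"
  using isometry_lincomb[OF assms(1), of k ax v] lincomb_ax[OF assms(2)] by simp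

lemma isometry_of_orthonormal:
  assumes e: "orthonormal k e" "\<And>i. i < k \<Longrightarrow> e i \<in> V" and V: "fd_subspace V"
  shows "(\<lambda>v\<in>CC k. lincomb e k v) \<in> isometries (CC k) V"
proof (rule isometriesI)
  obtain n where n: "V \<subseteq> CC n" using V by (auto simp: fd_subspace_def)
  fix u v assume uv: "u \<in> CC k" "v \<in> CC k"
  show "(\<lambda>v\<in>CC k. lincomb e k v) (u + v) = (\<lambda>v\<in>CC k. lincomb e k v) u + (\<lambda>v\<in>CC k. lincomb e k v) v"
    using uv by (simp add: lincomb_add)
  have l: "lincomb e k u \<in> CC n" using e(2) n by (intro lincomb_in) auto
  have "vinner (lincomb e k u) (lincomb e k v) = (\<Sum>i<k. cnj (v i) * u i)"
    unfolding vinner_lincomb_right[OF l]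
    using vinner_lincomb_orthonormal[OF e(1), of n] e(2) n by (intro sum.cong) auto
  then show "vinner ((\<lambda>v\<in>CC k. lincomb e k v) u) ((\<lambda>v\<in>CC k. lincomb e k v) v) = vinner u v"
    using uv by (simp add: vinner_CC mult.commute)
qed (use e V in \<open>auto simp: lincomb_vscale intro: lincomb_in\<close>)

lemma isometry_CC_le: "f \<in> isometries (CC k) (CC l) \<Longrightarrow> k \<le> l"
  using isometry_orthonormal orthonormal_card_le by blast

lemma lincomb_CC: "u \<in> CC k \<Longrightarrow> k \<le> l \<Longrightarrow> lincomb e l u = lincomb e k u"
  unfolding lincomb_def by (rule ext, rule sum.mono_neutral_right) (auto simp: CC_def)

text \<open>The images of the coordinate vectors of C^k are orthonormal, and completing them to a
  basis of C^l gives the columns of the unitary.\<close>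

lemma isometry_extends_to_unitary:
  assumes f: "f \<in> isometries (CC k) (CC l)"
  shows "\<exists>A\<in>unitary l. \<forall>u\<in>CC k. A u = f u"
proof -
  obtain e where e: "orthonormal l e" "\<forall>i<l. e i \<in> CC l" "\<forall>i<k. e i = f (ax i)"
    using orthonormal_extend[OF isometry_orthonormal[OF f]] by blast
  have "(\<lambda>v\<in>CC l. lincomb e l v) \<in> unitary l"
    unfolding unitary_def using e by (intro isometry_of_orthonormal) auto
  moreover have "(\<lambda>v\<in>CC l. lincomb e l v) u = f u" if u: "u \<in> CC k" for u
  proof -
    have "u \<in> CC l" using u CC_mono[OF isometry_CC_le[OF f]] by blast
    then have "(\<lambda>v\<in>CC l. lincomb e l v) u = lincomb e k u"
      using lincomb_CC[OF u isometry_CC_le[OF f]] by simp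
    also have "\<dots> = lincomb (\<lambda>i. f (ax i)) k u" using e(3) by (intro lincomb_cong) auto
    also have "\<dots> = f u" using isometry_eq_lincomb[OF f u] by simp
    finally show ?thesis .
  qed
  ultimately show ?thesis by blast
qed

section \<open>Unitary groups: inverses and block sums\<close>

lemma unitary_bij:
  assumes A: "A \<in> unitary n" shows "bij_betw A (CC n) (CC n)"
proof -
  have A': "A \<in> isometries (CC n) (CC n)" using A by (simp add: unitary_def)
  have "x \<in> A ` CC n" if x: "x \<in> CC n" for x
  proof -
    let ?c = "\<lambda>i. vinner x (A (ax i))"
    have "x = lincomb (\<lambda>i. A (ax i)) n ?c"
      by (rule orthonormal_basis[OF isometry_orthonormal[OF A'] x])
    \<comment> \<open>\<open>A\<close> is extensional, so nothing is known about
      \<open>A (ax i)\<close> for \<open>i \<ge> n\<close>; the coefficients are cut off to form a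
      vector of \<open>CC n\<close>.\<close>
    also have "\<dots> = lincomb (\<lambda>i. A (ax i)) n (vtake n ?c)"
      by (auto simp: lincomb_def vtake_def)
    also have "\<dots> = A (vtake n ?c)" using isometry_eq_lincomb[OF A', of "vtake n ?c"] by simp
    finally show ?thesis using vtake_in_CC by (rule image_eqI)
  qed
  then show ?thesis
    using isometry_inj[OF A'] isometriesD(1)[OF A'] by (auto simp: bij_betw_def)
qed

definition uinv :: "nat \<Rightarrow> (vec \<Rightarrow> vec) \<Rightarrow> vec \<Rightarrow> vec" where
  "uinv n A = restrict (inv_into (CC n) A) (CC n)"

lemma uinv:
  assumes "A \<in> unitary n"
  shows "uinv n A \<in> unitary n" "v \<in> CC n \<Longrightarrow> A (uinv n A v) = v" "v \<in> CC n \<Longrightarrow> uinv n A (A v) = v"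
  using isometry_inverse[of A "CC n" "CC n"] unitary_bij[OF assms] assms
  unfolding uinv_def unitary_def by auto

lemma unitaryD:
  assumes "A \<in> unitary n"
  shows "u \<in> CC n \<Longrightarrow> A u \<in> CC n" "A \<in> extensional (CC n)"
    "u \<in> CC n \<Longrightarrow> v \<in> CC n \<Longrightarrow> A (u + v) = A u + A v"
    "u \<in> CC n \<Longrightarrow> A (vscale c u) = vscale c (A u)"
    "u \<in> CC n \<Longrightarrow> v \<in> CC n \<Longrightarrow> vinner (A u) (A v) = vinner u v" "A 0 = 0"
  using assms isometriesD[of A "CC n" "CC n"] isometry_0[of A "CC n" "CC n"] by (auto simp: unitary_def)

lemma unitary_compose: "A \<in> unitary n \<Longrightarrow> B \<in> unitary n \<Longrightarrow> compose (CC n) A B \<in> unitary n"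
  unfolding unitary_def by (intro isometry_compose) auto

lemma unitary_id: "(\<lambda>v\<in>CC n. v) \<in> unitary n"
  unfolding unitary_def by (intro isometry_id) auto

lemma block_sum_eq:
  assumes "A \<in> unitary k" "v \<in> CC (k + m)"
  shows "block_sum k m A B v = A (vtake k v) + shift k (B (vdrop k v))"
proof
  fix i
  have "A (vtake k v) i = 0" if "k \<le> i"
    using unitaryD(1)[OF assms(1) vtake_in_CC[of k v]] that by (simp add: CC_def)
  then show "block_sum k m A B v i = (A (vtake k v) + shift k (B (vdrop k v))) i"
    using assms(2) by (simp add: block_sum_def shift_def)
qed

lemma block_sum_CC:
  assumes "A \<in> unitary k" "B \<in> unitary m" "u \<in> CC k"
  shows "block_sum k m A B u = A u"
  using block_sum_eq[OF assms(1), of u m B] assms CC_mono[of k "k + m"]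
  by (auto simp: vtake_id vdrop_CC unitaryD(6)[OF assms(2)])

lemma block_sum_shift:
  assumes "A \<in> unitary k" "w \<in> CC m"
  shows "block_sum k m A B (shift k w) = shift k (B w)"
  using block_sum_eq[OF assms(1) shift_in_CC[OF assms(2)]] unitaryD(6)[OF assms(1)] by simp

lemma vtake_add: "vtake k (u + v) = vtake k u + vtake k v" by (auto simp: vtake_def)
lemma vdrop_add: "vdrop k (u + v) = vdrop k u + vdrop k v" by (auto simp: vdrop_def)
lemma vtake_vscale: "vtake k (vscale c v) = vscale c (vtake k v)" by (auto simp: vtake_def vscale_def)
lemma vdrop_vscale: "vdrop k (vscale c v) = vscale c (vdrop k v)" by (auto simp: vdrop_def vscale_def)
lemma vscale_add: "vscale c (u + v) = vscale c u + vscale c v" by (auto simp: vscale_def distrib_left)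

lemma block_sum_unitary:
  assumes A: "A \<in> unitary k" and B: "B \<in> unitary m"
  shows "block_sum k m A B \<in> unitary (k + m)"
  unfolding unitary_def
proof (rule isometriesI)
  note eq = block_sum_eq[OF A]
  show "block_sum k m A B \<in> extensional (CC (k + m))" by (simp add: block_sum_def)
  fix u assume u: "u \<in> CC (k + m)"
  have Au: "A (vtake k u) \<in> CC k" and Bu: "B (vdrop k u) \<in> CC m"
    using unitaryD(1)[OF A] unitaryD(1)[OF B] vdrop_in_CC[OF u] by auto
  show "block_sum k m A B u \<in> CC (k + m)"
    unfolding eq[OF u] using Au Bu CC_mono[of k "k + m"] shift_in_CC by (intro add_in_CC) auto
  fix c
  show "block_sum k m A B (vscale c u) = vscale c (block_sum k m A B u)"
    using u vdrop_in_CC[OF u] unfolding eq[OF u] eq[OF vscale_in_CC[OF u]]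
    by (simp add: vtake_vscale vdrop_vscale unitaryD[OF A] unitaryD[OF B] shift_vscale vscale_add)
next
  note eq = block_sum_eq[OF A]
  fix u v assume u: "u \<in> CC (k + m)" and v: "v \<in> CC (k + m)"
  note d = vdrop_in_CC[OF u] vdrop_in_CC[OF v]
  show "block_sum k m A B (u + v) = block_sum k m A B u + block_sum k m A B v"
    using d unfolding eq[OF u] eq[OF v] eq[OF add_in_CC[OF u v]]
    by (simp add: vtake_add vdrop_add unitaryD[OF A] unitaryD[OF B] shift_add ac_simps)
  have "vinner (block_sum k m A B u) (block_sum k m A B v) =
      vinner (vtake k u) (vtake k v) + vinner (vdrop k u) (vdrop k v)"
    using d unfolding eq[OF u] eq[OF v]
    by (subst vinner_block[of _ k _ _ m]) (simp_all add: unitaryD[OF A] unitaryD[OF B])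
  also have "\<dots> = vinner u v"
    using vinner_block[of "vtake k u" k "vtake k v" "vdrop k u" m "vdrop k v"] d
    by (simp add: vtake_plus_shift_vdrop)
  finally show "vinner (block_sum k m A B u) (block_sum k m A B v) = vinner u v" .
qed

section \<open>Points of the bundle as pairs of a unitary and a vector\<close>

lemma J_bundleD:
  assumes "(f, x) \<in> J_bundle U V"
  shows "f \<in> isometries U V" "x \<in> V" "u \<in> U \<Longrightarrow> vinner x (f u) = 0"
  using assms by (auto simp: J_bundle_def)

text \<open>Extend \<open>f\<close> to a unitary \<open>A\<close>. Since \<open>A\<close> preserves
  inner products, the preimage of \<open>x\<close> is orthogonal to C^k and hence of the form
  \<open>shift k v\<close>.\<close>

lemma J_bundle_unitary_rep:
  assumes "(f, x) \<in> J_bundle (CC k) (CC (k + m))"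
  obtains A v where "A \<in> unitary (k + m)" "v \<in> CC m" "\<And>u. u \<in> CC k \<Longrightarrow> A u = f u" "A (shift k v) = x"
proof -
  note fx = J_bundleD[OF assms]
  obtain A where A: "A \<in> unitary (k + m)" "\<forall>u\<in>CC k. A u = f u"
    using isometry_extends_to_unitary[OF fx(1)] by blast
  define y where "y = uinv (k + m) A x"
  have y: "y \<in> CC (k + m)" "A y = x"
    using uinv[OF A(1)] unitaryD(1)[OF uinv(1)[OF A(1)]] fx(2) by (auto simp: y_def)
  have "vinner y u = 0" if u: "u \<in> CC k" for u
  proof -
    have "u \<in> CC (k + m)" using u CC_mono[of k "k + m"] by auto
    then have "vinner y u = vinner (A y) (A u)" using unitaryD(5)[OF A(1) y(1)] by metis
    then show ?thesis using A(2) y u fx(3) by simp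
  qed
  then have "y = shift k (vdrop k y)" using orthogonal_CC_eq_shift y by blast
  then show thesis using that[of A "vdrop k y"] A y vdrop_in_CC[OF y(1)] by simp
qed

lemma unitary_rep_J_bundle:
  assumes A: "A \<in> unitary (k + m)" and v: "v \<in> CC m"
  shows "(\<lambda>u\<in>CC k. A u, A (shift k v)) \<in> J_bundle (CC k) (CC (k + m))"
proof -
  have sub: "u \<in> CC k \<Longrightarrow> u \<in> CC (k + m)" for u using CC_mono[of k "k + m"] by auto
  have "(\<lambda>u\<in>CC k. A u) \<in> isometries (CC k) (CC (k + m))"
    by (rule isometriesI) (use sub in \<open>auto simp: unitaryD[OF A]\<close>)
  moreover have "vinner (A (shift k v)) (A u) = 0" if "u \<in> CC k" for u
    using vinner_shift_CC[OF that v] unitaryD(5)[OF A shift_in_CC[OF v] sub[OF that]] by simp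
  ultimately show ?thesis
    using unitaryD(1)[OF A shift_in_CC[OF v]] by (auto simp: J_bundle_def)
qed

text \<open>The unitary \<open>C\<close> with \<open>A C = A'\<close> fixes C^k pointwise, so it
  preserves the orthogonal complement and has the form \<open>1 \<oplus> B\<close>.\<close>

lemma unitary_rep_unique:
  assumes A: "A \<in> unitary (k + m)" and A': "A' \<in> unitary (k + m)" and v: "v \<in> CC m" "v' \<in> CC m"
    and eq: "\<And>u. u \<in> CC k \<Longrightarrow> A u = A' u" "A (shift k v) = A' (shift k v')"
  obtains B where "B \<in> unitary m" "A' = compose (CC (k + m)) A (block_sum k m (\<lambda>u\<in>CC k. u) B)" "B v' = v"
proof -
  let ?n = "k + m"
  define C where "C = compose (CC ?n) (uinv ?n A) A'"
  have C: "C \<in> unitary ?n" unfolding C_def using A A' by (intro unitary_compose uinv)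
  have sub: "u \<in> CC k \<Longrightarrow> u \<in> CC ?n" for u using CC_mono[of k ?n] by auto
  have Ck: "C u = u" if "u \<in> CC k" for u
    using that sub[OF that] eq(1)[OF that] uinv(3)[OF A] by (simp add: C_def compose_def flip: eq(1))
  have AC: "A (C u) = A' u" if "u \<in> CC ?n" for u
    using that uinv(2)[OF A] unitaryD(1)[OF A'] by (simp add: C_def compose_def)
  define B where "B = (\<lambda>w\<in>CC m. vdrop k (C (shift k w)))"
  have CB: "C (shift k w) = shift k (B w)" if w: "w \<in> CC m" for w
  proof -
    have "vinner (C (shift k w)) u = 0" if u: "u \<in> CC k" for u
      using unitaryD(5)[OF C shift_in_CC[OF w] sub[OF u]] Ck[OF u] vinner_shift_CC[OF u w] by simp
    then show ?thesis
      using orthogonal_CC_eq_shift[OF unitaryD(1)[OF C shift_in_CC[OF w]]] w by (simp add: B_def)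
  qed
  have Bm: "B w \<in> CC m" if "w \<in> CC m" for w
    using that vdrop_in_CC[OF unitaryD(1)[OF C shift_in_CC[OF that]]] by (simp add: B_def)
  have B: "B \<in> unitary m"
    unfolding unitary_def
  proof (rule isometriesI)
    show "B \<in> extensional (CC m)" by (simp add: B_def)
    fix u v assume uv: "u \<in> CC m" "v \<in> CC m"
    note s = shift_in_CC[OF uv(1), of k] shift_in_CC[OF uv(2), of k]
    show "B (u + v) = B u + B v"
      using uv s by (simp add: B_def shift_add unitaryD[OF C] vdrop_add)
    show "vinner (B u) (B v) = vinner u v"
      using unitaryD(5)[OF C s] CB uv vinner_shift Bm by metis
  next
    fix c u assume u: "u \<in> CC m"
    show "B (vscale c u) = vscale c (B u)"
      using u shift_in_CC[OF u, of k] by (simp add: B_def shift_vscale unitaryD[OF C] vdrop_vscale)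
  qed (rule Bm)
  have "C u = block_sum k m (\<lambda>u\<in>CC k. u) B u" if u: "u \<in> CC ?n" for u
  proof -
    have "C u = C (vtake k u + shift k (vdrop k u))" by (simp add: vtake_plus_shift_vdrop)
    also have "\<dots> = C (vtake k u) + C (shift k (vdrop k u))"
      using sub[of "vtake k u"] shift_in_CC[OF vdrop_in_CC[OF u]] by (simp add: unitaryD(3)[OF C])
    also have "\<dots> = vtake k u + shift k (B (vdrop k u))"
      using Ck[of "vtake k u"] CB[OF vdrop_in_CC[OF u]] by simp
    finally show ?thesis by (simp add: block_sum_eq[OF unitary_id u])
  qed
  then have "A' u = compose (CC ?n) A (block_sum k m (\<lambda>u\<in>CC k. u) B) u" if "u \<in> CC ?n" for u
    using that AC[OF that] by (simp add: compose_def)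
  then have 2: "A' = compose (CC ?n) A (block_sum k m (\<lambda>u\<in>CC k. u) B)"
    by (rule extensionalityI[OF unitaryD(2)[OF A'] compose_extensional])
  have "A (C (shift k v')) = A (shift k v)" using AC[OF shift_in_CC[OF v(2)]] eq(2) by simp
  then have "C (shift k v') = shift k v"
    using unitary_bij[OF A] unitaryD(1)[OF C shift_in_CC[OF v(2)]] shift_in_CC[OF v(1)]
    by (auto simp: bij_betw_def inj_on_def)
  then have "shift k (B v') = shift k v" using CB[OF v(2)] by simp
  then have "B v' = v" by (metis vdrop_shift)
  then show thesis using that B 2 by blast
qed


section \<open>Complex conjugation\<close>

definition conj_closed :: "vec set \<Rightarrow> bool" where
  "conj_closed V \<longleftrightarrow> (\<forall>s. \<forall>v\<in>V. vconj s v \<in> V)"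

lemma conj_closedD: "conj_closed V \<Longrightarrow> v \<in> V \<Longrightarrow> vconj s v \<in> V"
  by (simp add: conj_closed_def)

lemma conj_closed_CC [simp]: "conj_closed (CC n)" by (simp add: conj_closed_def)

lemma vconj_vscale: "vconj s (vscale c u) = vscale (if s then cnj c else c) (vconj s u)"
  by (auto simp: vconj_def vscale_def)

lemma mconj_apply: "u \<in> U \<Longrightarrow> mconj s U f u = vconj s (f (vconj s u))"
  by (simp add: mconj_def)

text \<open>\<open>mconj\<close> conjugates both before and after \<open>f\<close>, so scalars and
  inner products are conjugated twice, and complex linearity and isometry survive.\<close>

lemma mconj_isometry:
  assumes f: "f \<in> isometries U V" and U: "fd_subspace U" "conj_closed U" and V: "fd_subspace V" "conj_closed V"
  shows "mconj s U f \<in> isometries U V"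
proof (rule isometriesI)
  show "mconj s U f \<in> extensional U" by (simp add: mconj_def)
  obtain n m where nm: "V \<subseteq> CC n" "U \<subseteq> CC m" using U V by (auto simp: fd_subspace_def)
  fix u assume u: "u \<in> U"
  note cu = conj_closedD[OF U(2) u]
  show "mconj s U f u \<in> V"
    using u cu conj_closedD[OF V(2)] isometriesD(1)[OF f] by (simp add: mconj_apply)
  show "mconj s U f (vscale c u) = vscale c (mconj s U f u)" for c
    using u cu fd_subspaceD(3)[OF U(1)] by (simp add: mconj_apply vconj_vscale isometriesD(4)[OF f])
  fix v assume v: "v \<in> U"
  note cv = conj_closedD[OF U(2) v]
  show "mconj s U f (u + v) = mconj s U f u + mconj s U f v"
    using u v cu cv fd_subspaceD(2)[OF U(1)] by (simp add: mconj_apply vconj_add isometriesD(3)[OF f])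
  have fn: "f (vconj s u) \<in> CC n" using isometriesD(1)[OF f cu] nm by blast
  have um: "u \<in> CC m" using u nm by blast
  show "vinner (mconj s U f u) (mconj s U f v) = vinner u v"
    using u v cu cv by (simp add: mconj_apply vinner_vconj[OF fn] isometriesD(5)[OF f] vinner_vconj[OF um])
qed

lemma mconj_unitary: "A \<in> unitary n \<Longrightarrow> mconj s (CC n) A \<in> unitary n"
  unfolding unitary_def by (rule mconj_isometry) auto

lemma mconj_id: "conj_closed U \<Longrightarrow> mconj s U (\<lambda>u\<in>U. u) = (\<lambda>u\<in>U. u)"
  by (auto simp: mconj_def conj_closedD intro!: restrict_ext)

lemma mconj_compose:
  assumes f: "f \<in> isometries V W" and h: "h \<in> isometries U V" and "conj_closed U" "conj_closed V"
  shows "mconj s U (compose U f h) = compose U (mconj s V f) (mconj s U h)"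
  unfolding mconj_def compose_def
  by (rule restrict_ext) (use assms conj_closedD isometriesD(1)[OF h] in auto)

lemma mconj_mconj: "conj_closed U \<Longrightarrow> mconj s U (mconj t U f) = mconj (s \<noteq> t) U f"
  unfolding mconj_def by (rule restrict_ext) (cases s; cases t; simp add: conj_closedD)

lemma mconj_False: "f \<in> extensional U \<Longrightarrow> mconj False U f = f"
  by (auto simp: mconj_def fun_eq_iff extensional_def)

lemma group_C2: "group C2"
  by (rule groupI) (auto simp: C2_def)

lemma group_C2U: "group (C2U k)"
proof (rule groupI)
  let ?c = "\<lambda>A B. compose (CC k) A B"
  fix x y z assume "x \<in> carrier (C2U k)" "y \<in> carrier (C2U k)" "z \<in> carrier (C2U k)"
  then obtain s A t B r C where eq: "x = (s, A)" "y = (t, B)" "z = (r, C)"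
    and u: "A \<in> unitary k" "B \<in> unitary k" "C \<in> unitary k"
    by (auto simp: C2U_def)
  show "x \<otimes>\<^bsub>C2U k\<^esub> y \<in> carrier (C2U k)"
    using u by (simp add: C2U_def eq unitary_compose mconj_unitary)
  have "mconj s (CC k) (?c B (mconj t (CC k) C)) = ?c (mconj s (CC k) B) (mconj (s \<noteq> t) (CC k) C)"
    using u mconj_unitary[OF u(3)] unfolding unitary_def
    by (subst mconj_compose[of _ "CC k" "CC k" _ "CC k"]) (auto simp: mconj_mconj)
  moreover have "?c (?c A (mconj s (CC k) B)) D = ?c A (?c (mconj s (CC k) B) D)" if "D \<in> unitary k" for D
    using unitaryD(1)[OF that] by (intro compose_assoc[symmetric]) auto
  ultimately show "x \<otimes>\<^bsub>C2U k\<^esub> y \<otimes>\<^bsub>C2U k\<^esub> z = x \<otimes>\<^bsub>C2U k\<^esub> (y \<otimes>\<^bsub>C2U k\<^esub> z)"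
    using u mconj_unitary[OF u(3)] by (auto simp: C2U_def eq)
  show "\<one>\<^bsub>C2U k\<^esub> \<otimes>\<^bsub>C2U k\<^esub> x = x"
    using u unitaryD(1,2)[OF u(1)] Id_compose[of A "CC k" "CC k"]
    by (auto simp: C2U_def eq mconj_False)
  \<comment> \<open>The inverse of \<open>(s, A)\<close> in the semidirect product: multiplying by
    \<open>(s, D)\<close> from the left turns \<open>A\<close> into \<open>s A s\<close>, whose
    inverse is \<open>s A^-1 s\<close>.\<close>
  define D where "D = mconj s (CC k) (uinv k A)"
  have D: "D \<in> unitary k" unfolding D_def using u by (intro mconj_unitary uinv)
  have m: "mconj s (CC k) A v = vconj s (A (vconj s v))" if "v \<in> CC k" for v
    using that by (simp add: mconj_apply)
  have "?c D (mconj s (CC k) A) = (\<lambda>v\<in>CC k. v)"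
    unfolding compose_def
  proof (rule restrict_ext)
    fix v assume v: "v \<in> CC k"
    have "vconj s (A (vconj s v)) \<in> CC k" using v unitaryD(1)[OF u(1)] by simp
    then show "D (mconj s (CC k) A v) = v"
      using v uinv(3)[OF u(1)] by (simp add: m D_def mconj_apply)
  qed
  then have "(s, D) \<otimes>\<^bsub>C2U k\<^esub> x = \<one>\<^bsub>C2U k\<^esub>" by (simp add: C2U_def eq)
  moreover have "(s, D) \<in> carrier (C2U k)" using D by (simp add: C2U_def)
  ultimately show "\<exists>y\<in>carrier (C2U k). y \<otimes>\<^bsub>C2U k\<^esub> x = \<one>\<^bsub>C2U k\<^esub>" by blast
qed (simp add: C2U_def unitary_id)


section \<open>Composition in \<open>J\<close>\<close>

text \<open>The formula of the action in \<open>J_mor\<close> without its restriction to the points,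
  which would involve the target.\<close>

definition J_act :: "bool \<Rightarrow> vec set \<Rightarrow> jmor \<Rightarrow> jmor" where
  "J_act s U = map_option (\<lambda>(f, x). (mconj s U f, vconj s x))"

lemma points_J_mor [simp]: "points (J_mor U V) = insert None (Some ` J_bundle U V)"
  by (simp add: J_mor_def)

lemma Pt_J_mor [simp]: "Pt (J_mor U V) = None" by (simp add: J_mor_def)

lemma Act_J_mor: "\<phi> \<in> points (J_mor U V) \<Longrightarrow> Act (J_mor U V) s \<phi> = J_act s U \<phi>"
  by (simp add: J_mor_def J_act_def)

lemma J_comp_None [simp]: "J_comp U None \<psi> = None" "J_comp U \<phi> None = None"
  by (auto simp: J_comp_def split: option.splits)

lemma J_comp_Some [simp]: "J_comp U (Some (f, x)) (Some (h, y)) = Some (compose U f h, x + f y)"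
  by (simp add: J_comp_def)

lemma J_bundle_comp:
  assumes fx: "(f, x) \<in> J_bundle V W" and hy: "(h, y) \<in> J_bundle U V"
    and U: "fd_subspace U" and W: "fd_subspace W"
  shows "(compose U f h, x + f y) \<in> J_bundle U W"
proof -
  note F = J_bundleD[OF fx] note H = J_bundleD[OF hy]
  obtain n where n: "W \<subseteq> CC n" using W by (auto simp: fd_subspace_def)
  have fy: "f y \<in> W" using isometriesD(1)[OF F(1) H(2)] .
  have "vinner (x + f y) (f (h u)) = 0" if u: "u \<in> U" for u
  proof -
    have hu: "h u \<in> V" using isometriesD(1)[OF H(1) u] .
    have "vinner (x + f y) (f (h u)) = vinner x (f (h u)) + vinner (f y) (f (h u))"
      using n F(2) fy by (intro vinner_add_left) auto
    then show ?thesis using F(3)[OF hu] isometriesD(5)[OF F(1) H(2) hu] H(3)[OF u] by simp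
  qed
  then show ?thesis
    using isometry_compose[OF F(1) H(1) U] fd_subspaceD(2)[OF W F(2) fy] by (auto simp: J_bundle_def compose_eq)
qed

lemma J_comp_in:
  assumes "\<phi> \<in> points (J_mor V W)" "\<psi> \<in> points (J_mor U V)" "fd_subspace U" "fd_subspace W"
  shows "J_comp U \<phi> \<psi> \<in> points (J_mor U W)"
  using assms J_bundle_comp by fastforce

lemma J_comp_assoc:
  assumes "\<omega> \<in> points (J_mor W X)" "\<phi> \<in> points (J_mor V W)" "\<psi> \<in> points (J_mor U V)"
  shows "J_comp U \<omega> (J_comp U \<phi> \<psi>) = J_comp U (J_comp V \<omega> \<phi>) \<psi>"
proof (cases "\<omega> = None \<or> \<phi> = None \<or> \<psi> = None")
  case False
  then obtain f x g y h z where eq: "\<omega> = Some (f, x)" "\<phi> = Some (g, y)" "\<psi> = Some (h, z)"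
    and b: "(f, x) \<in> J_bundle W X" "(g, y) \<in> J_bundle V W" "(h, z) \<in> J_bundle U V"
    using assms by auto
  have "h \<in> U \<rightarrow> V" using isometriesD(1)[OF J_bundleD(1)[OF b(3)]] by auto
  moreover have "f (y + g z) = f y + f (g z)"
    using isometriesD(3)[OF J_bundleD(1)[OF b(1)]] J_bundleD(2)[OF b(2)] J_bundleD(2)[OF b(3)]
      isometriesD(1)[OF J_bundleD(1)[OF b(2)]] by simp
  ultimately show ?thesis
    using J_bundleD(2)[OF b(3)] by (simp add: eq compose_assoc compose_eq add.assoc)
qed auto

lemma J_id_in: "fd_subspace U \<Longrightarrow> J_id U \<in> points (J_mor U U)"
  by (auto simp: J_id_def J_bundle_def isometry_id fd_subspaceD)

lemma J_comp_id_left: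
  assumes "\<phi> \<in> points (J_mor U V)" shows "J_comp U (J_id V) \<phi> = \<phi>"
proof (cases \<phi>)
  case (Some p)
  obtain f x where p: "\<phi> = Some (f, x)" "(f, x) \<in> J_bundle U V" using assms Some by auto
  note F = J_bundleD[OF p(2)]
  have "compose U (\<lambda>v\<in>V. v) f = f"
    using isometriesD(1,2)[OF F(1)] by (intro Id_compose) auto
  then show ?thesis using F(2) by (simp add: p J_id_def)
qed simp

lemma J_comp_id_right:
  assumes "\<phi> \<in> points (J_mor U V)" "fd_subspace U" shows "J_comp U \<phi> (J_id U) = \<phi>"
proof (cases \<phi>)
  case (Some p)
  obtain f x where p: "\<phi> = Some (f, x)" "(f, x) \<in> J_bundle U V" using assms Some by auto
  note F = J_bundleD[OF p(2)]
  have "compose U f (\<lambda>u\<in>U. u) = f"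
    using isometriesD(1,2)[OF F(1)] by (intro compose_Id) auto
  then show ?thesis using isometry_0[OF F(1) assms(2)] by (simp add: p J_id_def)
qed simp

lemma J_act_in:
  assumes "\<phi> \<in> points (J_mor U V)" "fd_subspace U" "conj_closed U" "fd_subspace V" "conj_closed V"
  shows "J_act s U \<phi> \<in> points (J_mor U V)"
proof (cases \<phi>)
  case (Some p)
  obtain f x where p: "\<phi> = Some (f, x)" "(f, x) \<in> J_bundle U V" using assms Some by auto
  note F = J_bundleD[OF p(2)]
  obtain n where n: "V \<subseteq> CC n" using assms(4) by (auto simp: fd_subspace_def)
  have "vinner (vconj s x) (mconj s U f u) = 0" if "u \<in> U" for u
    using that vinner_vconj[of x n s] F(2,3) n conj_closedD[OF assms(3)] by (auto simp: mconj_apply)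
  then show ?thesis
    using mconj_isometry[OF F(1) assms(2-5)] conj_closedD[OF assms(5) F(2)]
    by (simp add: p J_act_def J_bundle_def)
qed (simp add: J_act_def)

lemma J_act_comp:
  assumes "\<phi> \<in> points (J_mor V W)" "\<psi> \<in> points (J_mor U V)" "conj_closed U" "conj_closed V"
  shows "J_act s U (J_comp U \<phi> \<psi>) = J_comp U (J_act s V \<phi>) (J_act s U \<psi>)"
proof (cases "\<phi> = None \<or> \<psi> = None")
  case False
  then obtain f x h y where eq: "\<phi> = Some (f, x)" "\<psi> = Some (h, y)"
    and b: "(f, x) \<in> J_bundle V W" "(h, y) \<in> J_bundle U V"
    using assms by auto
  show ?thesis
    using mconj_compose[OF J_bundleD(1)[OF b(1)] J_bundleD(1)[OF b(2)] assms(3,4)] J_bundleD(2)[OF b(2)]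
      conj_closedD[OF assms(4)]
    by (simp add: eq J_act_def vconj_add mconj_apply)
qed (auto simp: J_act_def)

section \<open>Topology of the unitary groups and of the Thom spaces\<close>

text \<open>Functions carry the product topology, so this is Tychonoff's theorem.\<close>

lemma compact_coordinatewise:
  assumes "\<And>i. compact (S i)" shows "compact {f. \<forall>i. f i \<in> S i}"
proof -
  have "compactin (product_topology (\<lambda>i. euclidean) UNIV) (PiE UNIV S)"
    using assms by (subst compactin_PiE) simp
  then show ?thesis by (simp add: euclidean_product_topology PiE_UNIV_domain Pi_def)
qed

lemma Hausdorff_space_euclidean_vec: "Hausdorff_space (euclidean :: (vec \<Rightarrow> vec) topology)"
proof -
  have "Hausdorff_space (product_topology (\<lambda>i :: vec. euclidean :: vec topology) UNIV)"
    by (subst Hausdorff_space_product_topology) simp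
  then show ?thesis by (simp only: euclidean_product_topology)
qed

lemma Hausdorff_space_euclidean_prod: "Hausdorff_space (euclidean :: ((vec \<Rightarrow> vec) \<times> vec) topology)"
proof -
  have "Hausdorff_space (prod_topology (euclidean :: (vec \<Rightarrow> vec) topology) (euclidean :: vec topology))"
    using Hausdorff_space_euclidean_vec by (subst Hausdorff_space_prod_topology) simp
  then show ?thesis using prod_topology_subtopology_eu[of "UNIV :: (vec \<Rightarrow> vec) set" "UNIV :: vec set"] by (simp only: subtopology_UNIV UNIV_Times_UNIV)
qed

text \<open>A closed polydisc in C^n. Polydiscs serve as the standard compact bounded sets because
  their compactness in the product topology is immediate.\<close>

definition cube :: "nat \<Rightarrow> real \<Rightarrow> vec set" where
  "cube n M = {v. \<forall>i. v i \<in> (if i < n then cball 0 M else {0})}"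

lemma compact_cube: "compact (cube n M)"
  unfolding cube_def by (rule compact_coordinatewise) simp

lemma cube_subset_CC: "cube n M \<subseteq> CC n"
proof
  fix v assume v: "v \<in> cube n M"
  show "v \<in> CC n" unfolding CC_def
  proof (intro CollectI allI impI)
    fix i assume "n \<le> i"
    then show "v i = 0" using v[unfolded cube_def, THEN CollectD, rule_format, of i] by simp
  qed
qed

definition nsq :: "nat \<Rightarrow> vec \<Rightarrow> real" where
  "nsq n v = (\<Sum>i<n. (cmod (v i))\<^sup>2)"

lemma nsq_eq: "v \<in> CC n \<Longrightarrow> vinner v v = of_real (nsq n v)"
  by (simp only: nsq_def vinner_self)

text \<open>Requiring \<open>1 \<le> M\<close> lets one number bound both the squared norm and the
  entries, since \<open>cmod (v i) > M \<ge> 1\<close> forces the square above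
  \<open>M\<close>.\<close>

lemma nsq_cube:
  assumes "v \<in> CC n" "nsq n v \<le> M" "1 \<le> M" shows "v \<in> cube n M"
  unfolding cube_def
proof (intro CollectI allI)
  fix i
  have "cmod (v i) \<le> M" if i: "i < n"
  proof (rule ccontr)
    assume "\<not> cmod (v i) \<le> M"
    then have "M * 1 < cmod (v i) * cmod (v i)"
      using assms(3) by (intro mult_strict_mono) auto
    moreover have "(cmod (v i))\<^sup>2 \<le> nsq n v"
      unfolding nsq_def by (rule member_le_sum) (use i in auto)
    ultimately show False using assms(2) by (simp add: power2_eq_square)
  qed
  then show "v i \<in> (if i < n then cball 0 M else {0})"
    using assms(1) by (auto simp: CC_def)
qed

lemma isometry_nsq:
  assumes "f \<in> isometries U V" "U \<subseteq> CC a" "V \<subseteq> CC b" "u \<in> U"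
  shows "nsq b (f u) = nsq a u"
proof -
  have "f u \<in> CC b" "u \<in> CC a" using isometriesD(1)[OF assms(1,4)] assms by auto
  then have "(of_real (nsq b (f u)) :: complex) = of_real (nsq a u)"
    using isometriesD(5)[OF assms(1,4,4)] nsq_eq by metis
  then show ?thesis by (rule of_real_eq_iff[THEN iffD1])
qed

lemma continuous_on_nsq: "continuous_on S (nsq n)"
  unfolding nsq_def by (intro continuous_intros continuous_on_product_then_coordinatewise continuous_on_id)

lemma continuous_on_coord2: "continuous_on S (\<lambda>e :: nat \<Rightarrow> vec. e i t)"
  by (rule continuous_on_product_then_coordinatewise, rule continuous_on_product_then_coordinatewise)
     (rule continuous_on_id)

text \<open>A unitary depends continuously on its columns, and the orthonormal tuples form a compact
  set: a closed condition \<open>H\<close> inside a product \<open>F\<close> of polydiscs.\<close>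

lemma compact_unitary: "compact (unitary n)"
proof -
  \<comment> \<open>Tuples are indexed by all naturals, so the entries from \<open>n\<close> on are
    pinned to 0 to keep the set compact.\<close>
  define F :: "(nat \<Rightarrow> vec) set" where "F = {e. \<forall>i. e i \<in> (if i < n then cube n 1 else {0})}"
  define H :: "(nat \<Rightarrow> vec) set" where "H = (\<Inter>i\<in>{..<n}. \<Inter>j\<in>{..<n}.
      {e. (\<Sum>t<n. e i t * cnj (e j t)) = (if i = j then 1 else 0)})"
  have "compact F" unfolding F_def by (rule compact_coordinatewise) (simp add: compact_cube)
  moreover have "closed H"
    unfolding H_def
    by (intro closed_INT ballI closed_Collect_eq continuous_intros continuous_on_coord2)
  ultimately have FH: "compact (F \<inter> H)" by (rule compact_Int_closed)
  define \<phi> where "\<phi> = (\<lambda>e. \<lambda>v\<in>CC n. lincomb e n v)"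
  have c: "continuous_on (F \<inter> H) \<phi>"
  proof (rule continuous_on_coordinatewise_then_product)
    fix v show "continuous_on (F \<inter> H) (\<lambda>e. \<phi> e v)"
    proof (cases "v \<in> CC n")
      case True
      have "continuous_on (F \<inter> H) (\<lambda>e. lincomb e n v)"
        unfolding lincomb_def
        by (rule continuous_on_coordinatewise_then_product) (intro continuous_intros continuous_on_coord2)
      then show ?thesis using True by (simp add: \<phi>_def)
    qed (simp add: \<phi>_def)
  qed
  have FC: "e i \<in> CC n" if "e \<in> F" "i < n" for e i
    using that(1)[unfolded F_def, THEN CollectD, rule_format, of i] that(2) cube_subset_CC by auto
  have FHo: "orthonormal n e \<longleftrightarrow> e \<in> H" if "e \<in> F" for e
    unfolding orthonormal_def H_def using vinner_CC[OF FC[OF that]] by auto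
  have "unitary n = \<phi> ` (F \<inter> H)"
  proof
    show "\<phi> ` (F \<inter> H) \<subseteq> unitary n"
    proof
      fix A assume "A \<in> \<phi> ` (F \<inter> H)"
      then obtain e where e: "e \<in> F" "e \<in> H" "A = \<phi> e" by auto
      show "A \<in> unitary n"
        unfolding unitary_def e(3) \<phi>_def
        by (rule isometry_of_orthonormal) (use FHo[OF e(1)] FC[OF e(1)] e(2) in auto)
    qed
    show "unitary n \<subseteq> \<phi> ` (F \<inter> H)"
    proof
      fix A assume A: "A \<in> unitary n"
      then have A': "A \<in> isometries (CC n) (CC n)" by (simp add: unitary_def)
      note o = isometry_orthonormal[OF A']
      define e where "e = (\<lambda>i. if i < n then A (ax i) else 0)"
      have "e i \<in> (if i < n then cube n 1 else {0})" for i
      proof (cases "i < n")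
        case True
        have "of_real (nsq n (A (ax i))) = (1 :: complex)"
          using o(1) True nsq_eq[OF o(2)[OF True]] by (simp add: orthonormal_def)
        then have "nsq n (A (ax i)) = 1" by (rule of_real_eq_1_iff[THEN iffD1])
        then show ?thesis using True nsq_cube[OF o(2)[OF True], of 1] by (simp add: e_def)
      qed (simp add: e_def)
      then have eF: "e \<in> F" by (simp add: F_def)
      have "orthonormal n e" using o(1) by (simp add: orthonormal_def e_def)
      then have eH: "e \<in> H" using FHo[OF eF] by simp
      have "A v = \<phi> e v" if v: "v \<in> CC n" for v
      proof -
        have "A v = lincomb (\<lambda>i. A (ax i)) n v" by (rule isometry_eq_lincomb[OF A' v])
        also have "\<dots> = lincomb e n v" by (rule lincomb_cong) (simp add: e_def)
        finally show ?thesis using v by (simp add: \<phi>_def)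
      qed
      then have "A = \<phi> e"
        by (intro extensionalityI[OF unitaryD(2)[OF A], of "\<phi> e"]) (auto simp: \<phi>_def)
      then show "A \<in> \<phi> ` (F \<inter> H)" using eF eH by blast
    qed
  qed
  then show ?thesis using compact_continuous_image[OF c FH] by simp
qed

lemma compact_Hausdorff_unitary: "compact_Hausdorff (top_of_set (unitary n))"
  unfolding compact_Hausdorff_def
  using compact_unitary[of n] Hausdorff_space_euclidean_vec
  by (simp add: Hausdorff_space_subtopology compact_space_subtopology)

section \<open>Compactness of spheres and Thom spaces\<close>

lemma points_sphere_of [simp]: "points (sphere_of V) = insert None (Some ` V)"
  by (simp add: sphere_of_def)

lemma Pt_sphere_of [simp]: "Pt (sphere_of V) = None"
  by (simp add: sphere_of_def)

lemma locally_compact_CC: "locally_compact_space (top_of_set (CC n))"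
  unfolding locally_compact_space_def
proof
  fix x assume "x \<in> topspace (top_of_set (CC n))"
  then have x: "x \<in> CC n" by simp
  define M where "M = nsq n x + 1"
  have M: "1 \<le> M" by (simp add: M_def nsq_def sum_nonneg)
  have "open {w. nsq n w < M}"
    by (intro open_Collect_less continuous_on_nsq continuous_on_const)
  then have "openin (top_of_set (CC n)) (CC n \<inter> {w. nsq n w < M})"
    by (rule openin_open_Int)
  moreover have "compactin (top_of_set (CC n)) (cube n M)"
    using cube_subset_CC compact_cube by (simp add: compactin_subtopology)
  moreover have "CC n \<inter> {w. nsq n w < M} \<subseteq> cube n M"
    using nsq_cube[OF _ _ M] by auto
  moreover have "x \<in> CC n \<inter> {w. nsq n w < M}" using x by (simp add: M_def)
  ultimately show "\<exists>U K. openin (top_of_set (CC n)) U \<and>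
      compactin (top_of_set (CC n)) K \<and> x \<in> U \<and> U \<subseteq> K" by blast
qed

lemma compact_Hausdorff_sphere: "compact_Hausdorff (Sp (sphere_of (CC n)))"
  unfolding compact_Hausdorff_def sphere_of_def
  by (simp add: Hausdorff_space_Alexandroff_compactification locally_compact_CC Hausdorff_space_subtopology)

definition thom_rep :: "nat \<Rightarrow> (vec \<Rightarrow> vec) \<times> vec \<Rightarrow> (vec \<Rightarrow> vec) \<times> vec" where
  "thom_rep k = (\<lambda>(A, v). (\<lambda>u\<in>CC k. A u, A (shift k v)))"

text \<open>The extension of \<open>thom_rep\<close> by the points at infinity; it is the quotient
  map of U(k+m) x S^2m onto the Thom space.\<close>

definition thom_map :: "nat \<Rightarrow> (vec \<Rightarrow> vec) \<times> vec option \<Rightarrow> jmor" where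
  "thom_map k = (\<lambda>(A, z). map_option (\<lambda>v. thom_rep k (A, v)) z)"

lemma thom_map_simps [simp]:
  "thom_map k (A, None) = None" "thom_map k (A, Some v) = Some (\<lambda>u\<in>CC k. A u, A (shift k v))"
  by (simp_all add: thom_map_def thom_rep_def)

lemma thom_rep_image: "thom_rep k ` (unitary (k + m) \<times> CC m) = J_bundle (CC k) (CC (k + m))"
proof
  show "thom_rep k ` (unitary (k + m) \<times> CC m) \<subseteq> J_bundle (CC k) (CC (k + m))"
    using unitary_rep_J_bundle by (auto simp: thom_rep_def)
  show "J_bundle (CC k) (CC (k + m)) \<subseteq> thom_rep k ` (unitary (k + m) \<times> CC m)"
  proof
    fix p assume p: "p \<in> J_bundle (CC k) (CC (k + m))"
    obtain f x where fx: "p = (f, x)" by (cases p)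
    obtain A v where A: "A \<in> unitary (k + m)" "v \<in> CC m" "\<And>u. u \<in> CC k \<Longrightarrow> A u = f u" "A (shift k v) = x"
      using J_bundle_unitary_rep[of f x k m] p fx by blast
    have "f \<in> extensional (CC k)" using isometriesD(2) J_bundleD(1) p fx by blast
    then have "(\<lambda>u\<in>CC k. A u) = f" using A(3) by (intro extensionalityI[of _ "CC k"]) auto
    then show "p \<in> thom_rep k ` (unitary (k + m) \<times> CC m)"
      using A by (intro image_eqI[of _ _ "(A, v)"]) (auto simp: thom_rep_def fx)
  qed
qed

text \<open>Evaluation of functions is not jointly continuous in the product topology. For linear
  maps on C^n, however, the value is a finite sum of coordinates of \<open>b p\<close> times values
  at coordinate vectors.\<close>

lemma continuous_on_eval_isometry:
  assumes c: "continuous_on S a" "continuous_on S b"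
    and ab: "\<And>p. p \<in> S \<Longrightarrow> a p \<in> isometries (CC n) V" "\<And>p. p \<in> S \<Longrightarrow> b p \<in> CC n"
  shows "continuous_on S (\<lambda>p. a p (b p))"
proof -
  have "continuous_on S (\<lambda>p. lincomb (\<lambda>i. a p (ax i)) n (b p))"
  proof (rule continuous_on_coordinatewise_then_product)
    fix j
    have "continuous_on S (\<lambda>p. b p i)" for i
      by (rule continuous_on_product_then_coordinatewise[OF c(2)])
    moreover have "continuous_on S (\<lambda>p. a p (ax i) j)" for i
      by (rule continuous_on_product_then_coordinatewise[OF continuous_on_product_then_coordinatewise[OF c(1)]])
    ultimately show "continuous_on S (\<lambda>p. lincomb (\<lambda>i. a p (ax i)) n (b p) j)"
      unfolding lincomb_def by (intro continuous_on_sum continuous_on_mult)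
  qed
  then show ?thesis
    using isometry_eq_lincomb[OF ab] by (simp cong: continuous_on_cong)
qed

lemma continuous_on_shift: "continuous_on S (shift k)"
proof (rule continuous_on_coordinatewise_then_product)
  fix i show "continuous_on S (\<lambda>v. shift k v i)"
    unfolding shift_def
    by (cases "i < k") (auto intro: continuous_on_product_then_coordinatewise continuous_on_id)
qed

lemma continuous_on_thom_rep: "continuous_on (unitary (k + m) \<times> CC m) (thom_rep k)"
proof -
  have 1: "continuous_on (unitary (k + m) \<times> CC m) (\<lambda>p. \<lambda>u\<in>CC k. fst p u)"
  proof (rule continuous_on_coordinatewise_then_product)
    fix u
    have "continuous_on (unitary (k + m) \<times> CC m) (\<lambda>p. fst p u)"
      by (rule continuous_on_product_then_coordinatewise[OF continuous_on_fst[OF continuous_on_id]])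
    then show "continuous_on (unitary (k + m) \<times> CC m) (\<lambda>p. (\<lambda>u\<in>CC k. fst p u) u)"
      by (cases "u \<in> CC k") simp_all
  qed
  have 2: "continuous_on (unitary (k + m) \<times> CC m) (\<lambda>p. fst p (shift k (snd p)))"
  proof -
    have c1: "continuous_on (unitary (k + m) \<times> CC m) fst" by (rule continuous_on_fst[OF continuous_on_id])
    have c2: "continuous_on (unitary (k + m) \<times> CC m) (\<lambda>p. shift k (snd p))"
      by (rule continuous_on_compose2[OF continuous_on_shift[of UNIV] continuous_on_snd[OF continuous_on_id]]) simp
    show ?thesis
      by (rule continuous_on_eval_isometry[OF c1 c2, of "k + m" "CC (k + m)"])
        (auto simp: unitary_def shift_in_CC)
  qed
  have "thom_rep k = (\<lambda>p. (\<lambda>u\<in>CC k. fst p u, fst p (shift k (snd p))))"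
    by (auto simp: thom_rep_def)
  then show ?thesis using continuous_on_Pair[OF 1 2] by simp
qed

lemma nsq_shift: "v \<in> CC m \<Longrightarrow> nsq (k + m) (shift k v) = nsq m v"
proof -
  assume v: "v \<in> CC m"
  have "(of_real (nsq (k + m) (shift k v)) :: complex) = of_real (nsq m v)"
    using vinner_shift[OF v, of k v] nsq_eq[OF v] nsq_eq[OF shift_in_CC[OF v], of k] by simp
  then show ?thesis by (rule of_real_eq_iff[THEN iffD1])
qed

text \<open>The compactification is Hausdorff once the bundle is locally compact Hausdorff. Points
  of the bundle whose vector part has bounded norm lie in the image under \<open>thom_rep\<close> of
  the compact product of U(k+m) with a polydisc, as unitaries preserve the norm.\<close>

lemma compact_Hausdorff_J_mor: "compact_Hausdorff (Sp (J_mor (CC k) (CC (k + m))))"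
proof -
  let ?J = "J_bundle (CC k) (CC (k + m))"
  have "locally_compact_space (top_of_set ?J)"
    unfolding locally_compact_space_def
  proof
    fix p assume "p \<in> topspace (top_of_set ?J)"
    then have p: "p \<in> ?J" by simp
    define M where "M = nsq (k + m) (snd p) + 1"
    have M: "1 \<le> M" by (simp add: M_def nsq_def sum_nonneg)
    have "continuous_on UNIV (\<lambda>q :: (vec \<Rightarrow> vec) \<times> vec. nsq (k + m) (snd q))"
      by (rule continuous_on_compose2[OF continuous_on_nsq[of UNIV] continuous_on_snd[OF continuous_on_id]]) simp
    then have "open {q :: (vec \<Rightarrow> vec) \<times> vec. nsq (k + m) (snd q) < M}"
      by (intro open_Collect_less continuous_on_const)
    then have o: "openin (top_of_set ?J) (?J \<inter> {q. nsq (k + m) (snd q) < M})"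
      by (rule openin_open_Int)
    define K where "K = thom_rep k ` (unitary (k + m) \<times> cube m M)"
    have sub: "unitary (k + m) \<times> cube m M \<subseteq> unitary (k + m) \<times> CC m" using cube_subset_CC by blast
    have "compact K" unfolding K_def
      by (intro compact_continuous_image continuous_on_subset[OF continuous_on_thom_rep sub]
          compact_Times compact_unitary compact_cube)
    moreover have "K \<subseteq> ?J" unfolding K_def thom_rep_image[symmetric] using sub by (rule image_mono)
    ultimately have K: "compactin (top_of_set ?J) K" by (simp add: compactin_subtopology)
    have "?J \<inter> {q. nsq (k + m) (snd q) < M} \<subseteq> K"
    proof
      fix q assume q: "q \<in> ?J \<inter> {q. nsq (k + m) (snd q) < M}"
      then obtain A v where A: "A \<in> unitary (k + m)" "v \<in> CC m" "q = thom_rep k (A, v)"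
        unfolding thom_rep_image[symmetric] by auto
      have "nsq (k + m) (shift k v) < M"
        using q A isometry_nsq[of A "CC (k + m)" "CC (k + m)" "k + m" "k + m" "shift k v"] shift_in_CC[OF A(2)]
        by (simp add: thom_rep_def unitary_def)
      then have "v \<in> cube m M" using nsq_cube[OF A(2) _ M] by (simp add: nsq_shift[OF A(2)])
      then show "q \<in> K" using A by (auto simp: K_def)
    qed
    moreover have "p \<in> ?J \<inter> {q. nsq (k + m) (snd q) < M}" using p by (simp add: M_def)
    ultimately show "\<exists>U K. openin (top_of_set ?J) U \<and>
        compactin (top_of_set ?J) K \<and> p \<in> U \<and> U \<subseteq> K" using o K by blast
  qed
  then show ?thesis
    unfolding compact_Hausdorff_def J_mor_def
    by (simp add: Hausdorff_space_Alexandroff_compactification Hausdorff_space_subtopology Hausdorff_space_euclidean_prod)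
qed

lemma closedin_sphere_cube: "closedin (Sp (sphere_of (CC n))) (Some ` cube n M)"
proof -
  have "closedin (top_of_set (CC n)) (cube n M)"
    using compact_imp_closed[OF compact_cube] cube_subset_CC by (rule closed_subset[rotated])
  then show ?thesis
    using cube_subset_CC compact_cube by (simp add: sphere_of_def compactin_subtopology)
qed

lemma compact_bounded_nsq:
  assumes "compact C" "continuous_on C g"
  shows "\<exists>M\<ge>1. \<forall>z\<in>C. nsq n (g z) \<le> M"
proof -
  have "continuous_on C (\<lambda>z. nsq n (g z))"
    by (rule continuous_on_compose2[OF continuous_on_nsq[of UNIV] assms(2)]) simp
  then have "compact ((\<lambda>z. nsq n (g z)) ` C)" using assms(1) by (intro compact_continuous_image)
  then have "bounded ((\<lambda>z. nsq n (g z)) ` C)" by (rule compact_imp_bounded)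
  then obtain M where M: "\<forall>z\<in>C. \<bar>nsq n (g z)\<bar> \<le> M" by (auto simp: bounded_iff)
  show ?thesis
  proof (intro exI[of _ "max M 1"] conjI ballI)
    fix z assume "z \<in> C"
    then have "\<bar>nsq n (g z)\<bar> \<le> M" using M by blast
    then show "nsq n (g z) \<le> max M 1" by linarith
  qed simp
qed

text \<open>\<open>thom_rep\<close> is proper: a compact set of the bundle has bounded vector parts
  \<open>A (shift k v)\<close>, and \<open>v\<close> has the same norm, so it stays in a
  polydisc.\<close>

lemma continuous_map_thom_map:
  "continuous_map (prod_topology (top_of_set (unitary (k + m))) (Sp (sphere_of (CC m))))
     (Sp (J_mor (CC k) (CC (k + m)))) (thom_map k)"
proof -
  let ?U = "top_of_set (unitary (k + m))" and ?S = "Sp (sphere_of (CC m))"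
  let ?J = "J_bundle (CC k) (CC (k + m))"
  let ?P = "prod_topology ?U ?S" and ?W = "unitary (k + m) \<times> Some ` CC m"
  let ?r = "\<lambda>p. thom_rep k (fst p, the (snd p))"
  have oS: "openin ?S (Some ` CC m)" by (simp add: sphere_of_def)
  have W: "openin ?P ?W" using oS by (simp add: openin_prod_Times_iff)
  have "subtopology ?P ?W = prod_topology ?U (subtopology ?S (Some ` CC m))"
    by (simp add: subtopology_Times subtopology_subtopology)
  moreover have "continuous_map (prod_topology ?U (subtopology ?S (Some ` CC m)))
      (prod_topology ?U (top_of_set (CC m))) (\<lambda>p. (fst p, the (snd p)))"
    using continuous_map_compose[OF continuous_map_snd continuous_map_the[of "top_of_set (CC m)"]]
    by (intro continuous_map_pairedI continuous_map_fst) (simp add: sphere_of_def o_def)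
  moreover have "continuous_map (prod_topology ?U (top_of_set (CC m))) (top_of_set ?J) (thom_rep k)"
    using continuous_on_thom_rep thom_rep_image by (simp add: image_subset_iff_funcset[symmetric])
  ultimately have r: "continuous_map (subtopology ?P ?W) (top_of_set ?J) ?r"
    using continuous_map_compose[of _ _ "\<lambda>p. (fst p, the (snd p))" _ "thom_rep k"] by (simp add: o_def)
  show ?thesis
    unfolding J_mor_def bspace.simps gspace.simps
  proof (rule continuous_map_into_Alexandroff[OF W r])
    fix C assume "compactin (top_of_set ?J) C"
    then have C: "compact C" "C \<subseteq> ?J" by (auto simp: compactin_subtopology)
    obtain M where M: "1 \<le> M" "\<forall>p\<in>C. nsq (k + m) (snd p) \<le> M"
      using compact_bounded_nsq[OF C(1) continuous_on_snd[OF continuous_on_id]] by blast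
    have "closedin ?P (unitary (k + m) \<times> Some ` cube m M)"
      using closedin_sphere_cube by (simp add: closedin_prod_Times_iff)
    moreover have "unitary (k + m) \<times> Some ` cube m M \<subseteq> ?W" using cube_subset_CC by blast
    moreover have "z \<in> unitary (k + m) \<times> Some ` cube m M" if z: "z \<in> ?W" "?r z \<in> C" for z
    proof -
      obtain A v where A: "z = (A, Some v)" "A \<in> unitary (k + m)" "v \<in> CC m" using z(1) by auto
      have "nsq (k + m) (A (shift k v)) \<le> M" using M(2) z(2) by (auto simp: A(1) thom_rep_def)
      then have "nsq m v \<le> M"
        using isometry_nsq[of A "CC (k + m)" "CC (k + m)" "k + m" "k + m" "shift k v"] shift_in_CC[OF A(3)] A(2)
        by (simp add: unitary_def nsq_shift[OF A(3)])
      then show ?thesis using nsq_cube[OF A(3) _ M(1)] A by simp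
    qed
    ultimately show "\<exists>T. closedin ?P T \<and> T \<subseteq> ?W \<and> (\<forall>z\<in>?W. ?r z \<in> C \<longrightarrow> z \<in> T)" 
      by (intro exI[of _ "unitary (k + m) \<times> Some ` cube m M"] conjI ballI impI)
  qed (auto simp: thom_map_def sphere_of_def)
qed

lemma thom_map_surj:
  "thom_map k ` (unitary (k + m) \<times> points (sphere_of (CC m))) = points (J_mor (CC k) (CC (k + m)))"
proof -
  have "unitary (k + m) \<times> points (sphere_of (CC m)) =
      unitary (k + m) \<times> {None} \<union> (\<lambda>(A, v). (A, Some v)) ` (unitary (k + m) \<times> CC m)"
    by auto
  moreover have "thom_map k ` (unitary (k + m) \<times> {None}) = {None}"
    using unitary_id[of "k + m"] by (force simp: thom_map_def)
  moreover have "thom_map k ` (\<lambda>(A, v). (A, Some v)) ` (unitary (k + m) \<times> CC m) = Some ` J_bundle (CC k) (CC (k + m))"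
  proof -
    have "thom_map k (case p of (A, v) \<Rightarrow> (A, Some v)) = Some (thom_rep k p)" for p
      by (cases p) (simp add: thom_map_def)
    then show ?thesis unfolding thom_rep_image[symmetric] image_image by (intro image_cong refl)
  qed
  ultimately show ?thesis by (simp add: image_Un)
qed

text \<open>The map S^2m x S^2n -> S^2(m+n) that collapses the wedge; it is the identification of
  spheres implicit in \<open>iter_str\<close>.\<close>

definition sphere_concat :: "nat \<Rightarrow> vec option \<times> vec option \<Rightarrow> vec option" where
  "sphere_concat m = (\<lambda>(a, b). case (a, b) of (Some v, Some w) \<Rightarrow> Some (v + shift m w) | _ \<Rightarrow> None)"

lemma sphere_concat_simps [simp]:
  "sphere_concat m (Some v, Some w) = Some (v + shift m w)"
  "sphere_concat m (None, b) = None" "sphere_concat m (a, None) = None"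
  by (auto simp: sphere_concat_def split: option.splits)

lemma block_in_CC: "v \<in> CC m \<Longrightarrow> w \<in> CC n \<Longrightarrow> v + shift m w \<in> CC (m + n)"
  using CC_mono[of m "m + n"] shift_in_CC[of w n m] by (intro add_in_CC) auto

text \<open>Proper on the finite parts because \<open>nsq\<close> is additive on orthogonal sums: a
  bound for the sum bounds both summands.\<close>

lemma continuous_map_sphere_concat:
  "continuous_map (prod_topology (Sp (sphere_of (CC m))) (Sp (sphere_of (CC n)))) (Sp (sphere_of (CC (m + n))))
     (sphere_concat m)"
proof -
  let ?S = "\<lambda>n. Sp (sphere_of (CC n))" and ?E = "\<lambda>n. top_of_set (CC n)"
  let ?P = "prod_topology (?S m) (?S n)" and ?W = "(Some ` CC m) \<times> (Some ` CC n)"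
  let ?r = "\<lambda>p. the (fst p) + shift m (the (snd p))"
  have oS: "openin (?S n) (Some ` CC n)" for n by (simp add: sphere_of_def)
  have W: "openin ?P ?W" using oS by (simp add: openin_prod_Times_iff)
  have the: "continuous_map (subtopology (?S n) (Some ` CC n)) (?E n) the" for n
    using continuous_map_the[of "?E n"] by (simp add: sphere_of_def)
  have "subtopology ?P ?W = prod_topology (subtopology (?S m) (Some ` CC m)) (subtopology (?S n) (Some ` CC n))"
    by (simp add: subtopology_Times)
  moreover have "continuous_map (prod_topology (subtopology (?S m) (Some ` CC m)) (subtopology (?S n) (Some ` CC n)))
      (prod_topology (?E m) (?E n)) (\<lambda>p. (the (fst p), the (snd p)))"
    using continuous_map_compose[OF continuous_map_fst the] continuous_map_compose[OF continuous_map_snd the]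
    by (intro continuous_map_pairedI) (simp_all add: o_def)
  moreover have "continuous_map (prod_topology (?E m) (?E n)) (?E (m + n)) (\<lambda>p. fst p + shift m (snd p))"
  proof -
    have "continuous_on (CC m \<times> CC n) (\<lambda>p. fst p + shift m (snd p))"
    proof (rule continuous_on_coordinatewise_then_product)
      fix i
      have "continuous_on (CC m \<times> CC n) (\<lambda>p. shift m (snd p))"
        by (rule continuous_on_compose2[OF continuous_on_shift[of UNIV] continuous_on_snd[OF continuous_on_id]]) simp
      then have 1: "continuous_on (CC m \<times> CC n) (\<lambda>p. shift m (snd p) i)"
        by (rule continuous_on_product_then_coordinatewise)
      have 2: "continuous_on (CC m \<times> CC n) (\<lambda>p. fst p i)"
        by (rule continuous_on_product_then_coordinatewise) (intro continuous_on_fst continuous_on_id)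
      show "continuous_on (CC m \<times> CC n) (\<lambda>p. (fst p + shift m (snd p)) i)"
        using continuous_on_add[OF 2 1] by simp
    qed
    then show ?thesis using block_in_CC by auto
  qed
  ultimately have r: "continuous_map (subtopology ?P ?W) (?E (m + n)) ?r"
    using continuous_map_compose[of _ _ "\<lambda>p. (the (fst p), the (snd p))" _ "\<lambda>p. fst p + shift m (snd p)"]
    by (simp add: o_def)
  show ?thesis
    unfolding sphere_of_def[of "CC (m + n)"] bspace.simps
  proof (rule continuous_map_into_Alexandroff[OF W r])
    fix C assume "compactin (?E (m + n)) C"
    then have C: "compact C" "C \<subseteq> CC (m + n)" by (auto simp: compactin_subtopology)
    obtain M where M: "1 \<le> M" "\<forall>p\<in>C. nsq (m + n) p \<le> M"
      using compact_bounded_nsq[OF C(1) continuous_on_id] by blast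
    let ?T = "Some ` cube m M \<times> Some ` cube n M"
    have "closedin ?P ?T"
      using closedin_sphere_cube by (simp add: closedin_prod_Times_iff)
    moreover have "?T \<subseteq> ?W" using cube_subset_CC by blast
    moreover have "z \<in> ?T" if z: "z \<in> ?W" "?r z \<in> C" for z
    proof -
      obtain v w where A: "z = (Some v, Some w)" "v \<in> CC m" "w \<in> CC n" using z(1) by auto
      have "nsq (m + n) (v + shift m w) \<le> M" using M(2) z(2) by (auto simp: A(1))
      moreover have "nsq (m + n) (v + shift m w) = nsq m v + nsq n w"
      proof -
        have "(of_real (nsq (m + n) (v + shift m w)) :: complex) = of_real (nsq m v + nsq n w)"
          using vinner_block[OF A(2,2,3), of w] nsq_eq[OF A(2)] nsq_eq[OF A(3)] nsq_eq[OF block_in_CC[OF A(2,3)]]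
          by simp
        then show ?thesis by (rule of_real_eq_iff[THEN iffD1])
      qed
      moreover have "0 \<le> nsq m v" "0 \<le> nsq n w" by (simp_all add: nsq_def sum_nonneg)
      ultimately have "nsq m v \<le> M" "nsq n w \<le> M" by linarith+
      then show ?thesis using nsq_cube[OF A(2) _ M(1)] nsq_cube[OF A(3) _ M(1)] A by simp
    qed
    ultimately show "\<exists>T. closedin ?P T \<and> T \<subseteq> ?W \<and> (\<forall>z\<in>?W. ?r z \<in> C \<longrightarrow> z \<in> T)" 
      by (intro exI[of _ ?T] conjI ballI impI)
  qed (auto simp: sphere_of_def)
qed

section \<open>Objects of \<open>J\<close>\<close>

text \<open>Invariance under \<open>mconj\<close> means that the frame vectors are real; coordinates
  taken in such a frame commute with complex conjugation.\<close>

definition real_frame :: "nat \<Rightarrow> vec set \<Rightarrow> (vec \<Rightarrow> vec) \<Rightarrow> bool" where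
  "real_frame k U \<theta> \<longleftrightarrow> \<theta> \<in> isometries (CC k) U \<and> bij_betw \<theta> (CC k) U \<and> (\<forall>s. mconj s (CC k) \<theta> = \<theta>)"

text \<open>A maximal orthonormal family of real vectors in \<open>V\<close> spans \<open>V\<close>, since the real and imaginary
  parts of a vector orthogonal to real vectors are again orthogonal to them.\<close>

lemma real_frame_exists:
  assumes V: "fd_subspace V" and c: "conj_closed V"
  shows "\<exists>k \<theta>. real_frame k V \<theta>"
proof -
  obtain N where N: "V \<subseteq> CC N" using V by (auto simp: fd_subspace_def)
  define P where "P = (\<lambda>k. \<exists>e. orthonormal k e \<and> (\<forall>i<k. e i \<in> V \<and> vconj True (e i) = e i))"
  have "P 0" by (auto simp: P_def orthonormal_def)
  have bound: "k \<le> N" if "P k" for k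
  proof -
    obtain e where "orthonormal k e" "\<forall>i<k. e i \<in> V" using \<open>P k\<close> by (auto simp: P_def)
    then show ?thesis using N by (intro orthonormal_card_le[of k e N]) auto
  qed
  have fin: "finite {k. P k}" by (rule finite_subset[of _ "{..N}"]) (use bound in auto)
  define k where "k = Max {k. P k}"
  have "P k" using Max_in[OF fin] \<open>P 0\<close> unfolding k_def by blast
  have max: "\<not> P (Suc k)" using Max_ge[OF fin, of "Suc k"] unfolding k_def by auto
  obtain e where e: "orthonormal k e" "\<And>i. i < k \<Longrightarrow> e i \<in> V" "\<And>i. i < k \<Longrightarrow> vconj True (e i) = e i"
    using \<open>P k\<close> by (auto simp: P_def)
  have eN: "\<And>i. i < k \<Longrightarrow> e i \<in> CC N" using e(2) N by auto
  have zero: "u = 0" if u: "u \<in> V" "vconj True u = u" "\<And>i. i < k \<Longrightarrow> vinner u (e i) = 0" for u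
  proof (rule ccontr)
    assume "u \<noteq> 0"
    have uN: "u \<in> CC N" using u N by auto
    obtain r :: real where r: "vinner (vscale (of_real r) u) (vscale (of_real r) u) = 1"
      by (rule exists_unit_multiple[OF uN \<open>u \<noteq> 0\<close>])
    let ?w = "vscale (of_real r) u"
    have w: "?w \<in> V" "vconj True ?w = ?w" using u V by (simp_all add: fd_subspaceD vconj_vscale)
    have o: "vinner ?w (e i) = 0" if "i < k" for i
      using u(3)[OF that] by (simp add: vinner_vscale_left[OF uN])
    have "orthonormal (Suc k) (e(k := ?w))"
      using orthonormal_extend_by(1)[OF e(1) eN vscale_in_CC[OF uN] r o] .
    moreover have "\<forall>i<Suc k. (e(k := ?w)) i \<in> V \<and> vconj True ((e(k := ?w)) i) = (e(k := ?w)) i"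
      using e w by (auto simp: less_Suc_eq)
    ultimately have "P (Suc k)" unfolding P_def by blast
    then show False using max by simp
  qed
  define \<theta> where "\<theta> = (\<lambda>v\<in>CC k. lincomb e k v)"
  have iso: "\<theta> \<in> isometries (CC k) V" unfolding \<theta>_def by (rule isometry_of_orthonormal[OF e(1,2) V])
  have "x \<in> \<theta> ` CC k" if x: "x \<in> V" for x
  proof -
    have xN: "x \<in> CC N" using x N by auto
    define d where "d = (\<lambda>i. vinner x (e i))"
    define w where "w = x + vscale (-1) (lincomb e k d)"
    have l: "lincomb e k d \<in> V" using V e(2) by (rule lincomb_in)
    have wV: "w \<in> V" using x l V unfolding w_def by (simp add: fd_subspaceD)
    then have wN: "w \<in> CC N" using N by auto
    have wo: "vinner w (e i) = 0" if "i < k" for i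
      using orthonormal_residual(2)[OF e(1) eN xN that] by (simp add: w_def d_def)
    let ?c = "vconj True w"
    have cV: "?c \<in> V" using conj_closedD[OF c wV] .
    then have cN: "?c \<in> CC N" using N by auto
    have co: "vinner ?c (e i) = 0" if "i < k" for i
      using vinner_vconj[OF wN, of True "e i"] e(3)[OF that] wo[OF that] by simp
    define p where "p = w + ?c"
    \<comment> \<open>\<open>p\<close> is twice the real part of the residual; multiplication by
      \<open>\<i>\<close> turns its imaginary part into a real vector as well.\<close>
    define q where "q = vscale \<i> (w + vscale (-1) ?c)"
    have "p = 0"
    proof (rule zero)
      show "p \<in> V" unfolding p_def using wV cV V by (simp add: fd_subspaceD)
      show "vconj True p = p" by (auto simp: p_def vconj_def)
      show "vinner p (e i) = 0" if "i < k" for i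
        unfolding p_def using wo[OF that] co[OF that] by (simp add: vinner_add_left[OF wN cN])
    qed
    moreover have "q = 0"
    proof (rule zero)
      show "q \<in> V" unfolding q_def using wV cV V by (simp add: fd_subspaceD)
      show "vconj True q = q" by (auto simp: q_def vconj_def vscale_def algebra_simps)
      show "vinner q (e i) = 0" if "i < k" for i
        unfolding q_def using wo[OF that] co[OF that] wN cN
        by (simp add: vinner_add_left[of _ N] vinner_vscale_left[of _ N])
    qed
    ultimately have pq: "p j = 0" "q j = 0" for j by simp_all
    have "w j = 0" for j
      using pq[of j] unfolding p_def q_def by (simp add: vscale_def) 
    then have "x = lincomb e k d" by (auto simp: w_def vscale_def fun_eq_iff)
    also have "\<dots> = lincomb e k (vtake k d)" by (auto simp: lincomb_def vtake_def)
    finally show ?thesis by (intro image_eqI[of _ _ "vtake k d"]) (simp_all add: \<theta>_def)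
  qed
  then have bij: "bij_betw \<theta> (CC k) V"
    using isometry_inj[OF iso] isometriesD(1)[OF iso] by (auto simp: bij_betw_def)
  have ce: "(if s then cnj (e i j) else e i j) = e i j" if "i < k" for s i j
    using fun_cong[OF e(3)[OF that], of j] by (simp add: vconj_def)
  have "mconj s (CC k) \<theta> = \<theta>" for s
    unfolding mconj_def \<theta>_def
  proof (rule restrict_ext)
    fix u assume u: "u \<in> CC k"
    have "vconj s (lincomb e k (vconj s u)) j = lincomb e k u j" for j
    proof (cases s)
      case True
      have "cnj (\<Sum>i<k. cnj (u i) * e i j) = (\<Sum>i<k. u i * e i j)"
        unfolding cnj_sum by (rule sum.cong) (use ce[of _ True j] in auto)
      then show ?thesis using True by (simp add: vconj_def lincomb_def)
    qed simp
    then show "vconj s ((\<lambda>v\<in>CC k. lincomb e k v) (vconj s u)) = lincomb e k u" using u by auto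
  qed
  then show ?thesis using iso bij unfolding real_frame_def by blast
qed

section \<open>Finite dimension and conjugation invariance of the objects\<close>

lemma module_real_span: "module (\<lambda>(c :: real) (v :: nat \<Rightarrow> real) i. c * v i)"
  by unfold_locales (auto simp: algebra_simps)

lemma real_span_closed:
  shows "0 \<in> real_span B" "a \<in> real_span B \<Longrightarrow> b \<in> real_span B \<Longrightarrow> a + b \<in> real_span B"
    "a \<in> real_span B \<Longrightarrow> (\<lambda>i. c * a i) \<in> real_span B" "a \<in> B \<Longrightarrow> a \<in> real_span B"
  unfolding real_span_def
  by (rule module.span_zero[OF module_real_span] module.span_add[OF module_real_span]
      module.span_scale[OF module_real_span] module.span_base[OF module_real_span]; assumption?)+

lemma real_span_support:
  assumes "\<And>b i. b \<in> B \<Longrightarrow> n \<le> i \<Longrightarrow> b i = 0" "a \<in> real_span B" "n \<le> i"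
  shows "a i = 0"
proof -
  interpret module "\<lambda>(c :: real) (v :: nat \<Rightarrow> real) i. c * v i" by (rule module_real_span)
  have "a \<in> {a. \<forall>i\<ge>n. a i = 0}"
    using assms(2) unfolding real_span_def
    by (rule span_induct) (use assms(1) in \<open>auto simp: subspace_def\<close>)
  then show ?thesis using assms(3) by blast
qed

text \<open>Finitely many generators of finite support have a common support bound, inherited by
  their span. Conjugation only changes the sign of the second component in
  \<open>complexification\<close>.\<close>

lemma J_obj_fd: assumes "U \<in> J_obj" shows "fd_subspace U" "conj_closed U"
proof -
  obtain B where B: "U = complexification (real_span B)" "finite B" "\<And>b. b \<in> B \<Longrightarrow> finite {i. b i \<noteq> 0}"
    using assms by (auto simp: J_obj_def)
  have "finite (\<Union>b\<in>B. {i. b i \<noteq> 0})" using B by blast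
  then obtain n where n: "\<forall>i\<in>(\<Union>b\<in>B. {i. b i \<noteq> 0}). i < n"
    unfolding finite_nat_set_iff_bounded ..
  have "b i = 0" if "b \<in> B" "n \<le> i" for b i
  proof (rule ccontr)
    assume "b i \<noteq> 0"
    then have "i < n" using n that(1) by blast
    then show False using that(2) by simp
  qed
  then have supp: "a i = 0" if "a \<in> real_span B" "n \<le> i" for a i
    using real_span_support[OF _ that] by blast
  let ?C = "\<lambda>a b i. Complex (a i) (b i)"
  have mem: "?C a b \<in> U" if "a \<in> real_span B" "b \<in> real_span B" for a b
    using that by (auto simp: B(1) complexification_def)
  have U: "\<exists>a b. u = ?C a b \<and> a \<in> real_span B \<and> b \<in> real_span B" if "u \<in> U" for u
    using that by (auto simp: B(1) complexification_def)
  note sp = real_span_closed[where B = B]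
  have "(0 :: vec) = ?C 0 0" by (auto simp: complex_eq_iff)
  then have "0 \<in> U" using mem[OF sp(1) sp(1)] by simp
  moreover have "u + v \<in> U" if uv: "u \<in> U" "v \<in> U" for u v
  proof -
    obtain a b a' b' where ab: "u = ?C a b" "v = ?C a' b'"
      and m: "a \<in> real_span B" "b \<in> real_span B" "a' \<in> real_span B" "b' \<in> real_span B"
      using U[OF uv(1)] U[OF uv(2)] by blast
    have "u + v = ?C (a + a') (b + b')" by (auto simp: ab complex_eq_iff)
    then show ?thesis using mem[OF sp(2)[OF m(1,3)] sp(2)[OF m(2,4)]] by simp
  qed
  moreover have "vscale c u \<in> U" if u: "u \<in> U" for c u
  proof -
    obtain a b where ab: "u = ?C a b" and m: "a \<in> real_span B" "b \<in> real_span B"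
      using U[OF u] by blast
    let ?a = "(\<lambda>i. Re c * a i) + (\<lambda>i. - Im c * b i)" and ?b = "(\<lambda>i. Re c * b i) + (\<lambda>i. Im c * a i)"
    have "vscale c u = ?C ?a ?b" by (auto simp: ab complex_eq_iff vscale_def)
    moreover have "?a \<in> real_span B" "?b \<in> real_span B"
      by (rule sp(2)[OF sp(3)[OF m(1)] sp(3)[OF m(2)]], rule sp(2)[OF sp(3)[OF m(2)] sp(3)[OF m(1)]])
    ultimately show ?thesis using mem[of ?a ?b] by simp
  qed
  moreover have "U \<subseteq> CC n"
  proof
    fix u assume "u \<in> U"
    then obtain a b where ab: "u = ?C a b" and m: "a \<in> real_span B" "b \<in> real_span B"
      using U by blast
    show "u \<in> CC n" using supp[OF m(1)] supp[OF m(2)] by (simp add: ab CC_def complex_eq_iff)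
  qed
  ultimately show "fd_subspace U" unfolding fd_subspace_def by blast
  show "conj_closed U"
    unfolding conj_closed_def
  proof (intro allI ballI)
    fix s u assume "u \<in> U"
    then obtain a b where ab: "u = ?C a b" and m: "a \<in> real_span B" "b \<in> real_span B"
      using U by blast
    have "vconj s u = ?C a (\<lambda>i. (if s then -1 else 1) * b i)"
      by (auto simp: ab vconj_def complex_eq_iff)
    then show "vconj s u \<in> U" using mem[OF m(1) sp(3)[OF m(2)]] by simp
  qed
qed

lemma CC_in_J_obj: "CC n \<in> J_obj"
proof -
  define r where "r = (\<lambda>i j :: nat. if j = i then 1 else (0::real))"
  define B where "B = r ` {..<n}"
  have sp: "a \<in> real_span B \<longleftrightarrow> (\<forall>i\<ge>n. a i = 0)" for a
  proof
    assume "a \<in> real_span B"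
    moreover have "b i = 0" if "b \<in> B" "n \<le> i" for b i
      using that by (auto simp: B_def r_def)
    ultimately show "\<forall>i\<ge>n. a i = 0"
      using real_span_support[of B n a] by blast
  next
    assume a: "\<forall>i\<ge>n. a i = 0"
    have *: "(\<lambda>j. if j < m then a j else 0) \<in> real_span B" if "m \<le> n" for m
      using that
    proof (induction m)
      case 0
      have "(\<lambda>j. if j < 0 then a j else 0) = 0" by auto
      then show "(\<lambda>j. if j < 0 then a j else 0) \<in> real_span B" using real_span_closed(1) by metis
    next
      case (Suc m)
      have "(\<lambda>j. if j < Suc m then a j else 0) = (\<lambda>j. if j < m then a j else 0) + (\<lambda>j. a m * r m j)"
        by (auto simp: r_def less_Suc_eq)
      moreover have "(\<lambda>j. a m * r m j) \<in> real_span B"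
        using Suc.prems by (intro real_span_closed(3,4)) (auto simp: B_def)
      ultimately show "(\<lambda>j. if j < Suc m then a j else 0) \<in> real_span B"
        using Suc real_span_closed(2) by (metis Suc_leD)
    qed
    have "a = (\<lambda>j. if j < n then a j else 0)" using a by auto
    then show "a \<in> real_span B" using *[of n] by simp
  qed
  have "CC n = complexification (real_span B)"
  proof
    show "CC n \<subseteq> complexification (real_span B)"
    proof
      fix v assume v: "v \<in> CC n"
      have "v = (\<lambda>i. Complex (Re (v i)) (Im (v i)))" by simp
      moreover have "(\<lambda>i. Re (v i)) \<in> real_span B" "(\<lambda>i. Im (v i)) \<in> real_span B"
        using v by (auto simp: sp CC_def)
      ultimately show "v \<in> complexification (real_span B)"
        unfolding complexification_def
        by (intro CollectI exI[of _ "\<lambda>i. Re (v i)"] exI[of _ "\<lambda>i. Im (v i)"] conjI)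
    qed
    show "complexification (real_span B) \<subseteq> CC n"
      by (auto simp: complexification_def sp CC_def complex_eq_iff)
  qed
  moreover have "finite B" "\<forall>b\<in>B. finite {i. b i \<noteq> 0}" by (auto simp: B_def r_def)
  ultimately show ?thesis unfolding J_obj_def by blast
qed

text \<open>Dimension and frame are one choice, so that \<open>jdim\<close> and \<open>jiso\<close>
  fit together. The separate clause for the spaces \<open>CC k\<close> is what makes
  \<open>spectrum_of (efunctor_of X)\<close> equal to \<open>X\<close> instead of only
  isomorphic.\<close>

definition J_frame :: "vec set \<Rightarrow> nat \<times> (vec \<Rightarrow> vec)" where
  "J_frame U = (if \<exists>k. U = CC k then (THE k. U = CC k, \<lambda>u\<in>U. u)
     else SOME p. real_frame (fst p) U (snd p))"

definition jdim :: "vec set \<Rightarrow> nat" where "jdim U = fst (J_frame U)"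
definition jiso :: "vec set \<Rightarrow> vec \<Rightarrow> vec" where "jiso U = snd (J_frame U)"
definition jinv :: "vec set \<Rightarrow> vec \<Rightarrow> vec" where
  "jinv U = restrict (inv_into (CC (jdim U)) (jiso U)) U"

lemma jdim_CC [simp]: "jdim (CC k) = k" and jiso_CC: "jiso (CC k) = (\<lambda>u\<in>CC k. u)"
proof -
  have "(THE j. CC k = CC j) = k" by (rule the_equality) (auto dest: CC_inj)
  then show "jdim (CC k) = k" "jiso (CC k) = (\<lambda>u\<in>CC k. u)"
    by (auto simp: jdim_def jiso_def J_frame_def)
qed

lemma real_frame_jiso: assumes "U \<in> J_obj" shows "real_frame (jdim U) U (jiso U)"
proof (cases "\<exists>k. U = CC k")
  case True
  then obtain k where k: "U = CC k" by blast
  have "(\<lambda>u\<in>CC k. u) \<in> isometries (CC k) (CC k)" by (intro isometry_id) auto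
  moreover have "bij_betw (\<lambda>u\<in>CC k. u) (CC k) (CC k)" by (auto simp: bij_betw_def inj_on_def)
  ultimately show ?thesis by (simp add: k jiso_CC real_frame_def mconj_id)
next
  case False
  obtain k \<theta> where "real_frame k U \<theta>" using real_frame_exists[OF J_obj_fd[OF assms]] by blast
  then have "real_frame (fst (k, \<theta>)) U (snd (k, \<theta>))" by simp
  then have "real_frame (fst (SOME p. real_frame (fst p) U (snd p))) U (snd (SOME p. real_frame (fst p) U (snd p)))"
    by (rule someI[where P = "\<lambda>p. real_frame (fst p) U (snd p)"])
  then show ?thesis using False by (simp add: jdim_def jiso_def J_frame_def)
qed

lemma jiso:
  assumes "U \<in> J_obj"
  shows "jiso U \<in> isometries (CC (jdim U)) U" "bij_betw (jiso U) (CC (jdim U)) U"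
    "mconj s (CC (jdim U)) (jiso U) = jiso U"
  using real_frame_jiso[OF assms] by (auto simp: real_frame_def)

lemma jinv:
  assumes "U \<in> J_obj"
  shows "jinv U \<in> isometries U (CC (jdim U))" "v \<in> U \<Longrightarrow> jiso U (jinv U v) = v"
    "u \<in> CC (jdim U) \<Longrightarrow> jinv U (jiso U u) = u"
  using isometry_inverse[OF jiso(1,2)[OF assms] fd_subspace_CC J_obj_fd(1)[OF assms]]
  by (simp_all add: jinv_def)

lemma mconj_jinv:
  assumes "U \<in> J_obj" shows "mconj s U (jinv U) = jinv U"
  unfolding mconj_def
proof (rule extensionalityI[of _ U])
  show "jinv U \<in> extensional U" by (simp add: jinv_def)
  fix u assume u: "u \<in> U"
  let ?w = "jinv U (vconj s u)"
  have cu: "vconj s u \<in> U" using conj_closedD[OF J_obj_fd(2)[OF assms] u] .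
  have w: "?w \<in> CC (jdim U)" using isometriesD(1)[OF jinv(1)[OF assms] cu] .
  have "jiso U (vconj s ?w) = vconj s (jiso U ?w)"
    using arg_cong[OF jiso(3)[OF assms, of s], of "\<lambda>f. f (vconj s ?w)"] w by (simp add: mconj_apply)
  also have "\<dots> = u" using jinv(2)[OF assms cu] by simp
  finally have "jinv U u = vconj s ?w" using jinv(3)[OF assms, of "vconj s ?w"] w by simp
  then show "(\<lambda>u\<in>U. vconj s (jinv U (vconj s u))) u = jinv U u" using u by simp
qed simp

section \<open>Reduction of morphisms to the objects \<open>CC k\<close>\<close>

definition J_up :: "vec set \<Rightarrow> jmor" where "J_up U = Some (jiso U, 0)"
definition J_dn :: "vec set \<Rightarrow> jmor" where "J_dn U = Some (jinv U, 0)"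

lemma J_up_in: "U \<in> J_obj \<Longrightarrow> J_up U \<in> points (J_mor (CC (jdim U)) U)"
  using fd_subspaceD(1)[OF J_obj_fd(1)] by (auto simp: J_up_def J_bundle_def jiso)

lemma J_dn_in: "U \<in> J_obj \<Longrightarrow> J_dn U \<in> points (J_mor U (CC (jdim U)))"
  by (auto simp: J_dn_def J_bundle_def jinv)

lemma J_dn_up: "U \<in> J_obj \<Longrightarrow> J_comp (CC (jdim U)) (J_dn U) (J_up U) = J_id (CC (jdim U))"
  using isometry_0[OF jinv(1) J_obj_fd(1)]
  by (auto simp: J_dn_def J_up_def J_id_def compose_def jinv intro!: restrict_ext)

lemma J_up_dn: "U \<in> J_obj \<Longrightarrow> J_comp U (J_up U) (J_dn U) = J_id U"
  using isometry_0[OF jiso(1)]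
  by (auto simp: J_dn_def J_up_def J_id_def compose_def jinv intro!: restrict_ext)

lemma J_act_up: "U \<in> J_obj \<Longrightarrow> J_act s (CC (jdim U)) (J_up U) = J_up U"
  by (simp add: J_act_def J_up_def jiso)

lemma J_act_dn: "U \<in> J_obj \<Longrightarrow> J_act s U (J_dn U) = J_dn U"
  by (simp add: J_act_def J_dn_def mconj_jinv)

lemma J_up_CC: "J_up (CC k) = J_id (CC k)"
  by (simp add: J_up_def J_id_def jiso_CC)

lemma J_dn_CC: "J_dn (CC k) = J_id (CC k)"
proof -
  have "jinv (CC k) v = v" if "v \<in> CC k" for v
    using jinv(3)[OF CC_in_J_obj, of v k] that by (simp add: jiso_CC)
  then have "jinv (CC k) = (\<lambda>u\<in>CC k. u)"
    by (intro extensionalityI[of _ "CC k"]) (auto simp: jinv_def[of "CC k"])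
  then show ?thesis by (simp add: J_dn_def J_id_def)
qed

text \<open>With \<open>jdim\<close> on objects this is a retraction of J onto its full subcategory
  of the spaces \<open>CC k\<close>; the lemmas below give its functoriality, equivariance and
  triviality there.\<close>

definition J_std :: "vec set \<Rightarrow> vec set \<Rightarrow> jmor \<Rightarrow> jmor" where
  "J_std U V \<phi> = J_comp (CC (jdim U)) (J_comp U (J_dn V) \<phi>) (J_up U)"

lemma J_std_in:
  assumes "U \<in> J_obj" "V \<in> J_obj" "\<phi> \<in> points (J_mor U V)"
  shows "J_std U V \<phi> \<in> points (J_mor (CC (jdim U)) (CC (jdim V)))"
  unfolding J_std_def
  by (intro J_comp_in[OF _ J_up_in] J_comp_in[OF J_dn_in] assms J_obj_fd fd_subspace_CC)

lemma J_std_id: "U \<in> J_obj \<Longrightarrow> J_std U U (J_id U) = J_id (CC (jdim U))"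
  by (simp only: J_std_def J_comp_id_right[OF J_dn_in J_obj_fd(1)] J_dn_up)

text \<open>\<open>J_up\<close> is natural: it compares the retraction with the identity functor.
  Under an enriched functor this becomes the naturality of the counit.\<close>

lemma J_up_std:
  assumes U: "U \<in> J_obj" and V: "V \<in> J_obj" and p: "\<phi> \<in> points (J_mor U V)"
  shows "J_comp (CC (jdim U)) (J_up V) (J_std U V \<phi>) = J_comp (CC (jdim U)) \<phi> (J_up U)"
proof -
  let ?k = "CC (jdim U)"
  note J_comp_in[OF J_dn_in[OF V] p J_obj_fd(1)[OF U] fd_subspace_CC]
  then have "J_comp ?k (J_up V) (J_std U V \<phi>) = J_comp ?k (J_comp U (J_up V) (J_comp U (J_dn V) \<phi>)) (J_up U)"
    unfolding J_std_def by (rule J_comp_assoc[OF J_up_in[OF V] _ J_up_in[OF U]])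
  also have "J_comp U (J_up V) (J_comp U (J_dn V) \<phi>) = J_comp U (J_comp V (J_up V) (J_dn V)) \<phi>"
    by (rule J_comp_assoc[OF J_up_in[OF V] J_dn_in[OF V] p])
  also have "\<dots> = \<phi>" by (simp only: J_up_dn[OF V] J_comp_id_left[OF p])
  finally show ?thesis .
qed

lemma J_std_comp:
  assumes U: "U \<in> J_obj" and V: "V \<in> J_obj" and W: "W \<in> J_obj"
    and q: "\<psi> \<in> points (J_mor U V)" and p: "\<phi> \<in> points (J_mor V W)"
  shows "J_std U W (J_comp U \<phi> \<psi>) = J_comp (CC (jdim U)) (J_std V W \<phi>) (J_std U V \<psi>)"
proof -
  let ?k = "CC (jdim U)"
  note fU = J_obj_fd(1)[OF U] and fV = J_obj_fd(1)[OF V]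
  note dp = J_comp_in[OF J_dn_in[OF W] p fV fd_subspace_CC]
  have "J_comp ?k (J_std V W \<phi>) (J_std U V \<psi>) = J_comp ?k (J_comp V (J_dn W) \<phi>) (J_comp ?k (J_up V) (J_std U V \<psi>))"
    unfolding J_std_def[of V W]
    by (rule J_comp_assoc[OF dp J_up_in[OF V] J_std_in[OF U V q], symmetric])
  also have "\<dots> = J_comp ?k (J_comp V (J_dn W) \<phi>) (J_comp ?k \<psi> (J_up U))"
    by (simp only: J_up_std[OF U V q])
  also have "\<dots> = J_comp ?k (J_comp U (J_comp V (J_dn W) \<phi>) \<psi>) (J_up U)"
    by (rule J_comp_assoc[OF dp q J_up_in[OF U]])
  also have "J_comp U (J_comp V (J_dn W) \<phi>) \<psi> = J_comp U (J_dn W) (J_comp U \<phi> \<psi>)"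
    by (rule J_comp_assoc[OF J_dn_in[OF W] p q, symmetric])
  finally show ?thesis by (simp add: J_std_def)
qed

lemma J_std_act:
  assumes U: "U \<in> J_obj" and V: "V \<in> J_obj" and p: "\<phi> \<in> points (J_mor U V)"
  shows "J_std U V (J_act s U \<phi>) = J_act s (CC (jdim U)) (J_std U V \<phi>)"
  unfolding J_std_def
  by (simp only: J_act_comp[OF J_comp_in[OF J_dn_in[OF V] p J_obj_fd(1)[OF U] fd_subspace_CC] J_up_in[OF U] conj_closed_CC J_obj_fd(2)[OF U]]
      J_act_comp[OF J_dn_in[OF V] p J_obj_fd(2)[OF U] J_obj_fd(2)[OF V]] J_act_up[OF U] J_act_dn[OF V])

lemma J_std_CC:
  assumes "\<phi> \<in> points (J_mor (CC k) (CC l))" shows "J_std (CC k) (CC l) \<phi> = \<phi>"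
  by (simp only: J_std_def J_dn_CC J_up_CC jdim_CC J_comp_id_left[OF assms] J_comp_id_right[OF assms fd_subspace_CC])

section \<open>Continuity of the reduction\<close>

definition bundle_conj :: "vec set \<Rightarrow> (vec \<Rightarrow> vec) \<Rightarrow> (vec \<Rightarrow> vec) \<Rightarrow> (vec \<Rightarrow> vec) \<times> vec \<Rightarrow> (vec \<Rightarrow> vec) \<times> vec" where
  "bundle_conj U' P Q = (\<lambda>(f, x). (\<lambda>u\<in>U'. P (f (Q u)), P x))"

text \<open>\<open>P\<close> and \<open>Q\<close> are arbitrary because both \<open>J_std\<close>
  and its inverse have this form: with \<open>jinv V\<close>, \<open>jiso U\<close> for the former
  and \<open>jiso V\<close>, \<open>jinv U\<close> for the latter.\<close>

lemma continuous_on_bundle_conj: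
  assumes P: "continuous_on V P" and Q: "\<And>u. u \<in> U' \<Longrightarrow> Q u \<in> U"
  shows "continuous_on (J_bundle U V) (bundle_conj U' P Q)"
proof -
  have 1: "continuous_on (J_bundle U V) (\<lambda>p. \<lambda>u\<in>U'. P (fst p (Q u)))"
  proof (rule continuous_on_coordinatewise_then_product)
    fix u
    show "continuous_on (J_bundle U V) (\<lambda>p. (\<lambda>u\<in>U'. P (fst p (Q u))) u)"
    proof (cases "u \<in> U'")
      case True
      have "continuous_on (J_bundle U V) (\<lambda>p. fst p (Q u))"
        by (rule continuous_on_product_then_coordinatewise[OF continuous_on_fst[OF continuous_on_id]])
      then have "continuous_on (J_bundle U V) (\<lambda>p. P (fst p (Q u)))"
        by (rule continuous_on_compose2[OF P]) (use Q[OF True] in \<open>auto simp: J_bundle_def isometriesD(1)\<close>)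
      then show ?thesis using True by simp
    qed simp
  qed
  have 2: "continuous_on (J_bundle U V) (\<lambda>p. P (snd p))"
    by (rule continuous_on_compose2[OF P continuous_on_snd[OF continuous_on_id]]) (auto simp: J_bundle_def)
  have "bundle_conj U' P Q = (\<lambda>p. (\<lambda>u\<in>U'. P (fst p (Q u)), P (snd p)))"
    by (auto simp: bundle_conj_def)
  then show ?thesis using continuous_on_Pair[OF 1 2] by simp
qed

lemma bundle_conj_in:
  assumes P: "P \<in> isometries V V'" and Q: "Q \<in> isometries U' U" and U': "fd_subspace U'"
  shows "bundle_conj U' P Q ` J_bundle U V \<subseteq> J_bundle U' V'"
proof (rule image_subsetI)
  fix p assume p: "p \<in> J_bundle U V"
  obtain f x where fx: "p = (f, x)" by (cases p)
  note F = J_bundleD[OF p[unfolded fx]]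
  have "(\<lambda>u\<in>U'. P (f (Q u))) = compose U' P (compose U' f Q)" by (auto simp: compose_def)
  then have "(\<lambda>u\<in>U'. P (f (Q u))) \<in> isometries U' V'"
    using isometry_compose[OF P isometry_compose[OF F(1) Q U'] U'] by simp
  moreover have "vinner (P x) (P (f (Q u))) = 0" if "u \<in> U'" for u
    using isometriesD(5)[OF P F(2) isometriesD(1)[OF F(1) isometriesD(1)[OF Q that]]] F(3)[OF isometriesD(1)[OF Q that]]
    by simp
  ultimately show "bundle_conj U' P Q p \<in> J_bundle U' V'"
    using isometriesD(1)[OF P F(2)] by (auto simp: fx bundle_conj_def J_bundle_def)
qed

lemma continuous_on_jiso: "V \<in> J_obj \<Longrightarrow> continuous_on (CC (jdim V)) (jiso V)"
  by (rule continuous_on_eval_isometry[where n = "jdim V" and V = V, OF continuous_on_const continuous_on_id])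
    (auto simp: jiso)

text \<open>The source is not given as some \<open>CC n\<close>, so
  \<open>continuous_on_eval_isometry\<close> does not apply directly. Instead, the
  \<open>i\<close>-th coordinate of \<open>jinv V y\<close> is the inner product of \<open>y\<close>
  with the frame vector \<open>jiso V (ax i)\<close>.\<close>

lemma continuous_on_jinv:
  assumes V: "V \<in> J_obj" shows "continuous_on V (jinv V)"
proof (rule continuous_on_coordinatewise_then_product)
  obtain N where N: "V \<subseteq> CC N" using J_obj_fd(1)[OF V] by (auto simp: fd_subspace_def)
  fix i
  show "continuous_on V (\<lambda>y. jinv V y i)"
  proof (cases "i < jdim V")
    case True
    have eq: "jinv V y i = (\<Sum>j<N. y j * cnj (jiso V (ax i) j))" if y: "y \<in> V" for y
    proof -
      have m: "jinv V y \<in> CC (jdim V)" using isometriesD(1)[OF jinv(1)[OF V] y] .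
      have "jinv V y i = vinner (jinv V y) (ax i)" using vinner_ax_right[OF m] by simp
      also have "\<dots> = vinner (jiso V (jinv V y)) (jiso V (ax i))"
        using isometriesD(5)[OF jiso(1)[OF V] m, of "ax i"] True by simp
      also have "\<dots> = vinner y (jiso V (ax i))" by (simp only: jinv(2)[OF V y])
      finally show ?thesis using vinner_CC[of y N] N y by auto
    qed
    have "continuous_on V (\<lambda>y. y j)" for j
      by (rule continuous_on_product_then_coordinatewise[OF continuous_on_id])
    then have "continuous_on V (\<lambda>y. \<Sum>j<N. y j * cnj (jiso V (ax i) j))"
      by (intro continuous_on_sum continuous_on_mult continuous_on_const)
    then show ?thesis using eq by (simp cong: continuous_on_cong)
  next
    case False
    have "jinv V y i = 0" if "y \<in> V" for y
      using isometriesD(1)[OF jinv(1)[OF V] that] False by (auto simp: CC_def)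
    then show ?thesis by (simp cong: continuous_on_cong)
  qed
qed

lemma J_std_Some:
  assumes U: "U \<in> J_obj" and V: "V \<in> J_obj" and p: "p \<in> J_bundle U V"
  shows "J_std U V (Some p) = Some (bundle_conj (CC (jdim U)) (jinv V) (jiso U) p)"
proof -
  obtain f x where fx: "p = (f, x)" by (cases p)
  note F = J_bundleD[OF p[unfolded fx]]
  have "jinv V (f 0) = 0"
    using isometry_0[OF F(1) J_obj_fd(1)[OF U]] isometry_0[OF jinv(1)[OF V] J_obj_fd(1)[OF V]] by simp
  moreover have "0 \<in> U" using fd_subspaceD(1)[OF J_obj_fd(1)[OF U]] .
  moreover have "compose (CC (jdim U)) (compose U (jinv V) f) (jiso U) = (\<lambda>u\<in>CC (jdim U). jinv V (f (jiso U u)))"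
    using isometriesD(1)[OF jiso(1)[OF U]] by (auto simp: compose_def)
  ultimately show ?thesis
    by (simp add: J_std_def J_dn_def J_up_def fx bundle_conj_def compose_eq)
qed

text \<open>On bundles \<open>?h\<close> has the continuous inverse \<open>?g\<close>, so the
  preimage of a compact \<open>C\<close> lies in the compact image of \<open>C\<close> under
  \<open>?g\<close>; this is the properness that extends \<open>?h\<close> over infinity.\<close>

lemma continuous_map_J_std:
  assumes U: "U \<in> J_obj" and V: "V \<in> J_obj"
  shows "continuous_map (Sp (J_mor U V)) (Sp (J_mor (CC (jdim U)) (CC (jdim V)))) (J_std U V)"
proof -
  let ?k = "CC (jdim U)" and ?l = "CC (jdim V)"
  let ?h = "bundle_conj ?k (jinv V) (jiso U)" and ?g = "bundle_conj U (jiso V) (jinv U)"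
  let ?E = "top_of_set (J_bundle U V)" and ?E' = "top_of_set (J_bundle ?k ?l)"
  let ?P = "Alexandroff_compactification ?E" and ?W = "Some ` J_bundle U V"
  have W: "openin ?P ?W" by simp
  have h: "continuous_map ?E ?E' ?h"
    using continuous_on_bundle_conj[OF continuous_on_jinv[OF V] isometriesD(1)[OF jiso(1)[OF U]]]
      bundle_conj_in[OF jinv(1)[OF V] jiso(1)[OF U] fd_subspace_CC] by auto
  have r: "continuous_map (subtopology ?P ?W) ?E' (\<lambda>z. ?h (the z))"
    using continuous_map_compose[OF continuous_map_the[of ?E] h] by (simp add: o_def)
  have gc: "continuous_on (J_bundle ?k ?l) ?g"
    using continuous_on_bundle_conj[OF continuous_on_jiso[OF V] isometriesD(1)[OF jinv(1)[OF U]]] .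
  have gi: "?g ` J_bundle ?k ?l \<subseteq> J_bundle U V"
    by (rule bundle_conj_in[OF jiso(1)[OF V] jinv(1)[OF U] J_obj_fd(1)[OF U]])
  have gh: "?g (?h p) = p" if "p \<in> J_bundle U V" for p
  proof -
    obtain f x where fx: "p = (f, x)" by (cases p)
    note F = J_bundleD[OF that[unfolded fx]]
    have "(\<lambda>u\<in>U. jiso V ((\<lambda>u\<in>?k. jinv V (f (jiso U u))) (jinv U u))) = f"
      using isometriesD(1)[OF jinv(1)[OF U]] isometriesD(1)[OF F(1)]
      by (intro extensionalityI[OF _ isometriesD(2)[OF F(1)]]) (auto simp: jinv U V)
    then show ?thesis using F(2) by (simp add: bundle_conj_def fx jinv V)
  qed
  show ?thesis
    unfolding J_mor_def bspace.simps gspace.simps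
  proof (rule continuous_map_into_Alexandroff[OF W r])
    fix C assume "compactin ?E' C"
    then have C: "compact C" "C \<subseteq> J_bundle ?k ?l" by (auto simp: compactin_subtopology)
    have gC: "compact (?g ` C)" "?g ` C \<subseteq> J_bundle U V"
      using compact_continuous_image[OF continuous_on_subset[OF gc C(2)] C(1)] gi C(2) by auto
    then have c: "compactin ?E (?g ` C)" by (simp add: compactin_subtopology)
    have "Hausdorff_space ?E" by (simp add: Hausdorff_space_subtopology Hausdorff_space_euclidean_prod)
    then have "closedin ?E (?g ` C)" using c by (rule compactin_imp_closedin)
    then have "closedin ?P (Some ` ?g ` C)" using c by simp
    moreover have "Some ` ?g ` C \<subseteq> ?W" using gC by (intro image_mono)
    moreover have "z \<in> Some ` ?g ` C" if "z \<in> ?W" "?h (the z) \<in> C" for z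
      using that gh by force
    ultimately show "\<exists>T. closedin ?P T \<and> T \<subseteq> ?W \<and> (\<forall>z\<in>?W. ?h (the z) \<in> C \<longrightarrow> z \<in> T)"
      by (intro exI[of _ "Some ` ?g ` C"] conjI ballI impI)
  next
    fix z assume "z \<in> ?W"
    then show "J_std U V z = Some (?h (the z))" using J_std_Some[OF U V] by auto
  next
    fix z assume "z \<in> topspace ?P" "z \<notin> ?W"
    then show "J_std U V z = None" by (auto simp: J_std_def)
  qed
qed

section \<open>Based \<open>G\<close>-spaces\<close>

lemma based_mapsD:
  assumes "f \<in> based_maps X Y"
  shows "f \<in> extensional (points X)" "continuous_map (Sp X) (Sp Y) f" "f (Pt X) = Pt Y"
    "x \<in> points X \<Longrightarrow> f x \<in> points Y"
  using assms by (auto simp: based_maps_def continuous_map_def)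

lemma based_maps_compose:
  assumes f: "f \<in> based_maps X Y" and g: "g \<in> based_maps Y Z" and P: "Pt X \<in> points X"
  shows "compose (points X) g f \<in> based_maps X Z"
proof -
  have "continuous_map (Sp X) (Sp Z) (compose (points X) g f)"
    using continuous_map_compose[OF based_mapsD(2)[OF f] based_mapsD(2)[OF g]]
    by (rule continuous_map_eq) (simp add: compose_def)
  then show ?thesis
    using P by (simp add: based_maps_def compose_def based_mapsD(3)[OF f] based_mapsD(3)[OF g])
qed

lemma based_maps_id: "Pt X \<in> points X \<Longrightarrow> (\<lambda>x\<in>points X. x) \<in> based_maps X X"
proof -
  assume "Pt X \<in> points X"
  moreover have "continuous_map (Sp X) (Sp X) (\<lambda>x\<in>points X. x)"
    by (rule continuous_map_eq[of _ _ "\<lambda>x. x"]) auto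
  ultimately show ?thesis by (simp add: based_maps_def)
qed

lemma gmapsD:
  assumes "f \<in> gmaps G X Y"
  shows "f \<in> based_maps X Y" "g \<in> carrier G \<Longrightarrow> x \<in> points X \<Longrightarrow> f (Act X g x) = Act Y g (f x)"
  using assms by (auto simp: gmaps_def)

lemma based_gspaceD:
  assumes "based_gspace G X"
  shows "cgwh (Sp X)" "weak_Hausdorff (Sp X)" "Pt X \<in> points X" "group_action G (points X) (Act X)"
    "Act X \<in> extensional (carrier G)"
    "continuous_map (kprod (gtop G) (Sp X)) (Sp X) (\<lambda>(g, x). Act X g x)"
    "g \<in> carrier G \<Longrightarrow> Act X g (Pt X) = Pt X"
    "g \<in> carrier G \<Longrightarrow> x \<in> points X \<Longrightarrow> Act X g x \<in> points X"
    "g \<in> carrier G \<Longrightarrow> h \<in> carrier G \<Longrightarrow> x \<in> points X \<Longrightarrow> Act X (g \<otimes>\<^bsub>G\<^esub> h) x = Act X g (Act X h x)"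
    "x \<in> points X \<Longrightarrow> Act X \<one>\<^bsub>G\<^esub> x = x"
    "g \<in> carrier G \<Longrightarrow> Act X g \<in> extensional (points X)"
proof -
  show a: "group_action G (points X) (Act X)" using assms by (simp add: based_gspace_def)
  interpret group_action G "points X" "Act X" by (rule a)
  show "x \<in> points X \<Longrightarrow> Act X \<one>\<^bsub>G\<^esub> x = x"
    using id_eq_one by (metis restrict_apply')
  show "g \<in> carrier G \<Longrightarrow> x \<in> points X \<Longrightarrow> Act X g x \<in> points X"
    using element_image by blast
  show "g \<in> carrier G \<Longrightarrow> h \<in> carrier G \<Longrightarrow> x \<in> points X \<Longrightarrow> Act X (g \<otimes>\<^bsub>G\<^esub> h) x = Act X g (Act X h x)"
    by (rule composition_rule)
  show "g \<in> carrier G \<Longrightarrow> Act X g \<in> extensional (points X)"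
    using bij_prop0 Bij_imp_extensional by blast
qed (use assms in \<open>auto simp: based_gspace_def cgwh_def\<close>)

text \<open>Bijectivity is supplied by the inverse group element. Extensionality is part of the
  input because the bijections in \<open>BijGroup\<close> are extensional.\<close>

lemma group_actionI:
  assumes G: "group G" and e: "\<And>g. g \<in> carrier G \<Longrightarrow> \<phi> g \<in> extensional E"
    and c: "\<And>g x. g \<in> carrier G \<Longrightarrow> x \<in> E \<Longrightarrow> \<phi> g x \<in> E"
    and m: "\<And>g h x. g \<in> carrier G \<Longrightarrow> h \<in> carrier G \<Longrightarrow> x \<in> E \<Longrightarrow> \<phi> (g \<otimes>\<^bsub>G\<^esub> h) x = \<phi> g (\<phi> h x)"
    and o: "\<And>x. x \<in> E \<Longrightarrow> \<phi> \<one>\<^bsub>G\<^esub> x = x"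
  shows "group_action G E \<phi>"
proof -
  interpret group G by (rule G)
  have B: "\<phi> g \<in> Bij E" if g: "g \<in> carrier G" for g
  proof -
    have "\<phi> g (\<phi> (inv\<^bsub>G\<^esub> g) x) = x" "\<phi> (inv\<^bsub>G\<^esub> g) (\<phi> g x) = x" if "x \<in> E" for x
      using m[OF g inv_closed[OF g] that] m[OF inv_closed[OF g] g that] o[OF that] g by simp_all
    then have "bij_betw (\<phi> g) E E"
      using c g by (intro bij_betw_byWitness[where f' = "\<phi> (inv\<^bsub>G\<^esub> g)"]) auto
    then show ?thesis using e[OF g] by (simp add: Bij_def)
  qed
  have "\<phi> (g \<otimes>\<^bsub>G\<^esub> h) = compose E (\<phi> g) (\<phi> h)" if "g \<in> carrier G" "h \<in> carrier G" for g h
    by (rule extensionalityI[OF e compose_extensional]) (use that m in \<open>auto simp: compose_eq\<close>)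
  then have "\<phi> \<in> hom G (BijGroup E)"
    using B by (auto simp: hom_def BijGroup_def)
  then show ?thesis
    by (simp add: group_action_def group_hom_def group_hom_axioms_def G group_BijGroup)
qed

lemma gmaps_compose:
  assumes f: "f \<in> gmaps G X Y" and g: "g \<in> gmaps G Y Z" and X: "based_gspace G X"
  shows "compose (points X) g f \<in> gmaps G X Z"
  using based_maps_compose[OF gmapsD(1)[OF f] gmapsD(1)[OF g] based_gspaceD(3)[OF X]]
    gmapsD(2)[OF f] gmapsD(2)[OF g] based_mapsD(4)[OF gmapsD(1)[OF f]] based_gspaceD(8)[OF X]
  by (simp add: gmaps_def compose_def)

lemma gmaps_id: assumes "based_gspace G X" shows "(\<lambda>x\<in>points X. x) \<in> gmaps G X X"
  using based_maps_id[OF based_gspaceD(3)[OF assms]] based_gspaceD(8)[OF assms] by (simp add: gmaps_def)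

lemma gmaps_extensional: "f \<in> gmaps G X Y \<Longrightarrow> f \<in> extensional (points X)"
  using gmapsD(1) based_mapsD(1) by blast

lemma gmaps_funcset: "f \<in> gmaps G X Y \<Longrightarrow> f \<in> points X \<rightarrow> points Y"
  by (rule funcsetI) (rule based_mapsD(4)[OF gmapsD(1)])

lemma gmaps_compose_id:
  assumes "f \<in> gmaps G X Y"
  shows "compose (points X) f (\<lambda>x\<in>points X. x) = f" "compose (points X) (\<lambda>x\<in>points Y. x) f = f"
  using gmaps_extensional[OF assms] gmaps_funcset[OF assms] by (simp_all add: compose_Id Id_compose)

lemma points_smash [simp]:
  "points (smash X Y) = (\<lambda>(x, y). smash_pt X Y x y) ` (points X \<times> points Y)"
  by (simp add: smash_def)

lemma continuous_map_from_smash: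
  assumes "continuous_map (kprod (Sp X) (Sp Y)) Z (\<lambda>p. f (smash_pt X Y (fst p) (snd p)))"
  shows "continuous_map (Sp (smash X Y)) Z f"
proof -
  have "quotient_map (kprod (Sp X) (Sp Y)) (Sp (smash X Y)) (\<lambda>(x, y). smash_pt X Y x y)"
    unfolding smash_def by (simp add: quotient_map_quot_topology)
  moreover have "f \<circ> (\<lambda>(x, y). smash_pt X Y x y) = (\<lambda>p. f (smash_pt X Y (fst p) (snd p)))"
    by auto
  ultimately show ?thesis using assms by (metis continuous_compose_quotient_map)
qed

lemma continuous_map_into_smash:
  assumes "compact_Hausdorff K" "weak_Hausdorff (Sp X)" "weak_Hausdorff (Sp Y)"
    "continuous_map K (Sp X) a" "continuous_map K (Sp Y) b"
  shows "continuous_map K (Sp (smash X Y)) (\<lambda>z. smash_pt X Y (a z) (b z))"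
proof -
  have "continuous_map (kprod (Sp X) (Sp Y)) (Sp (smash X Y)) (\<lambda>(x, y). smash_pt X Y x y)"
    unfolding smash_def by (simp add: quotient_map_quot_topology quotient_imp_continuous_map)
  from continuous_map_kprod_comp[OF this assms(1,2,4,3,5)] show ?thesis by simp
qed

lemma weak_Hausdorff_sphere: "weak_Hausdorff (Sp (sphere_of (CC n)))"
  using compact_Hausdorff_sphere Hausdorff_imp_weak_Hausdorff compact_Hausdorff_def by blast


section \<open>The two categories\<close>

lemma rspectrum_mapsD:
  assumes "f \<in> rspectrum_maps X Y"
  shows "f k \<in> gmaps (C2U k) (Lev X k) (Lev Y k)"
    "x \<in> points (Lev X k) \<Longrightarrow> v \<in> points (sphere_of (CC 1)) \<Longrightarrow>
      f (Suc k) (Str X k (smash_pt (Lev X k) (sphere_of (CC 1)) x v)) =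
      Str Y k (smash_pt (Lev Y k) (sphere_of (CC 1)) (f k x) v)"
  using assms unfolding rspectrum_maps_def by blast+

lemma real_spectrumD:
  assumes "real_spectrum X"
  shows "based_gspace (C2U k) (Lev X k)"
    "Str X k \<in> based_maps (smash (Lev X k) (sphere_of (CC 1))) (Lev X (Suc k))"
    "\<lbrakk>A \<in> unitary k; B \<in> unitary m; x \<in> points (Lev X k); v \<in> points (sphere_of (CC m))\<rbrakk> \<Longrightarrow>
        iter_str X k m (smash_pt (Lev X k) (sphere_of (CC m)) (Act (Lev X k) (s, A) x) (sphere_act s B v)) =
        Act (Lev X (k + m)) (s, block_sum k m A B)
          (iter_str X k m (smash_pt (Lev X k) (sphere_of (CC m)) x v))"
  using assms unfolding real_spectrum_def by blast+

lemma Str_smash_in: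
  assumes "real_spectrum X" "x \<in> points (Lev X k)" "v \<in> points (sphere_of (CC 1))"
  shows "Str X k (smash_pt (Lev X k) (sphere_of (CC 1)) x v) \<in> points (Lev X (Suc k))"
  by (rule based_mapsD(4)[OF real_spectrumD(2)[OF assms(1)]])
    (simp only: points_smash, rule image_eqI[of _ _ "(x, v)"], use assms(2,3) in simp_all)

lemma is_category_Real_Spectra: "is_category (Real_Spectra :: ('a rspectrum, nat \<Rightarrow> 'a \<Rightarrow> 'a) cat)"
proof -
  note b = real_spectrumD(1)
  have id: "(\<lambda>k. \<lambda>x\<in>points (Lev X k). x) \<in> rspectrum_maps X X" if X: "real_spectrum X" for X :: "'a rspectrum"
    unfolding rspectrum_maps_def using gmaps_id[OF b[OF X]] Str_smash_in[OF X] by auto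
  have comp: "(\<lambda>k. compose (points (Lev X k)) (g k) (f k)) \<in> rspectrum_maps X Z"
    if X: "real_spectrum X" and f: "f \<in> rspectrum_maps X Y" and g: "g \<in> rspectrum_maps Y Z"
    for X Y Z :: "'a rspectrum" and f g
  proof -
    have "compose (points (Lev X (Suc k))) (g (Suc k)) (f (Suc k)) (Str X k (smash_pt (Lev X k) (sphere_of (CC 1)) x v)) =
        Str Z k (smash_pt (Lev Z k) (sphere_of (CC 1)) (compose (points (Lev X k)) (g k) (f k) x) v)"
      if x: "x \<in> points (Lev X k)" and v: "v \<in> points (sphere_of (CC 1))" for k x v
      using Str_smash_in[OF X x v] rspectrum_mapsD(2)[OF f x v]
        rspectrum_mapsD(2)[OF g based_mapsD(4)[OF gmapsD(1)[OF rspectrum_mapsD(1)[OF f]] x] v] x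
      by (simp add: compose_eq)
    then show ?thesis
      unfolding rspectrum_maps_def
      using gmaps_compose[OF rspectrum_mapsD(1)[OF f] rspectrum_mapsD(1)[OF g] b[OF X]] by blast
  qed
  have idl: "(\<lambda>k. compose (points (Lev X k)) (f k) (\<lambda>x\<in>points (Lev X k). x)) = f"
    and idr: "(\<lambda>k. compose (points (Lev X k)) (\<lambda>x\<in>points (Lev Y k). x) (f k)) = f"
    if f: "f \<in> rspectrum_maps X Y" for X Y :: "'a rspectrum" and f
    by (rule ext, rule gmaps_compose_id[OF rspectrum_mapsD(1)[OF f]])+
  have assoc: "(\<lambda>k. compose (points (Lev W k)) (compose (points (Lev X k)) (h k) (g k)) (f k)) =
      (\<lambda>k. compose (points (Lev W k)) (h k) (compose (points (Lev W k)) (g k) (f k)))"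
    if f: "f \<in> rspectrum_maps W X" for W X :: "'a rspectrum" and f g h :: "nat \<Rightarrow> 'a \<Rightarrow> 'a"
    by (rule ext, rule compose_assoc[OF gmaps_funcset[OF rspectrum_mapsD(1)[OF f]], symmetric])
  show ?thesis
    unfolding is_category_def Real_Spectra_def
    by (simp add: id comp idl idr assoc)
qed

section \<open>Enriched functors and their natural transformations\<close>

lemma enriched_functorD:
  assumes "enriched_functor F"
  shows "FOb F \<in> extensional J_obj"
    "U \<notin> J_obj \<or> V \<notin> J_obj \<Longrightarrow> FMor F U V = undefined"
    "U \<in> J_obj \<Longrightarrow> based_gspace C2 (FOb F U)"
    "U \<in> J_obj \<Longrightarrow> V \<in> J_obj \<Longrightarrow> FMor F U V \<in> gmaps C2 (J_mor U V) (map_space (FOb F U) (FOb F V))"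
    "U \<in> J_obj \<Longrightarrow> FMor F U U (J_id U) = (\<lambda>x\<in>points (FOb F U). x)"
    "\<lbrakk>U \<in> J_obj; V \<in> J_obj; W \<in> J_obj; \<psi> \<in> points (J_mor U V); \<phi> \<in> points (J_mor V W)\<rbrakk> \<Longrightarrow>
      FMor F U W (J_comp U \<phi> \<psi>) = compose (points (FOb F U)) (FMor F V W \<phi>) (FMor F U V \<psi>)"
  using assms unfolding enriched_functor_def by blast+

lemma enriched_natsD:
  assumes "\<alpha> \<in> enriched_nats F G"
  shows "\<alpha> \<in> extensional J_obj" "U \<in> J_obj \<Longrightarrow> \<alpha> U \<in> gmaps C2 (FOb F U) (FOb G U)"
    "\<lbrakk>U \<in> J_obj; V \<in> J_obj; \<phi> \<in> points (J_mor U V)\<rbrakk> \<Longrightarrow>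
        compose (points (FOb F U)) (\<alpha> V) (FMor F U V \<phi>) =
        compose (points (FOb F U)) (FMor G U V \<phi>) (\<alpha> U)"
  using assms unfolding enriched_nats_def by blast+

lemma points_map_space [simp]: "points (map_space X Y) = based_maps X Y"
  by (simp add: map_space_def)

lemma FMor_based_map:
  assumes "enriched_functor F" "U \<in> J_obj" "V \<in> J_obj" "\<phi> \<in> points (J_mor U V)"
  shows "FMor F U V \<phi> \<in> based_maps (FOb F U) (FOb F V)"
  using based_mapsD(4)[OF gmapsD(1)[OF enriched_functorD(4)[OF assms(1-3)]] assms(4)] by simp

lemma FMor_comp:
  assumes "enriched_functor F" "U \<in> J_obj" "V \<in> J_obj" "W \<in> J_obj"
    "\<psi> \<in> points (J_mor U V)" "\<phi> \<in> points (J_mor V W)" "x \<in> points (FOb F U)"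
  shows "FMor F U W (J_comp U \<phi> \<psi>) x = FMor F V W \<phi> (FMor F U V \<psi> x)"
  using enriched_functorD(6)[OF assms(1-6)] assms(7) by (simp add: compose_eq)

lemma FMor_id:
  assumes "enriched_functor F" "U \<in> J_obj" "x \<in> points (FOb F U)"
  shows "FMor F U U (J_id U) x = x"
  using enriched_functorD(5)[OF assms(1,2)] assms(3) by simp

lemma FMor_None:
  assumes "enriched_functor F" "U \<in> J_obj" "V \<in> J_obj" "x \<in> points (FOb F U)"
  shows "FMor F U V None x = Pt (FOb F V)"
  using based_mapsD(3)[OF gmapsD(1)[OF enriched_functorD(4)[OF assms(1-3)]]] assms(4)
  by (simp add: map_space_def)

lemma carrier_C2 [simp]: "carrier C2 = UNIV" and mult_C2 [simp]: "s \<otimes>\<^bsub>C2\<^esub> t = (s \<noteq> t)"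
  and one_C2 [simp]: "\<one>\<^bsub>C2\<^esub> = False" and gtop_C2 [simp]: "gtop C2 = discrete_topology UNIV"
  by (simp_all add: C2_def)

text \<open>Equivariance of \<open>FMor\<close> into the mapping space says that
  \<open>s \<phi>\<close> acts as \<open>s f s\<close>, where \<open>f\<close> is the value at
  \<phi>; at the point \<open>s x\<close> the inner \<open>s\<close> cancels.\<close>

lemma FMor_act:
  assumes F: "enriched_functor F" and U: "U \<in> J_obj" and V: "V \<in> J_obj"
    and p: "\<phi> \<in> points (J_mor U V)" and x: "x \<in> points (FOb F U)"
  shows "FMor F U V (J_act s U \<phi>) (Act (FOb F U) s x) = Act (FOb F V) s (FMor F U V \<phi> x)"
proof -
  note bU = based_gspaceD[OF enriched_functorD(3)[OF F U]]
  have sx: "Act (FOb F U) s x \<in> points (FOb F U)" using bU(8) x by simp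
  have eq: "FMor F U V (J_act s U \<phi>) = Act (map_space (FOb F U) (FOb F V)) s (FMor F U V \<phi>)"
    using gmapsD(2)[OF enriched_functorD(4)[OF F U V], of s \<phi>] p Act_J_mor[OF p] by simp
  have "FMor F U V (J_act s U \<phi>) (Act (FOb F U) s x) =
      Act (FOb F V) s (FMor F U V \<phi> (Act (FOb F U) s (Act (FOb F U) s x)))"
    unfolding eq using FMor_based_map[OF F U V p] sx by (simp add: map_space_def)
  also have "Act (FOb F U) s (Act (FOb F U) s x) = x"
    using bU(9)[of s s x] bU(10)[of x] x by simp
  finally show ?thesis .
qed

text \<open>Continuity into the mapping space is turned into joint continuity over a test space: the
  k-ified topology is finer than the compact-open one, so \<open>continuous_map_eval\<close>
  applies.\<close>

lemma continuous_map_FMor: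
  assumes F: "enriched_functor F" and U: "U \<in> J_obj" and V: "V \<in> J_obj" and K: "compact_Hausdorff K"
    and a: "continuous_map K (Sp (J_mor U V)) a" and b: "continuous_map K (Sp (FOb F U)) b"
  shows "continuous_map K (Sp (FOb F V)) (\<lambda>z. FMor F U V (a z) (b z))"
proof (rule continuous_map_eval[OF based_gspaceD(2)[OF enriched_functorD(3)[OF F U]] K _ b])
  have "continuous_map K (Sp (map_space (FOb F U) (FOb F V))) (\<lambda>z. FMor F U V (a z))"
    using continuous_map_compose[OF a based_mapsD(2)[OF gmapsD(1)[OF enriched_functorD(4)[OF F U V]]]]
    by (simp add: o_def)
  then show "continuous_map K (compact_open (FOb F U) (FOb F V)) (\<lambda>z. FMor F U V (a z))"
    using continuous_map_compose[OF _ continuous_map_kify_id] by (force simp: map_space_def o_def)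
qed

lemma is_category_C2_E1: "is_category (C2_E1 :: ('a efunctor, vec set \<Rightarrow> 'a \<Rightarrow> 'a) cat)"
proof -
  note b = enriched_functorD(3)
  note g = enriched_natsD(2)
  have id: "(\<lambda>U\<in>J_obj. \<lambda>x\<in>points (FOb F U). x) \<in> enriched_nats F F" if F: "enriched_functor F" for F :: "'a efunctor"
    unfolding enriched_nats_def
  proof (intro CollectI conjI ballI)
    fix U assume U: "U \<in> J_obj"
    show "(\<lambda>U\<in>J_obj. \<lambda>x\<in>points (FOb F U). x) U \<in> gmaps C2 (FOb F U) (FOb F U)"
      using gmaps_id[OF b[OF F U]] U by simp
    fix V \<phi> assume V: "V \<in> J_obj" and p: "\<phi> \<in> points (J_mor U V)"
    have "FMor F U V \<phi> \<in> points (FOb F U) \<rightarrow> points (FOb F V)" "FMor F U V \<phi> \<in> extensional (points (FOb F U))"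
      using based_mapsD[OF FMor_based_map[OF F U V p]] by auto
    then show "compose (points (FOb F U)) ((\<lambda>U\<in>J_obj. \<lambda>x\<in>points (FOb F U). x) V) (FMor F U V \<phi>) =
        compose (points (FOb F U)) (FMor F U V \<phi>) ((\<lambda>U\<in>J_obj. \<lambda>x\<in>points (FOb F U). x) U)"
      using U V by (simp add: compose_Id Id_compose)
  qed simp
  have comp: "(\<lambda>U\<in>J_obj. compose (points (FOb F U)) (\<beta> U) (\<alpha> U)) \<in> enriched_nats F H"
    if F: "enriched_functor F" "enriched_functor G"
      and \<alpha>: "\<alpha> \<in> enriched_nats F G" and \<beta>: "\<beta> \<in> enriched_nats G H"
    for F G H :: "'a efunctor" and \<alpha> \<beta>
    unfolding enriched_nats_def
  proof (intro CollectI conjI ballI)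
    fix U assume U: "U \<in> J_obj"
    show "(\<lambda>U\<in>J_obj. compose (points (FOb F U)) (\<beta> U) (\<alpha> U)) U \<in> gmaps C2 (FOb F U) (FOb H U)"
      using gmaps_compose[OF g[OF \<alpha> U] g[OF \<beta> U] b[OF F(1) U]] U by simp
    fix V \<phi> assume V: "V \<in> J_obj" and p: "\<phi> \<in> points (J_mor U V)"
    have \<alpha>U: "\<alpha> U \<in> points (FOb F U) \<rightarrow> points (FOb G U)" by (rule gmaps_funcset[OF g[OF \<alpha> U]])
    have fF: "FMor F U V \<phi> \<in> points (FOb F U) \<rightarrow> points (FOb F V)"
      and fG: "FMor G U V \<phi> \<in> points (FOb G U) \<rightarrow> points (FOb G V)"
      using based_mapsD(4)[OF FMor_based_map[OF _ U V p]] F by auto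
    have "compose (points (FOb F U)) (compose (points (FOb F V)) (\<beta> V) (\<alpha> V)) (FMor F U V \<phi>) =
        compose (points (FOb F U)) (\<beta> V) (compose (points (FOb F U)) (\<alpha> V) (FMor F U V \<phi>))"
      by (rule compose_assoc[OF fF, symmetric])
    also have "compose (points (FOb F U)) (\<alpha> V) (FMor F U V \<phi>) = compose (points (FOb F U)) (FMor G U V \<phi>) (\<alpha> U)"
      by (rule enriched_natsD(3)[OF \<alpha> U V p])
    also have "compose (points (FOb F U)) (\<beta> V) \<dots> =
        compose (points (FOb F U)) (compose (points (FOb G U)) (\<beta> V) (FMor G U V \<phi>)) (\<alpha> U)"
      by (rule compose_assoc[OF \<alpha>U])
    also have "compose (points (FOb G U)) (\<beta> V) (FMor G U V \<phi>) = compose (points (FOb G U)) (FMor H U V \<phi>) (\<beta> U)"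
      by (rule enriched_natsD(3)[OF \<beta> U V p])
    also have "compose (points (FOb F U)) \<dots> (\<alpha> U) =
        compose (points (FOb F U)) (FMor H U V \<phi>) (compose (points (FOb F U)) (\<beta> U) (\<alpha> U))"
      by (rule compose_assoc[OF \<alpha>U, symmetric])
    finally show "compose (points (FOb F U)) ((\<lambda>U\<in>J_obj. compose (points (FOb F U)) (\<beta> U) (\<alpha> U)) V) (FMor F U V \<phi>) =
        compose (points (FOb F U)) (FMor H U V \<phi>) ((\<lambda>U\<in>J_obj. compose (points (FOb F U)) (\<beta> U) (\<alpha> U)) U)"
      using U V by simp
  qed simp
  have idl: "(\<lambda>U\<in>J_obj. compose (points (FOb F U)) (\<alpha> U) ((\<lambda>U\<in>J_obj. \<lambda>x\<in>points (FOb F U). x) U)) = \<alpha>"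
    and idr: "(\<lambda>U\<in>J_obj. compose (points (FOb F U)) ((\<lambda>U\<in>J_obj. \<lambda>x\<in>points (FOb G U). x) U) (\<alpha> U)) = \<alpha>"
    if \<alpha>: "\<alpha> \<in> enriched_nats F G" for F G :: "'a efunctor" and \<alpha>
    using enriched_natsD(1)[OF \<alpha>]
    by (auto intro!: extensionalityI[of _ J_obj] simp: gmaps_compose_id[OF g[OF \<alpha>]])
  have assoc: "(\<lambda>U\<in>J_obj. compose (points (FOb E U)) ((\<lambda>U\<in>J_obj. compose (points (FOb F U)) (\<gamma> U) (\<beta> U)) U) (\<alpha> U)) =
      (\<lambda>U\<in>J_obj. compose (points (FOb E U)) (\<gamma> U) ((\<lambda>U\<in>J_obj. compose (points (FOb E U)) (\<beta> U) (\<alpha> U)) U))"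
    if \<alpha>: "\<alpha> \<in> enriched_nats E F" for E F :: "'a efunctor" and \<alpha> \<beta> \<gamma> :: "vec set \<Rightarrow> 'a \<Rightarrow> 'a"
    by (rule restrict_ext) (simp add: compose_assoc[OF gmaps_funcset[OF g[OF \<alpha>]], symmetric])
  show ?thesis
    unfolding is_category_def C2_E1_def
    using id comp idl idr assoc by (simp cong: restrict_cong)
qed

section \<open>From enriched functors to Real spectra\<close>

text \<open>The restrictions provide the extensionality that \<open>based_gspace\<close> and
  \<open>based_maps\<close> ask of actions and structure maps.\<close>

definition spectrum_of :: "'a efunctor \<Rightarrow> 'a rspectrum" where
  "spectrum_of E = \<lparr>
     Lev = (\<lambda>k. \<lparr>Sp = Sp (FOb E (CC k)), Pt = Pt (FOb E (CC k)),
       Act = (\<lambda>p\<in>carrier (C2U k). \<lambda>x\<in>points (FOb E (CC k)).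
         FMor E (CC k) (CC k) (Some (snd p, 0)) (Act (FOb E (CC k)) (fst p) x))\<rparr>),
     Str = (\<lambda>k. \<lambda>z\<in>points (smash (FOb E (CC k)) (sphere_of (CC 1))).
       case z of Some (x, Some v) \<Rightarrow> FMor E (CC k) (CC (Suc k)) (Some (\<lambda>u\<in>CC k. u, shift k v)) x
       | _ \<Rightarrow> Pt (FOb E (CC (Suc k))))\<rparr>"

lemma spectrum_of_simps [simp]:
  "Sp (Lev (spectrum_of E) k) = Sp (FOb E (CC k))" "Pt (Lev (spectrum_of E) k) = Pt (FOb E (CC k))"
  by (simp_all add: spectrum_of_def)

lemma smash_spectrum_of [simp]:
  "smash (Lev (spectrum_of E) k) Y = smash (FOb E (CC k)) Y"
  "smash_pt (Lev (spectrum_of E) k) Y = smash_pt (FOb E (CC k)) Y"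
  by (simp_all add: smash_def smash_pt_def fun_eq_iff)

lemma based_maps_spectrum_of [simp]:
  "based_maps X (Lev (spectrum_of E) k) = based_maps X (FOb E (CC k))"
  "based_maps (Lev (spectrum_of E) k) Y = based_maps (FOb E (CC k)) Y"
  by (simp_all add: based_maps_def)

lemma Act_spectrum_of:
  assumes "A \<in> unitary k" "x \<in> points (FOb E (CC k))"
  shows "Act (Lev (spectrum_of E) k) (s, A) x = FMor E (CC k) (CC k) (Some (A, 0)) (Act (FOb E (CC k)) s x)"
  using assms by (simp add: spectrum_of_def C2U_def)

lemma carrier_C2U: "p \<in> carrier (C2U k) \<longleftrightarrow> snd p \<in> unitary k"
  by (cases p) (simp add: C2U_def)

lemma J_unitary_in: "A \<in> unitary k \<Longrightarrow> Some (A, 0) \<in> points (J_mor (CC k) (CC k))"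
  by (auto simp: J_bundle_def unitary_def)

text \<open>This morphism is represented by the identity of C^(k+m) together with
  \<open>v\<close>.\<close>

lemma J_incl_in:
  assumes "v \<in> CC m" shows "Some (\<lambda>u\<in>CC k. u, shift k v) \<in> points (J_mor (CC k) (CC (k + m)))"
proof -
  have "(\<lambda>u\<in>CC k. (\<lambda>u\<in>CC (k + m). u) u, (\<lambda>u\<in>CC (k + m). u) (shift k v)) \<in> J_bundle (CC k) (CC (k + m))"
    by (rule unitary_rep_J_bundle[OF unitary_id assms])
  moreover have "(\<lambda>u\<in>CC k. (\<lambda>u\<in>CC (k + m). u) u) = (\<lambda>u\<in>CC k. u)"
    using CC_mono[of k "k + m"] by (intro restrict_ext) auto
  ultimately show ?thesis using shift_in_CC[OF assms, of k] by simp
qed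

lemma iter_str_None: "iter_str X k m None = Pt (Lev X (k + m))"
  by (cases m) auto

lemma vtake_vdrop_split:
  "shift (k + m) (vdrop m v) + shift k (vtake m v) = shift k v"
proof
  fix i
  show "(shift (k + m) (vdrop m v) + shift k (vtake m v)) i = shift k v i"
    by (cases "i < k") (auto simp: shift_def vdrop_def vtake_def)
qed

context
  fixes E :: "'a efunctor" assumes E: "enriched_functor E"
begin

lemma Act_FOb:
  assumes "U \<in> J_obj" "x \<in> points (FOb E U)"
  shows "Act (FOb E U) s x \<in> points (FOb E U)" "Act (FOb E U) s (Act (FOb E U) t x) = Act (FOb E U) (s \<noteq> t) x"
    "Act (FOb E U) False x = x"
  using based_gspaceD(8,9,10)[OF enriched_functorD(3)[OF E assms(1)]] assms(2) by simp_all

lemma FMor_in: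
  "U \<in> J_obj \<Longrightarrow> V \<in> J_obj \<Longrightarrow> \<phi> \<in> points (J_mor U V) \<Longrightarrow> x \<in> points (FOb E U) \<Longrightarrow> FMor E U V \<phi> x \<in> points (FOb E V)"
  by (rule based_mapsD(4)[OF FMor_based_map[OF E]])

lemma FMor_Pt:
  "U \<in> J_obj \<Longrightarrow> V \<in> J_obj \<Longrightarrow> \<phi> \<in> points (J_mor U V) \<Longrightarrow> FMor E U V \<phi> (Pt (FOb E U)) = Pt (FOb E V)"
  by (rule based_mapsD(3)[OF FMor_based_map[OF E]])

lemma based_gspace_spectrum_of: "based_gspace (C2U k) (Lev (spectrum_of E) k)"
proof -
  note kJ = CC_in_J_obj[of k]
  let ?X = "FOb E (CC k)" and ?L = "Lev (spectrum_of E) k"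
  note b = based_gspaceD[OF enriched_functorD(3)[OF E kJ]]
  have closed: "Act ?L p x \<in> points ?X" if "p \<in> carrier (C2U k)" "x \<in> points ?X" for p x
    using that Act_spectrum_of[of "snd p" k x E "fst p"] FMor_in[OF kJ kJ J_unitary_in] Act_FOb(1)[OF kJ]
    by (simp add: carrier_C2U)
  have "group_action (C2U k) (points ?L) (Act ?L)"
  proof (rule group_actionI[OF group_C2U])
    fix p assume "p \<in> carrier (C2U k)"
    then show "Act ?L p \<in> extensional (points ?L)"
      by (simp add: spectrum_of_def)
  next
    fix p x assume "p \<in> carrier (C2U k)" "x \<in> points ?L"
    then show "Act ?L p x \<in> points ?L" using closed by simp
  next
    fix p q x assume p: "p \<in> carrier (C2U k)" and q: "q \<in> carrier (C2U k)" and "x \<in> points ?L"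
    then have x: "x \<in> points ?X" by simp
    obtain s A t B where pq: "p = (s, A)" "q = (t, B)" by (metis surj_pair)
    have A: "A \<in> unitary k" and B: "B \<in> unitary k" using p q by (simp_all add: pq carrier_C2U)
    note B' = mconj_unitary[OF B, of s]
    note mB = J_unitary_in[OF B]
    have tx: "Act ?X t x \<in> points ?X" using Act_FOb(1)[OF kJ x] .
    have "Act ?L p (Act ?L q x) = FMor E (CC k) (CC k) (Some (A, 0)) (Act ?X s (FMor E (CC k) (CC k) (Some (B, 0)) (Act ?X t x)))"
      using Act_spectrum_of[OF A] Act_spectrum_of[OF B x] FMor_in[OF kJ kJ mB tx] by (simp add: pq)
    \<comment> \<open>Moving \<open>s\<close> past \<open>B\<close> replaces \<open>B\<close> by its
      conjugate, which is the twist in the multiplication of \<open>C2U\<close>.\<close>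
    also have "Act ?X s (FMor E (CC k) (CC k) (Some (B, 0)) (Act ?X t x)) =
        FMor E (CC k) (CC k) (J_act s (CC k) (Some (B, 0))) (Act ?X s (Act ?X t x))"
      by (rule FMor_act[OF E kJ kJ mB tx, symmetric])
    also have "J_act s (CC k) (Some (B, 0)) = Some (mconj s (CC k) B, 0)" by (simp add: J_act_def)
    also have "FMor E (CC k) (CC k) (Some (A, 0)) (FMor E (CC k) (CC k) (Some (mconj s (CC k) B, 0)) (Act ?X s (Act ?X t x))) =
        FMor E (CC k) (CC k) (J_comp (CC k) (Some (A, 0)) (Some (mconj s (CC k) B, 0))) (Act ?X s (Act ?X t x))"
      by (rule FMor_comp[OF E kJ kJ kJ J_unitary_in[OF B'] J_unitary_in[OF A] Act_FOb(1)[OF kJ tx], symmetric])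
    also have "\<dots> = FMor E (CC k) (CC k) (Some (compose (CC k) A (mconj s (CC k) B), 0)) (Act ?X (s \<noteq> t) x)"
      using unitaryD(6)[OF A] Act_FOb(2)[OF kJ x] by simp
    also have "\<dots> = Act ?L (p \<otimes>\<^bsub>C2U k\<^esub> q) x"
      using Act_spectrum_of[OF unitary_compose[OF A B'] x] by (simp add: pq C2U_def)
    finally show "Act ?L (p \<otimes>\<^bsub>C2U k\<^esub> q) x = Act ?L p (Act ?L q x)" by simp
  next
    fix x assume "x \<in> points ?L"
    then have x: "x \<in> points ?X" by simp
    have "Act ?L \<one>\<^bsub>C2U k\<^esub> x = FMor E (CC k) (CC k) (J_id (CC k)) x"
      using Act_spectrum_of[OF unitary_id x] Act_FOb(3)[OF kJ x] by (simp add: C2U_def J_id_def)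
    then show "Act ?L \<one>\<^bsub>C2U k\<^esub> x = x" using FMor_id[OF E kJ x] by simp
  qed
  moreover have "continuous_map (kprod (gtop (C2U k)) (Sp ?L)) (Sp ?L) (\<lambda>(p, x). Act ?L p x)"
    unfolding spectrum_of_simps
  proof (rule continuous_map_from_kprod)
    fix K :: "((bool \<times> (vec \<Rightarrow> vec)) \<times> 'a) set set topology" and p b
    assume K: "compact_Hausdorff K" and p: "continuous_map K (gtop (C2U k)) p" and bc: "continuous_map K (Sp ?X) b"
    have p1: "continuous_map K (gtop C2) (\<lambda>z. fst (p z))"
      and p2: "continuous_map K (top_of_set (unitary (k + 0))) (\<lambda>z. snd (p z))"
      using p by (simp_all add: C2U_def continuous_map_pairwise o_def)
    have pc: "p z \<in> carrier (C2U k)" "b z \<in> points ?X" if "z \<in> topspace K" for z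
      using that p bc p2 by (auto simp: carrier_C2U continuous_map_def)
    have "weak_Hausdorff (gtop C2)" by (simp add: Hausdorff_imp_weak_Hausdorff Hausdorff_space_discrete_topology)
    from continuous_map_kprod_comp[OF b(6) K this p1 b(2) bc]
    have sx: "continuous_map K (Sp ?X) (\<lambda>z. Act ?X (fst (p z)) (b z))" by simp
    \<comment> \<open>The morphism \<open>(A, 0)\<close> is the value of \<open>thom_map\<close> at
      the non-base point of S^0; hence \<open>m = 0\<close> and the \<open>k + 0\<close>
      above.\<close>
    have "continuous_map K (Sp (sphere_of (CC 0))) (\<lambda>z. Some 0)" by simp
    then have "continuous_map K (prod_topology (top_of_set (unitary (k + 0))) (Sp (sphere_of (CC 0))))
        (\<lambda>z. (snd (p z), Some 0))"
      using p2 by (intro continuous_map_pairedI)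
    from continuous_map_compose[OF this continuous_map_thom_map]
    have "continuous_map K (Sp (J_mor (CC k) (CC (k + 0)))) (\<lambda>z. thom_map k (snd (p z), Some 0))"
      by (simp add: o_def)
    then have "continuous_map K (Sp (J_mor (CC k) (CC k))) (\<lambda>z. thom_map k (snd (p z), Some 0))"
      by (simp only: add_0_right)
    from continuous_map_FMor[OF E kJ kJ K this sx]
    have c: "continuous_map K (Sp ?X) (\<lambda>z. FMor E (CC k) (CC k) (thom_map k (snd (p z), Some 0)) (Act ?X (fst (p z)) (b z)))" .
    have eq: "FMor E (CC k) (CC k) (thom_map k (snd (p z), Some 0)) (Act ?X (fst (p z)) (b z)) = Act ?L (p z) (b z)"
      if z: "z \<in> topspace K" for z
    proof -
      have A: "snd (p z) \<in> unitary k" using pc(1)[OF z] by (simp add: carrier_C2U)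
      have "(\<lambda>u\<in>CC k. snd (p z) u) = snd (p z)"
        using unitaryD(2)[OF A] by (intro extensionalityI[of _ "CC k"]) auto
      then have "thom_map k (snd (p z), Some 0) = Some (snd (p z), 0)"
        using unitaryD(6)[OF A] by simp
      then show ?thesis using Act_spectrum_of[OF A pc(2)[OF z], of "fst (p z)"] by simp
    qed
    show "continuous_map K (Sp ?X) (\<lambda>z. case (p z, b z) of (p, x) \<Rightarrow> Act ?L p x)"
      by (rule continuous_map_eq[OF c]) (simp only: split_conv eq)
  next
    fix p x assume "p \<in> topspace (gtop (C2U k))" "x \<in> topspace (Sp ?X)"
    then show "(case (p, x) of (p, x) \<Rightarrow> Act ?L p x) \<in> topspace (Sp ?X)"
      using closed by (simp add: carrier_C2U C2U_def mem_Times_iff)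
  qed
  moreover have "Act ?L p (Pt ?L) = Pt ?L" if "p \<in> carrier (C2U k)" for p
    using that Act_spectrum_of[of "snd p" k "Pt ?X" E "fst p"] b(3,7) FMor_Pt[OF kJ kJ J_unitary_in]
    by (simp add: carrier_C2U)
  moreover have "Act ?L \<in> extensional (carrier (C2U k))" by (simp add: spectrum_of_def)
  ultimately show ?thesis
    unfolding based_gspace_def using b(1,3) by simp
qed

lemma Str_spectrum_of:
  assumes x: "x \<in> points (FOb E (CC k))" and v: "v \<in> CC 1"
  shows "Str (spectrum_of E) k (smash_pt (FOb E (CC k)) (sphere_of (CC 1)) x (Some v)) =
      FMor E (CC k) (CC (Suc k)) (Some (\<lambda>u\<in>CC k. u, shift k v)) x"
    "Str (spectrum_of E) k None = Pt (FOb E (CC (Suc k)))"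
proof -
  let ?q = "smash_pt (FOb E (CC k)) (sphere_of (CC 1))"
  have "?q x (Some v) \<in> points (smash (FOb E (CC k)) (sphere_of (CC 1)))"
    unfolding points_smash by (rule image_eqI[of _ _ "(x, Some v)"]) (use x v in auto)
  \<comment> \<open>At the base point \<open>smash_pt\<close> collapses to \<open>None\<close>, and
    the formula for the structure map persists because the values of \<open>FMor\<close> are based
    maps.\<close>
  moreover have "Pt (FOb E (CC (Suc k))) = FMor E (CC k) (CC (Suc k)) (Some (\<lambda>u\<in>CC k. u, shift k v)) x"
    if "x = Pt (FOb E (CC k))"
    using FMor_Pt[OF CC_in_J_obj CC_in_J_obj J_incl_in[OF v, of k]] that by simp
  ultimately show "Str (spectrum_of E) k (?q x (Some v)) =
      FMor E (CC k) (CC (Suc k)) (Some (\<lambda>u\<in>CC k. u, shift k v)) x"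
    by (auto simp: spectrum_of_def smash_pt_def)
  have "?q x None \<in> points (smash (FOb E (CC k)) (sphere_of (CC 1)))"
    unfolding points_smash by (rule image_eqI[of _ _ "(x, None)"]) (use x in auto)
  then show "Str (spectrum_of E) k None = Pt (FOb E (CC (Suc k)))"
    by (simp add: spectrum_of_def smash_pt_def)
qed

lemma Str_None_spectrum_of: "Str (spectrum_of E) k None = Pt (FOb E (CC (Suc k)))"
  using Str_spectrum_of(2)[OF based_gspaceD(3)[OF enriched_functorD(3)[OF E CC_in_J_obj]] zero_in_CC] .

lemma Str_based_spectrum_of:
  "Str (spectrum_of E) k \<in> based_maps (smash (FOb E (CC k)) (sphere_of (CC 1))) (FOb E (CC (Suc k)))"
proof -
  note kJ = CC_in_J_obj[of k] and kJ' = CC_in_J_obj[of "Suc k"]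
  let ?X = "FOb E (CC k)" and ?S = "sphere_of (CC 1)"
  have "continuous_map (kprod (Sp ?X) (Sp ?S)) (Sp (FOb E (CC (Suc k))))
      (\<lambda>p. Str (spectrum_of E) k (smash_pt ?X ?S (fst p) (snd p)))"
  proof (rule continuous_map_from_kprod)
    \<comment> \<open>The inclusion with vector part \<open>v\<close> is \<open>thom_map\<close> at
      the identity of C^(k+1), which supplies continuity in \<open>v\<close>, also at
      infinity.\<close>
    let ?f = "\<lambda>x v. FMor E (CC k) (CC (Suc k)) (thom_map k (\<lambda>u\<in>CC (Suc k). u, v)) x"
    have eq: "Str (spectrum_of E) k (smash_pt ?X ?S x v) = ?f x v"
      if x: "x \<in> points ?X" and v: "v \<in> points ?S" for x v
    proof (cases v)
      case None
      then show ?thesis using Str_None_spectrum_of FMor_None[OF E kJ kJ' x] by (simp add: smash_pt_def)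
    next
      case (Some w)
      then have w: "w \<in> CC 1" using v by auto
      have "(\<lambda>u\<in>CC k. (\<lambda>u\<in>CC (Suc k). u) u) = (\<lambda>u\<in>CC k. u)"
        using CC_mono[of k "Suc k"] by (intro restrict_ext) auto
      then show ?thesis using Str_spectrum_of(1)[OF x w] shift_in_CC[OF w, of k] by (simp add: Some)
    qed
    show "Str (spectrum_of E) k (smash_pt ?X ?S (fst (x, v)) (snd (x, v))) \<in> topspace (Sp (FOb E (CC (Suc k))))"
      if "x \<in> topspace (Sp ?X)" "v \<in> topspace (Sp ?S)" for x v
    proof -
      have "thom_map k (\<lambda>u\<in>CC (Suc k). u, v) \<in> points (J_mor (CC k) (CC (k + 1)))"
        unfolding thom_map_surj[symmetric] using that(2) unitary_id[of "Suc k"] by (intro imageI) simp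
      then show ?thesis using FMor_in[OF kJ kJ' _ that(1)] eq[OF that] by simp
    qed
    fix K :: "('a \<times> vec option) set set topology" and a b
    assume K: "compact_Hausdorff K" and a: "continuous_map K (Sp ?X) a" and b: "continuous_map K (Sp ?S) b"
    have "continuous_map K (prod_topology (top_of_set (unitary (k + 1))) (Sp ?S)) (\<lambda>z. (\<lambda>u\<in>CC (k + 1). u, b z))"
      using b unitary_id[of "k + 1"] by (intro continuous_map_pairedI) auto
    from continuous_map_compose[OF this continuous_map_thom_map]
    have "continuous_map K (Sp (J_mor (CC k) (CC (Suc k)))) (\<lambda>z. thom_map k (\<lambda>u\<in>CC (Suc k). u, b z))"
      by (simp add: o_def)
    from continuous_map_FMor[OF E kJ kJ' K this a]
    have c: "continuous_map K (Sp (FOb E (CC (Suc k)))) (\<lambda>z. ?f (a z) (b z))" .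
    have "a z \<in> points ?X" "b z \<in> points ?S" if "z \<in> topspace K" for z
      using that a b unfolding continuous_map_def by blast+
    then show "continuous_map K (Sp (FOb E (CC (Suc k))))
        (\<lambda>z. Str (spectrum_of E) k (smash_pt ?X ?S (fst (a z, b z)) (snd (a z, b z))))"
      by (intro continuous_map_eq[OF c]) (simp only: eq fst_conv snd_conv)
  qed
  then have "continuous_map (Sp (smash ?X ?S)) (Sp (FOb E (CC (Suc k)))) (Str (spectrum_of E) k)"
    by (rule continuous_map_from_smash)
  moreover have "Str (spectrum_of E) k \<in> extensional (points (smash ?X ?S))"
    by (simp add: spectrum_of_def)
  ultimately show ?thesis
    using Str_None_spectrum_of by (simp add: based_maps_def smash_def)
qed

text \<open>Each application of the structure map composes with one more inclusion; the vectors of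
  the composite add up to \<open>shift k v\<close> by \<open>vtake_vdrop_split\<close>.\<close>

lemma iter_str_spectrum_of:
  assumes x: "x \<in> points (FOb E (CC k))" and v: "v \<in> CC m"
  shows "iter_str (spectrum_of E) k m (Some (x, Some v)) =
    FMor E (CC k) (CC (k + m)) (Some (\<lambda>u\<in>CC k. u, shift k v)) x"
  using v
proof (induction m arbitrary: v)
  case 0
  then have "v = 0" by (simp add: CC_0)
  then show "iter_str (spectrum_of E) k 0 (Some (x, Some v)) =
    FMor E (CC k) (CC (k + 0)) (Some (\<lambda>u\<in>CC k. u, shift k v)) x"
    using FMor_id[OF E CC_in_J_obj x] by (simp add: J_id_def)
next
  case (Suc m)
  note J = CC_in_J_obj
  have d: "vdrop m v \<in> CC 1" using vdrop_in_CC[of v m 1] Suc.prems by simp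
  note i1 = J_incl_in[OF vtake_in_CC[of m v], of k] and i2 = J_incl_in[OF d, of "k + m"]
  let ?y = "FMor E (CC k) (CC (k + m)) (Some (\<lambda>u\<in>CC k. u, shift k (vtake m v))) x"
  have y: "?y \<in> points (FOb E (CC (k + m)))" by (rule FMor_in[OF J J i1 x])
  have IH: "iter_str (spectrum_of E) k m (Some (x, Some (vtake m v))) = ?y"
    by (rule Suc.IH[OF vtake_in_CC])
  have "iter_str (spectrum_of E) k (Suc m) (Some (x, Some v)) =
      FMor E (CC (k + m)) (CC (Suc (k + m))) (Some (\<lambda>u\<in>CC (k + m). u, shift (k + m) (vdrop m v))) ?y"
    using Str_spectrum_of(1)[OF y d] IH by simp
  also have "\<dots> = FMor E (CC k) (CC (Suc (k + m)))
      (J_comp (CC k) (Some (\<lambda>u\<in>CC (k + m). u, shift (k + m) (vdrop m v))) (Some (\<lambda>u\<in>CC k. u, shift k (vtake m v)))) x"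
    using FMor_comp[OF E J J J i1 i2 x] by simp
  also have "J_comp (CC k) (Some (\<lambda>u\<in>CC (k + m). u, shift (k + m) (vdrop m v))) (Some (\<lambda>u\<in>CC k. u, shift k (vtake m v))) =
      Some (\<lambda>u\<in>CC k. u, shift k v)"
  proof -
    have "compose (CC k) (\<lambda>u\<in>CC (k + m). u) (\<lambda>u\<in>CC k. u) = (\<lambda>u\<in>CC k. u)"
      unfolding compose_def using CC_mono[of k "k + m"] by (intro restrict_ext) auto
    then show ?thesis using shift_in_CC[OF vtake_in_CC[of m v], of k] vtake_vdrop_split[of k m v] by simp
  qed
  finally show "iter_str (spectrum_of E) k (Suc m) (Some (x, Some v)) =
    FMor E (CC k) (CC (k + Suc m)) (Some (\<lambda>u\<in>CC k. u, shift k v)) x" by simp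
qed

lemma iter_smash_spectrum_of:
  assumes x: "x \<in> points (FOb E (CC k))" and v: "v \<in> CC m"
  shows "iter_str (spectrum_of E) k m (smash_pt (FOb E (CC k)) (sphere_of (CC m)) x (Some v)) =
    FMor E (CC k) (CC (k + m)) (Some (\<lambda>u\<in>CC k. u, shift k v)) x"
  using iter_str_spectrum_of[OF assms] FMor_Pt[OF CC_in_J_obj CC_in_J_obj J_incl_in[OF v, of k]]
    iter_str_None[of "spectrum_of E" k m]
  by (cases "x = Pt (FOb E (CC k))") (simp_all add: smash_pt_def)

lemma real_spectrum_spectrum_of: "real_spectrum (spectrum_of E)"
  unfolding real_spectrum_def smash_spectrum_of based_maps_spectrum_of spectrum_of_simps
proof (intro conjI allI ballI)
  fix k
  show "based_gspace (C2U k) (Lev (spectrum_of E) k)" by (rule based_gspace_spectrum_of)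
  show "Str (spectrum_of E) k \<in> based_maps (smash (FOb E (CC k)) (sphere_of (CC 1))) (FOb E (CC (Suc k)))"
    by (rule Str_based_spectrum_of)
  fix m s A B x v
  assume A: "A \<in> unitary k" and B: "B \<in> unitary m" and x: "x \<in> points (FOb E (CC k))"
    and v: "v \<in> points (sphere_of (CC m))"
  let ?X = "FOb E (CC k)" and ?Y = "FOb E (CC (k + m))"
  let ?L = "Lev (spectrum_of E)" and ?S = "sphere_of (CC m)"
  note J = CC_in_J_obj
  note AB = block_sum_unitary[OF A B]
  have sx: "Act ?X s x \<in> points ?X" by (rule Act_FOb(1)[OF J x])
  show "iter_str (spectrum_of E) k m (smash_pt ?X ?S (Act (?L k) (s, A) x) (sphere_act s B v)) =
      Act (?L (k + m)) (s, block_sum k m A B) (iter_str (spectrum_of E) k m (smash_pt ?X ?S x v))"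
  proof (cases v)
    case None
    then have "smash_pt ?X ?S y (sphere_act s B v) = None" "smash_pt ?X ?S x v = None" for y
      by (simp_all add: smash_pt_def sphere_act_def)
    moreover have "Act (?L (k + m)) (s, block_sum k m A B) (Pt (?L (k + m))) = Pt (?L (k + m))"
      by (rule based_gspaceD(7)[OF based_gspace_spectrum_of]) (simp add: carrier_C2U AB)
    ultimately show ?thesis using iter_str_None[of "spectrum_of E" k m] by simp
  next
    case (Some w)
    then have w: "w \<in> CC m" using v by auto
    have Bw: "B (vconj s w) \<in> CC m" using unitaryD(1)[OF B] w by simp
    note iA = J_unitary_in[OF A] and iAB = J_unitary_in[OF AB]
    note iw = J_incl_in[OF w, of k] and isw = J_incl_in[OF vconj_in_CC[OF w], of k s] and iBw = J_incl_in[OF Bw, of k]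
    have "iter_str (spectrum_of E) k m (smash_pt ?X ?S (Act (?L k) (s, A) x) (sphere_act s B v)) =
        FMor E (CC k) (CC (k + m)) (Some (\<lambda>u\<in>CC k. u, shift k (B (vconj s w))))
          (FMor E (CC k) (CC k) (Some (A, 0)) (Act ?X s x))"
      using iter_smash_spectrum_of[OF FMor_in[OF J J iA sx] Bw] Act_spectrum_of[OF A x, of s]
      by (simp add: Some sphere_act_def)
    also have "\<dots> = FMor E (CC k) (CC (k + m))
        (J_comp (CC k) (Some (\<lambda>u\<in>CC k. u, shift k (B (vconj s w)))) (Some (A, 0))) (Act ?X s x)"
      by (rule FMor_comp[OF E J J J iA iBw sx, symmetric])
    \<comment> \<open>The identity in J behind equivariance: \<open>A\<close> followed by the
      inclusion with vector \<open>B (s w)\<close> equals the inclusion with vector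
      \<open>s w\<close> followed by \<open>A \<oplus> B\<close>.\<close>
    also have "J_comp (CC k) (Some (\<lambda>u\<in>CC k. u, shift k (B (vconj s w)))) (Some (A, 0)) =
        J_comp (CC k) (Some (block_sum k m A B, 0)) (Some (\<lambda>u\<in>CC k. u, shift k (vconj s w)))"
    proof -
      have "compose (CC k) (\<lambda>u\<in>CC k. u) A = compose (CC k) (block_sum k m A B) (\<lambda>u\<in>CC k. u)"
        unfolding compose_def using block_sum_CC[OF A B] unitaryD(1)[OF A] by (intro restrict_ext) auto
      then show ?thesis using block_sum_shift[OF A vconj_in_CC[OF w]] by simp
    qed
    also have "FMor E (CC k) (CC (k + m)) \<dots> (Act ?X s x) =
        FMor E (CC (k + m)) (CC (k + m)) (Some (block_sum k m A B, 0))
          (FMor E (CC k) (CC (k + m)) (Some (\<lambda>u\<in>CC k. u, shift k (vconj s w))) (Act ?X s x))"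
      by (rule FMor_comp[OF E J J J isw iAB sx])
    \<comment> \<open>The inclusion is real, so conjugation affects the vector only.\<close>
    also have "Some (\<lambda>u\<in>CC k. u, shift k (vconj s w)) = J_act s (CC k) (Some (\<lambda>u\<in>CC k. u, shift k w))"
      by (simp add: J_act_def mconj_id vconj_shift)
    also have "FMor E (CC k) (CC (k + m)) \<dots> (Act ?X s x) =
        Act ?Y s (FMor E (CC k) (CC (k + m)) (Some (\<lambda>u\<in>CC k. u, shift k w)) x)"
      by (rule FMor_act[OF E J J iw x])
    also have "FMor E (CC k) (CC (k + m)) (Some (\<lambda>u\<in>CC k. u, shift k w)) x =
        iter_str (spectrum_of E) k m (smash_pt ?X ?S x v)"
      unfolding Some by (rule iter_smash_spectrum_of[OF x w, symmetric])
    also have "FMor E (CC (k + m)) (CC (k + m)) (Some (block_sum k m A B, 0)) (Act ?Y s \<dots>) =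
        Act (?L (k + m)) (s, block_sum k m A B) \<dots>"
      by (rule Act_spectrum_of[OF AB, symmetric])
        (use iter_smash_spectrum_of[OF x w] FMor_in[OF J J iw x] in \<open>simp add: Some\<close>)
    finally show ?thesis .
  qed
qed

end

text \<open>Actions and structure maps of both spectra are built from values of the functors at
  morphisms of J and from the C_2-action, and \<alpha> commutes with both ingredients.\<close>

lemma rspectrum_maps_of_nat:
  assumes E: "enriched_functor E" and E': "enriched_functor E'" and \<alpha>: "\<alpha> \<in> enriched_nats E E'"
  shows "(\<lambda>k. \<alpha> (CC k)) \<in> rspectrum_maps (spectrum_of E) (spectrum_of E')"
  unfolding rspectrum_maps_def
proof (intro CollectI conjI allI ballI)
  fix k
  note J = CC_in_J_obj
  note ak = enriched_natsD(2)[OF \<alpha> J]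
  have nat: "\<alpha> (CC l) (FMor E (CC j) (CC l) \<phi> x) = FMor E' (CC j) (CC l) \<phi> (\<alpha> (CC j) x)"
    if "\<phi> \<in> points (J_mor (CC j) (CC l))" "x \<in> points (FOb E (CC j))" for j l \<phi> x
    using fun_cong[OF enriched_natsD(3)[OF \<alpha> J J that(1)], of x] that(2) by (simp add: compose_eq)
  have am: "\<alpha> (CC k) x \<in> points (FOb E' (CC k))" if "x \<in> points (FOb E (CC k))" for k x
    by (rule based_mapsD(4)[OF gmapsD(1)[OF ak] that])
  show "\<alpha> (CC k) \<in> gmaps (C2U k) (Lev (spectrum_of E) k) (Lev (spectrum_of E') k)"
    unfolding gmaps_def
  proof (intro CollectI conjI ballI)
    show "\<alpha> (CC k) \<in> based_maps (Lev (spectrum_of E) k) (Lev (spectrum_of E') k)"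
      using gmapsD(1)[OF ak] by simp
    fix p x assume "p \<in> carrier (C2U k)" "x \<in> points (Lev (spectrum_of E) k)"
    then have A: "snd p \<in> unitary k" and x: "x \<in> points (FOb E (CC k))" by (simp_all add: carrier_C2U)
    have "\<alpha> (CC k) (Act (Lev (spectrum_of E) k) (fst p, snd p) x) = Act (Lev (spectrum_of E') k) (fst p, snd p) (\<alpha> (CC k) x)"
      unfolding Act_spectrum_of[OF A x] Act_spectrum_of[OF A am[OF x]]
      using nat[OF J_unitary_in[OF A] Act_FOb(1)[OF E J x]] gmapsD(2)[OF ak _ x] by simp
    then show "\<alpha> (CC k) (Act (Lev (spectrum_of E) k) p x) = Act (Lev (spectrum_of E') k) p (\<alpha> (CC k) x)" by simp
  qed
  fix x v assume "x \<in> points (Lev (spectrum_of E) k)" and v: "v \<in> points (sphere_of (CC 1))"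
  then have x: "x \<in> points (FOb E (CC k))" by simp
  have "\<alpha> (CC (Suc k)) (Str (spectrum_of E) k (smash_pt (FOb E (CC k)) (sphere_of (CC 1)) x v)) =
      Str (spectrum_of E') k (smash_pt (FOb E' (CC k)) (sphere_of (CC 1)) (\<alpha> (CC k) x) v)"
  proof (cases v)
    case None
    then show ?thesis
      using Str_None_spectrum_of[OF E] Str_None_spectrum_of[OF E'] based_mapsD(3)[OF gmapsD(1)[OF ak]]
      by (simp add: smash_pt_def)
  next
    case (Some w)
    then have w: "w \<in> CC 1" using v by auto
    show ?thesis
      unfolding Some Str_spectrum_of(1)[OF E x w] Str_spectrum_of(1)[OF E' am[OF x] w]
      using nat[OF _ x] J_incl_in[OF w, of k] by simp
  qed
  then show "\<alpha> (CC (Suc k)) (Str (spectrum_of E) k (smash_pt (Lev (spectrum_of E) k) (sphere_of (CC 1)) x v)) =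
      Str (spectrum_of E') k (smash_pt (Lev (spectrum_of E') k) (sphere_of (CC 1)) (\<alpha> (CC k) x) v)"
    by simp
qed

definition spectrum_ftor :: "('a efunctor, vec set \<Rightarrow> 'a \<Rightarrow> 'a, 'a rspectrum, nat \<Rightarrow> 'a \<Rightarrow> 'a) ftor" where
  "spectrum_ftor = \<lparr>onObj = spectrum_of, onHom = (\<lambda>E E' \<alpha> k. \<alpha> (CC k))\<rparr>"

lemma is_functor_spectrum_ftor: "is_functor C2_E1 Real_Spectra spectrum_ftor"
  unfolding is_functor_def
  using real_spectrum_spectrum_of rspectrum_maps_of_nat
  by (auto simp: C2_E1_def Real_Spectra_def spectrum_ftor_def CC_in_J_obj)

section \<open>From Real spectra to enriched functors\<close>

definition stab :: "'a rspectrum \<Rightarrow> nat \<Rightarrow> nat \<Rightarrow> 'a \<Rightarrow> vec option \<Rightarrow> 'a" where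
  "stab X k m x z = iter_str X k m (smash_pt (Lev X k) (sphere_of (CC m)) x z)"

definition is_rep :: "nat \<Rightarrow> nat \<Rightarrow> (vec \<Rightarrow> vec) \<Rightarrow> vec \<Rightarrow> (vec \<Rightarrow> vec) \<Rightarrow> vec \<Rightarrow> bool" where
  "is_rep k m f y A v \<longleftrightarrow> A \<in> unitary (k + m) \<and> v \<in> CC m \<and> (\<forall>u\<in>CC k. A u = f u) \<and> A (shift k v) = y"

text \<open>Independence of the chosen representative is \<open>spectrum_mor_rep\<close>. Isometries
  C^k -> C^l exist only for \<open>k \<le> l\<close>, so for morphisms other than
  \<open>None\<close> the difference \<open>l - k\<close> is a true one.\<close>

definition spectrum_mor :: "'a rspectrum \<Rightarrow> nat \<Rightarrow> nat \<Rightarrow> jmor \<Rightarrow> 'a \<Rightarrow> 'a" where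
  "spectrum_mor X k l \<phi> = (\<lambda>x\<in>points (Lev X k). case \<phi> of None \<Rightarrow> Pt (Lev X l)
     | Some (f, y) \<Rightarrow> (let p = SOME p. is_rep k (l - k) f y (fst p) (snd p) in
         Act (Lev X l) (False, fst p) (stab X k (l - k) x (Some (snd p)))))"

lemma J_mor_CC_cases:
  assumes "\<phi> \<in> points (J_mor (CC k) (CC l))"
  obtains "\<phi> = None" | m f y A v where "\<phi> = Some (f, y)" "l = k + m" "is_rep k m f y A v"
proof (cases \<phi>)
  case (Some p)
  obtain f y where fy: "\<phi> = Some (f, y)" "(f, y) \<in> J_bundle (CC k) (CC l)" using assms Some by auto
  have "k \<le> l" using isometry_CC_le[OF J_bundleD(1)[OF fy(2)]] .
  then obtain m where m: "l = k + m" using le_Suc_ex by blast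
  from J_bundle_unitary_rep[OF fy(2)[unfolded m]] obtain A v where
    "A \<in> unitary (k + m)" "v \<in> CC m" "\<And>u. u \<in> CC k \<Longrightarrow> A u = f u" "A (shift k v) = y" by blast
  then have "is_rep k m f y A v" by (simp add: is_rep_def)
  then show thesis using that(2)[OF fy(1) m] by blast
qed (use that in blast)

lemma shift_shift: "shift k (shift m v) = shift (k + m) v"
  by (auto simp: shift_def fun_eq_iff)

lemma block_sum_id: "block_sum k m (\<lambda>v\<in>CC k. v) (\<lambda>v\<in>CC m. v) = (\<lambda>v\<in>CC (k + m). v)"
proof (rule extensionalityI[of _ "CC (k + m)"])
  fix v assume v: "v \<in> CC (k + m)"
  show "block_sum k m (\<lambda>v\<in>CC k. v) (\<lambda>v\<in>CC m. v) v = (\<lambda>v\<in>CC (k + m). v) v"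
    using v vdrop_in_CC[OF v] by (simp add: block_sum_eq[OF unitary_id v] vtake_plus_shift_vdrop)
qed (simp_all add: block_sum_def)

text \<open>Because \<open>X\<close> equals \<open>kify X\<close>, it suffices to pair test maps
  into \<open>X\<close> with the constant map at \<open>j\<close>.\<close>

lemma continuous_map_kprod_slice:
  assumes X: "cgwh X" and J: "weak_Hausdorff J" and h: "continuous_map (kprod J X) Y h" and j: "j \<in> topspace J"
  shows "continuous_map X Y (\<lambda>x. h (j, x))"
proof -
  have "continuous_map (kify X) Y (\<lambda>x. h (j, x))"
  proof (rule continuous_map_from_kify)
    fix K :: "'a set set topology" and u assume "test_map K X u"
    then have K: "compact_Hausdorff K" and u: "continuous_map K X u"
      by (auto simp: test_map_def compact_Hausdorff_def)
    have "continuous_map K J (\<lambda>z. j)" using j by simp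
    from continuous_map_kprod_comp[OF h K J this _ u] X
    show "continuous_map K Y (\<lambda>z. h (j, u z))" by (simp add: cgwh_def)
  next
    fix x assume "x \<in> topspace X"
    then show "h (j, x) \<in> topspace Y" using h j unfolding continuous_map_def by auto
  qed
  then show ?thesis using X by (simp add: cgwh_def)
qed

section \<open>Iterated structure maps of a fixed Real spectrum\<close>

context
  fixes X :: "'a rspectrum" assumes X: "real_spectrum X"
begin

lemma Str_None: "Str X k None = Pt (Lev X (Suc k))"
  using based_mapsD(3)[OF real_spectrumD(2)[OF X]] by (simp add: smash_def)

lemma Pt_in: "Pt (Lev X k) \<in> points (Lev X k)"
  by (rule based_gspaceD(3)[OF real_spectrumD(1)[OF X]])

lemma stab_None: "stab X k m x None = Pt (Lev X (k + m))"
  by (simp add: stab_def smash_pt_def iter_str_None)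

lemma stab_Pt: "stab X k m (Pt (Lev X k)) z = Pt (Lev X (k + m))"
  by (simp add: stab_def smash_pt_def iter_str_None)

text \<open>The argument is no point of the smash product, but \<open>iter_str\<close> gives the
  base point there too; this lets \<open>stab_Some\<close> hold uniformly in
  \<open>x\<close>.\<close>

lemma iter_str_Pt: "iter_str X k m (Some (Pt (Lev X k), Some v)) = Pt (Lev X (k + m))"
proof (induction m arbitrary: v)
  case (Suc m)
  show "iter_str X k (Suc m) (Some (Pt (Lev X k), Some v)) = Pt (Lev X (k + Suc m))"
    by (simp add: Suc smash_pt_def Str_None)
qed simp

lemma stab_Some: "stab X k m x (Some v) = iter_str X k m (Some (x, Some v))"
  by (cases "x = Pt (Lev X k)") (simp_all add: stab_Pt iter_str_Pt, simp add: stab_def smash_pt_def)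

lemma stab_0: "stab X k 0 x (Some v) = x"
  by (simp add: stab_Some)

lemma stab_Suc:
  assumes "v \<in> CC m" "w \<in> CC 1"
  shows "stab X k (Suc m) x (Some (v + shift m w)) =
    Str X (k + m) (smash_pt (Lev X (k + m)) (sphere_of (CC 1)) (stab X k m x (Some v)) (Some w))"
proof -
  have "vtake m (v + shift m w) = v" "vdrop m (v + shift m w) = w"
    using assms by (simp_all add: vtake_add vdrop_add vtake_id vdrop_CC)
  then show ?thesis by (simp add: stab_Some)
qed

lemma stab_in:
  assumes "x \<in> points (Lev X k)" "z \<in> points (sphere_of (CC m))"
  shows "stab X k m x z \<in> points (Lev X (k + m))"
  using assms(2)
proof (induction m arbitrary: z)
  case 0
  then show "stab X k 0 x z \<in> points (Lev X (k + 0))"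
    using assms(1) Pt_in[of k] stab_None[of k 0 x] by (cases z) (simp_all add: stab_0)
next
  case (Suc m)
  show "stab X k (Suc m) x z \<in> points (Lev X (k + Suc m))"
  proof (cases z)
    case None
    then show ?thesis using stab_None Pt_in by simp
  next
    case (Some v)
    then have v: "v \<in> CC (m + 1)" using Suc.prems by auto
    note d = vdrop_in_CC[OF v]
    have "stab X k m x (Some (vtake m v)) \<in> points (Lev X (k + m))"
      by (rule Suc.IH) simp
    from Str_smash_in[OF X this, of "Some (vdrop m v)"] d
    have "Str X (k + m) (smash_pt (Lev X (k + m)) (sphere_of (CC 1)) (stab X k m x (Some (vtake m v))) (Some (vdrop m v)))
        \<in> points (Lev X (Suc (k + m)))" by simp
    then show ?thesis
      using stab_Suc[OF vtake_in_CC[of m v] d, where k = k and x = x] by (simp add: Some vtake_plus_shift_vdrop)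
  qed
qed

lemma stab_act:
  assumes "A \<in> unitary k" "B \<in> unitary m" "x \<in> points (Lev X k)" "v \<in> CC m"
  shows "stab X k m (Act (Lev X k) (s, A) x) (Some (B (vconj s v))) =
    Act (Lev X (k + m)) (s, block_sum k m A B) (stab X k m x (Some v))"
  using real_spectrumD(3)[OF X assms(1-3), of "Some v" s] assms(4)
  by (simp add: stab_def sphere_act_def)

text \<open>Both sides feed the same coordinates into the structure maps in the same order;
  induction on \<open>b\<close> removes the last coordinate of \<open>w\<close>.\<close>

lemma stab_add:
  assumes v: "v \<in> CC a" and w: "w \<in> CC b"
  shows "stab X k (a + b) x (Some (v + shift a w)) = stab X (k + a) b (stab X k a x (Some v)) (Some w)"
  using w
proof (induction b arbitrary: w)
  case 0
  then have "w = 0" by (simp add: CC_0)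
  then show "stab X k (a + 0) x (Some (v + shift a w)) = stab X (k + a) 0 (stab X k a x (Some v)) (Some w)"
    by (simp add: stab_0)
next
  case (Suc b)
  have d: "vdrop b w \<in> CC 1" using vdrop_in_CC[of w b 1] Suc.prems by simp
  have "v + shift a w = (v + shift a (vtake b w)) + shift (a + b) (vdrop b w)"
    by (subst vtake_plus_shift_vdrop[of b w, symmetric]) (simp only: shift_add shift_shift add.assoc)
  then have "stab X k (a + Suc b) x (Some (v + shift a w)) =
      stab X k (Suc (a + b)) x (Some ((v + shift a (vtake b w)) + shift (a + b) (vdrop b w)))"
    by (simp only: add_Suc_right)
  also have "\<dots> = Str X (k + (a + b)) (smash_pt (Lev X (k + (a + b))) (sphere_of (CC 1))
      (stab X k (a + b) x (Some (v + shift a (vtake b w)))) (Some (vdrop b w)))"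
    by (rule stab_Suc[OF block_in_CC[OF v vtake_in_CC] d])
  also have "stab X k (a + b) x (Some (v + shift a (vtake b w))) =
      stab X (k + a) b (stab X k a x (Some v)) (Some (vtake b w))"
    by (rule Suc.IH[OF vtake_in_CC])
  also have "Str X (k + (a + b)) (smash_pt (Lev X (k + (a + b))) (sphere_of (CC 1)) \<dots> (Some (vdrop b w))) =
      stab X (k + a) (Suc b) (stab X k a x (Some v)) (Some (vtake b w + shift b (vdrop b w)))"
    using stab_Suc[OF vtake_in_CC[of b w] d, where k = "k + a"] by (simp only: add.assoc)
  finally show "stab X k (a + Suc b) x (Some (v + shift a w)) = stab X (k + a) (Suc b) (stab X k a x (Some v)) (Some w)"
    by (simp only: vtake_plus_shift_vdrop)
qed

text \<open>Concatenation does not map \<open>S\<^sup>2\<^sup>m\<^sup>+\<^sup>2\<close> to \<open>S\<^sup>2\<^sup>m \<times> S\<^sup>2\<close>, so a test space \<open>K\<close> is first pulled back along the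
  quotient map \<open>S\<^sup>2\<^sup>m \<times> S\<^sup>2 \<rightarrow> S\<^sup>2\<^sup>m\<^sup>+\<^sup>2\<close>; the pullback is a compact Hausdorff space mapping onto \<open>K\<close>.\<close>

lemma continuous_map_stab:
  fixes K :: "'k topology"
  assumes "compact_Hausdorff K" "continuous_map K (Sp (Lev X k)) a" "continuous_map K (Sp (sphere_of (CC m))) b"
  shows "continuous_map K (Sp (Lev X (k + m))) (\<lambda>z. stab X k m (a z) (b z))"
proof -
  note wH = based_gspaceD(2)[OF real_spectrumD(1)[OF X]]
  let ?S = "\<lambda>m. Sp (sphere_of (CC m))"
  \<comment> \<open>The induction needs the claim for a test space of another type, the pullback of
    \<open>K\<close>. The formulation by \<open>kprod\<close> does not mention the type of the test
    space, so it can serve as induction hypothesis.\<close>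
  have "continuous_map (kprod (Sp (Lev X k)) (?S m)) (Sp (Lev X (k + m))) (\<lambda>p. stab X k m (fst p) (snd p))"
  proof (induction m)
    case 0
    show "continuous_map (kprod (Sp (Lev X k)) (?S 0)) (Sp (Lev X (k + 0))) (\<lambda>p. stab X k 0 (fst p) (snd p))"
    proof (rule continuous_map_from_kprod)
      fix K :: "('a \<times> vec option) set set topology" and a b
      assume a: "continuous_map K (Sp (Lev X k)) a" and b: "continuous_map K (?S 0) b"
      \<comment> \<open>S^0 is discrete: the finite part of the sphere is a single point, compact
        and hence clopen, so the map is glued from \<open>a\<close> and a constant.\<close>
      have S: "openin (?S 0) (Some ` CC 0)" "closedin (?S 0) (Some ` CC 0)"
      proof -
        have "compact (CC 0)" by (simp add: CC_0)
        then show "openin (?S 0) (Some ` CC 0)" "closedin (?S 0) (Some ` CC 0)"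
          by (simp_all add: sphere_of_def compactin_subtopology)
      qed
      have bz: "b z = None \<or> b z \<in> Some ` CC 0" if "z \<in> topspace K" for z
        using b that by (auto simp: continuous_map_def)
      have eq: "stab X k 0 (a z) (b z) = (if b z \<in> Some ` CC 0 then a z else Pt (Lev X k))" if "z \<in> topspace K" for z
        using bz[OF that] stab_None[of k 0] by (auto simp: stab_0)
      have c: "continuous_map K (Sp (Lev X k)) (\<lambda>z. if b z \<in> Some ` CC 0 then a z else Pt (Lev X k))"
        unfolding continuous_map_def
      proof (intro conjI allI impI)
        show "(\<lambda>z. if b z \<in> Some ` CC 0 then a z else Pt (Lev X k)) \<in> topspace K \<rightarrow> topspace (Sp (Lev X k))"
          using a Pt_in[of k] by (auto simp: continuous_map_def)
        fix U assume U: "openin (Sp (Lev X k)) U"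
        let ?T = "{z \<in> topspace K. b z \<in> Some ` CC 0}"
        have T: "openin K ?T" "closedin K ?T"
          using b S openin_continuous_map_preimage closedin_continuous_map_preimage by blast+
        have o: "openin K (?T \<inter> {z \<in> topspace K. a z \<in> U})"
          using T(1) openin_continuous_map_preimage[OF a U] by (rule openin_Int)
        have o': "openin K (topspace K - ?T)" using T(2) by (simp add: closedin_def)
        show "openin K {z \<in> topspace K. (if b z \<in> Some ` CC 0 then a z else Pt (Lev X k)) \<in> U}"
        proof (cases "Pt (Lev X k) \<in> U")
          case True
          then have "{z \<in> topspace K. (if b z \<in> Some ` CC 0 then a z else Pt (Lev X k)) \<in> U} =
              (?T \<inter> {z \<in> topspace K. a z \<in> U}) \<union> (topspace K - ?T)" by auto
          then show ?thesis using openin_Un[OF o o'] by simp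
        next
          case False
          then have "{z \<in> topspace K. (if b z \<in> Some ` CC 0 then a z else Pt (Lev X k)) \<in> U} =
              ?T \<inter> {z \<in> topspace K. a z \<in> U}" by auto
          then show ?thesis using o by simp
        qed
      qed
      show "continuous_map K (Sp (Lev X (k + 0))) (\<lambda>z. stab X k 0 (fst (a z, b z)) (snd (a z, b z)))"
        unfolding add_0_right fst_conv snd_conv by (rule continuous_map_eq[OF c]) (rule eq[symmetric])
    qed (simp only: fst_conv snd_conv, rule stab_in)
  next
    case (Suc m)
    show "continuous_map (kprod (Sp (Lev X k)) (?S (Suc m))) (Sp (Lev X (k + Suc m))) (\<lambda>p. stab X k (Suc m) (fst p) (snd p))"
    proof (rule continuous_map_from_kprod)
      fix K :: "('a \<times> vec option) set set topology" and a b
      assume K: "compact_Hausdorff K" and a: "continuous_map K (Sp (Lev X k)) a" and b: "continuous_map K (?S (Suc m)) b"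
      let ?P = "prod_topology (?S m) (?S 1)" and ?q = "sphere_concat m"
      let ?Q = "prod_topology K ?P"
      define D where "D = {p \<in> topspace ?Q. ?q (snd p) = b (fst p)}"
      have Q: "compact_Hausdorff ?Q"
        using K compact_Hausdorff_sphere
        by (simp add: compact_Hausdorff_def compact_space_prod_topology Hausdorff_space_prod_topology)
      have S: "Hausdorff_space (?S (m + 1))" using compact_Hausdorff_sphere compact_Hausdorff_def by blast
      have "continuous_map ?Q (?S (m + 1)) (\<lambda>p. ?q (snd p))"
        using continuous_map_compose[OF continuous_map_snd continuous_map_sphere_concat[of m 1]]
        unfolding o_def .
      moreover have "continuous_map ?Q (?S (m + 1)) (\<lambda>p. b (fst p))"
        using continuous_map_compose[OF continuous_map_fst b] by (simp add: o_def)
      ultimately have clD: "closedin ?Q D"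
        unfolding D_def by (rule closedin_continuous_maps_eq[OF S])
      let ?K = "subtopology ?Q D"
      have tK: "topspace ?K = D" using closedin_subset[OF clD] by auto
      have KD: "compact_Hausdorff ?K"
        using Q clD by (simp add: compact_Hausdorff_def closedin_compact_space compact_space_subtopology Hausdorff_space_subtopology)
      have f1: "continuous_map ?K K fst"
        by (rule continuous_map_from_subtopology[OF continuous_map_fst])
      have f2: "continuous_map ?K (?S m) (\<lambda>p. fst (snd p))"
        using continuous_map_compose[OF continuous_map_snd continuous_map_fst]
        by (intro continuous_map_from_subtopology) (simp add: o_def)
      have f3: "continuous_map ?K (?S 1) (\<lambda>p. snd (snd p))"
        using continuous_map_compose[OF continuous_map_snd continuous_map_snd]
        by (intro continuous_map_from_subtopology) (simp add: o_def)
      have surj: "fst ` topspace ?K = topspace K"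
      proof
        show "fst ` topspace ?K \<subseteq> topspace K" unfolding tK D_def by auto
        show "topspace K \<subseteq> fst ` topspace ?K"
        proof
          fix z assume z: "z \<in> topspace K"
          have bz: "b z \<in> points (sphere_of (CC (m + 1)))" using b z by (auto simp: continuous_map_def)
          obtain c d where cd: "c \<in> points (sphere_of (CC m))" "d \<in> points (sphere_of (CC 1))" "?q (c, d) = b z"
          proof (cases "b z")
            case None
            then show thesis using that[of None None] by simp
          next
            case (Some w)
            then have "w \<in> CC (m + 1)" using bz by auto
            from vdrop_in_CC[OF this] show thesis
              using that[of "Some (vtake m w)" "Some (vdrop m w)"] Some by (simp add: vtake_plus_shift_vdrop)
          qed
          then have "(z, c, d) \<in> D" using z by (auto simp: D_def)
          then show "z \<in> fst ` topspace ?K" unfolding tK by force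
        qed
      qed
      have ac: "continuous_map ?K (Sp (Lev X k)) (\<lambda>p. a (fst p))"
        using continuous_map_compose[OF f1 a] by (simp add: o_def)
      have "continuous_map ?K (Sp (Lev X (k + m))) (\<lambda>p. stab X k m (a (fst p)) (fst (snd p)))"
        using continuous_map_kprod_comp[OF Suc KD wH ac weak_Hausdorff_sphere f2] by simp
      from continuous_map_into_smash[OF KD wH weak_Hausdorff_sphere this f3]
      have "continuous_map ?K (Sp (smash (Lev X (k + m)) (sphere_of (CC 1))))
          (\<lambda>p. smash_pt (Lev X (k + m)) (sphere_of (CC 1)) (stab X k m (a (fst p)) (fst (snd p))) (snd (snd p)))" .
      from continuous_map_compose[OF this based_mapsD(2)[OF real_spectrumD(2)[OF X]]]
      have c: "continuous_map ?K (Sp (Lev X (Suc (k + m))))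
          (\<lambda>p. Str X (k + m) (smash_pt (Lev X (k + m)) (sphere_of (CC 1)) (stab X k m (a (fst p)) (fst (snd p))) (snd (snd p))))"
        by (simp add: o_def)
      have eq: "Str X (k + m) (smash_pt (Lev X (k + m)) (sphere_of (CC 1)) (stab X k m (a (fst p)) (fst (snd p))) (snd (snd p))) =
          stab X k (Suc m) (a (fst p)) (b (fst p))" if p: "p \<in> topspace ?K" for p
      proof -
        obtain z c d where zcd: "p = (z, c, d)" by (metis surj_pair)
        have b: "b z = ?q (c, d)" and cd: "c \<in> points (sphere_of (CC m))" "d \<in> points (sphere_of (CC 1))"
          using p unfolding tK by (auto simp: D_def zcd)
        show ?thesis
        proof (cases "c = None \<or> d = None")
          case True
          then have "b z = None" using b by auto
          then show ?thesis using True
            by (auto simp: zcd stab_None smash_pt_def Str_None)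
        next
          case False
          then obtain v w where vw: "c = Some v" "d = Some w" by auto
          then have "v \<in> CC m" "w \<in> CC 1" using cd by auto
          from stab_Suc[OF this] show ?thesis by (simp add: zcd b vw)
        qed
      qed
      have "continuous_map ?K (Sp (Lev X (k + Suc m))) (\<lambda>p. stab X k (Suc m) (a (fst p)) (b (fst p)))"
        using continuous_map_eq[OF c eq] by simp
      then have "continuous_map K (Sp (Lev X (k + Suc m))) (\<lambda>z. stab X k (Suc m) (a z) (b z))"
        using KD K by (intro continuous_map_from_surjection[OF _ _ f1 surj]) (auto simp: compact_Hausdorff_def)
      then show "continuous_map K (Sp (Lev X (k + Suc m))) (\<lambda>z. stab X k (Suc m) (fst (a z, b z)) (snd (a z, b z)))"
        by simp
    qed (simp only: fst_conv snd_conv, rule stab_in)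
  qed
  from continuous_map_kprod_comp[OF this assms(1) wH assms(2) weak_Hausdorff_sphere assms(3)]
  show ?thesis by simp
qed

section \<open>The action of J on the levels: well-definedness, functoriality, continuity\<close>

lemma Lev_act_in:
  "A \<in> unitary k \<Longrightarrow> x \<in> points (Lev X k) \<Longrightarrow> Act (Lev X k) (s, A) x \<in> points (Lev X k)"
  by (rule based_gspaceD(8)[OF real_spectrumD(1)[OF X]]) (simp_all add: carrier_C2U)

lemma Lev_act_act:
  "A \<in> unitary k \<Longrightarrow> B \<in> unitary k \<Longrightarrow> x \<in> points (Lev X k) \<Longrightarrow>
    Act (Lev X k) (s, A) (Act (Lev X k) (t, B) x) = Act (Lev X k) (s \<noteq> t, compose (CC k) A (mconj s (CC k) B)) x"
  using based_gspaceD(9)[OF real_spectrumD(1)[OF X], of "(s, A)" k "(t, B)" x]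
  by (simp add: C2U_def)

lemma Lev_act_id: "x \<in> points (Lev X k) \<Longrightarrow> Act (Lev X k) (False, \<lambda>v\<in>CC k. v) x = x"
  using based_gspaceD(10)[OF real_spectrumD(1)[OF X]] by (simp add: C2U_def)

lemma Lev_act_Pt: "A \<in> unitary k \<Longrightarrow> Act (Lev X k) (s, A) (Pt (Lev X k)) = Pt (Lev X k)"
  by (rule based_gspaceD(7)[OF real_spectrumD(1)[OF X]]) (simp add: carrier_C2U)

lemma Lev_act_compose:
  "A \<in> unitary k \<Longrightarrow> B \<in> unitary k \<Longrightarrow> x \<in> points (Lev X k) \<Longrightarrow>
    Act (Lev X k) (False, A) (Act (Lev X k) (t, B) x) = Act (Lev X k) (t, compose (CC k) A B) x"
  using Lev_act_act[of A k B x False t] unitaryD(2)[of B k] by (simp add: mconj_False)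

lemma spectrum_mor_rep:
  assumes r: "is_rep k m f y A v" and x: "x \<in> points (Lev X k)"
  shows "spectrum_mor X k (k + m) (Some (f, y)) x = Act (Lev X (k + m)) (False, A) (stab X k m x (Some v))"
proof -
  define p where "p = (SOME p. is_rep k m f y (fst p) (snd p))"
  have "is_rep k m f y (fst (A, v)) (snd (A, v))" using r by simp
  then have p: "is_rep k m f y (fst p) (snd p)" unfolding p_def
    by (rule someI[where P = "\<lambda>p. is_rep k m f y (fst p) (snd p)"])
  let ?C = "fst p" and ?w = "snd p"
  have C: "?C \<in> unitary (k + m)" "?w \<in> CC m" and A: "A \<in> unitary (k + m)" "v \<in> CC m"
    and eq: "\<And>u. u \<in> CC k \<Longrightarrow> ?C u = A u" "?C (shift k ?w) = A (shift k v)"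
    using p r by (auto simp: is_rep_def)
  obtain B where B: "B \<in> unitary m" "A = compose (CC (k + m)) ?C (block_sum k m (\<lambda>u\<in>CC k. u) B)" "B v = ?w"
    by (rule unitary_rep_unique[OF C(1) A(1) C(2) A(2) eq])
  have z: "stab X k m x (Some v) \<in> points (Lev X (k + m))" using A(2) by (intro stab_in x) auto
  have "Act (Lev X (k + m)) (False, A) (stab X k m x (Some v)) =
      Act (Lev X (k + m)) (False, ?C) (Act (Lev X (k + m)) (False, block_sum k m (\<lambda>u\<in>CC k. u) B) (stab X k m x (Some v)))"
    by (subst Lev_act_compose[OF C(1) block_sum_unitary[OF unitary_id B(1)] z]) (simp only: B(2)[symmetric])
  \<comment> \<open>Two representatives differ by \<open>1 \<oplus> B\<close>; the structure map
    absorbs this factor by replacing \<open>v\<close> with \<open>B v\<close>, which is the chosen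
    vector.\<close>
  also have "Act (Lev X (k + m)) (False, block_sum k m (\<lambda>u\<in>CC k. u) B) (stab X k m x (Some v)) =
      stab X k m (Act (Lev X k) (False, \<lambda>u\<in>CC k. u) x) (Some (B (vconj False v)))"
    by (rule stab_act[OF unitary_id B(1) x A(2), symmetric])
  also have "\<dots> = stab X k m x (Some ?w)" using B(3) Lev_act_id[OF x] by simp
  finally show ?thesis
    using x by (simp add: spectrum_mor_def p_def Let_def)
qed

lemma spectrum_mor_None: "x \<in> points (Lev X k) \<Longrightarrow> spectrum_mor X k l None x = Pt (Lev X l)"
  by (simp add: spectrum_mor_def)

lemma thom_map_is_rep:
  "A \<in> unitary (k + m) \<Longrightarrow> v \<in> CC m \<Longrightarrow> is_rep k m (\<lambda>u\<in>CC k. A u) (A (shift k v)) A v"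
  by (simp add: is_rep_def)

lemma spectrum_mor_thom:
  assumes A: "A \<in> unitary (k + m)" and z: "z \<in> points (sphere_of (CC m))" and x: "x \<in> points (Lev X k)"
  shows "spectrum_mor X k (k + m) (thom_map k (A, z)) x = Act (Lev X (k + m)) (False, A) (stab X k m x z)"
proof (cases z)
  case None
  then show ?thesis using spectrum_mor_None[OF x] Lev_act_Pt[OF A] by (simp add: stab_None)
next
  case (Some v)
  then have "v \<in> CC m" using z by auto
  from spectrum_mor_rep[OF thom_map_is_rep[OF A this] x] show ?thesis by (simp add: Some)
qed

lemma spectrum_mor_in:
  assumes "\<phi> \<in> points (J_mor (CC k) (CC l))" "x \<in> points (Lev X k)"
  shows "spectrum_mor X k l \<phi> x \<in> points (Lev X l)"
  using assms(1)
proof (cases rule: J_mor_CC_cases)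
  case 1
  then show ?thesis using spectrum_mor_None[OF assms(2)] Pt_in by simp
next
  case (2 m f y A v)
  then have "A \<in> unitary (k + m)" "v \<in> CC m" by (simp_all add: is_rep_def)
  then have "Act (Lev X (k + m)) (False, A) (stab X k m x (Some v)) \<in> points (Lev X (k + m))"
    by (intro Lev_act_in stab_in assms(2)) auto
  then show ?thesis using spectrum_mor_rep[OF 2(3) assms(2)] by (simp add: 2(1,2))
qed

lemma spectrum_mor_Pt:
  assumes "\<phi> \<in> points (J_mor (CC k) (CC l))"
  shows "spectrum_mor X k l \<phi> (Pt (Lev X k)) = Pt (Lev X l)"
  using assms
proof (cases rule: J_mor_CC_cases)
  case 1
  then show ?thesis using spectrum_mor_None[OF Pt_in] by simp
next
  case (2 m f y A v)
  then have "A \<in> unitary (k + m)" by (simp add: is_rep_def)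
  then show ?thesis using spectrum_mor_rep[OF 2(3) Pt_in] Lev_act_Pt by (simp add: 2(1,2) stab_Pt)
qed

lemma spectrum_mor_id:
  assumes "x \<in> points (Lev X k)" shows "spectrum_mor X k k (J_id (CC k)) x = x"
proof -
  have "is_rep k 0 (\<lambda>u\<in>CC k. u) 0 (\<lambda>u\<in>CC k. u) 0"
    using unitary_id[of k] by (simp add: is_rep_def)
  from spectrum_mor_rep[OF this assms] show ?thesis
    using Lev_act_id[OF assms] by (simp add: J_id_def stab_0)
qed

lemma spectrum_mor_comp:
  assumes p: "\<psi> \<in> points (J_mor (CC k) (CC l))" and q: "\<phi> \<in> points (J_mor (CC l) (CC n))"
    and x: "x \<in> points (Lev X k)"
  shows "spectrum_mor X k n (J_comp (CC k) \<phi> \<psi>) x = spectrum_mor X l n \<phi> (spectrum_mor X k l \<psi> x)"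
proof (cases "\<psi> = None \<or> \<phi> = None")
  case True
  then show ?thesis
    using spectrum_mor_None[OF x] spectrum_mor_None[OF spectrum_mor_in[OF p x]] spectrum_mor_Pt[OF q] by auto
next
  case False
  obtain a f y A v where P: "\<psi> = Some (f, y)" "l = k + a" "is_rep k a f y A v"
    by (rule J_mor_CC_cases[OF p]) (use False in blast)+
  obtain b g z B w where Q: "\<phi> = Some (g, z)" "n = l + b" "is_rep l b g z B w"
    by (rule J_mor_CC_cases[OF q]) (use False in blast)+
  have A: "A \<in> unitary (k + a)" "v \<in> CC a" "\<And>u. u \<in> CC k \<Longrightarrow> A u = f u" "A (shift k v) = y"
    using P(3) by (auto simp: is_rep_def)
  have B: "B \<in> unitary (k + a + b)" "w \<in> CC b" "\<And>u. u \<in> CC (k + a) \<Longrightarrow> B u = g u" "B (shift (k + a) w) = z"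
    using Q(3) by (auto simp: is_rep_def P(2))
  let ?I = "\<lambda>u\<in>CC b. u"
  note AI = block_sum_unitary[OF A(1) unitary_id[of b]]
  \<comment> \<open>\<open>B (A \<oplus> 1)\<close> with the vector \<open>v \<oplus> w\<close>
    represents the composite: on C^k it is \<open>g\<close> after \<open>f\<close>, and it sends the
    two summands of the vector to \<open>g y\<close> and \<open>z\<close>.\<close>
  define D where "D = compose (CC (k + a + b)) B (block_sum (k + a) b A ?I)"
  have D: "D \<in> unitary (k + a + b)" unfolding D_def by (rule unitary_compose[OF B(1) AI])
  have sub: "u \<in> CC (k + a + b)" if "u \<in> CC (k + a)" for u using that CC_mono[of "k + a" "k + a + b"] by auto
  have sub': "u \<in> CC (k + a)" if "u \<in> CC k" for u using that CC_mono[of k "k + a"] by auto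
  have Ak: "A u \<in> CC (k + a)" if "u \<in> CC (k + a)" for u using unitaryD(1)[OF A(1) that] .
  have sv: "shift k v \<in> CC (k + a)" and sw: "shift (k + a) w \<in> CC (k + a + b)"
    using shift_in_CC A(2) B(2) by auto
  have rep: "is_rep k (a + b) (compose (CC k) g f) (z + g y) D (v + shift a w)"
    unfolding is_rep_def
  proof (intro conjI ballI)
    show "D \<in> unitary (k + (a + b))" using D by (simp only: add.assoc)
    show "v + shift a w \<in> CC (a + b)" by (rule block_in_CC[OF A(2) B(2)])
    fix u assume u: "u \<in> CC k"
    have "D u = B (A u)"
      using block_sum_CC[OF A(1) unitary_id sub'[OF u], of b] sub[OF sub'[OF u]] by (simp add: D_def compose_eq)
    then show "D u = compose (CC k) g f u"
      using u B(3)[OF Ak[OF sub'[OF u]]] A(3)[OF u] by (simp add: compose_eq)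
  next
    have "D (shift k (v + shift a w)) = D (shift k v + shift (k + a) w)" by (simp only: shift_add shift_shift)
    also have "\<dots> = D (shift k v) + D (shift (k + a) w)" by (rule unitaryD(3)[OF D sub[OF sv] sw])
    also have "D (shift k v) = g y"
      using block_sum_CC[OF A(1) unitary_id sv, of b] sub[OF sv] B(3)[OF Ak[OF sv]] A(4)
      by (simp add: D_def compose_eq)
    also have "D (shift (k + a) w) = z"
      using block_sum_shift[OF A(1) B(2), of ?I] sw B(2,4) by (simp add: D_def compose_eq)
    finally show "D (shift k (v + shift a w)) = z + g y" by (simp only: add.commute)
  qed
  let ?y = "stab X k a x (Some v)"
  have y: "?y \<in> points (Lev X (k + a))" using A(2) by (intro stab_in x) auto
  have z: "stab X (k + a) b ?y (Some w) \<in> points (Lev X (k + a + b))" using B(2) by (intro stab_in y) auto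
  have "spectrum_mor X k n (J_comp (CC k) \<phi> \<psi>) x =
      Act (Lev X (k + (a + b))) (False, D) (stab X k (a + b) x (Some (v + shift a w)))"
    using spectrum_mor_rep[OF rep x] by (simp only: P(1,2) Q(1,2) J_comp_Some add.assoc)
  also have "\<dots> = Act (Lev X (k + a + b)) (False, D) (stab X (k + a) b ?y (Some w))"
    by (simp only: stab_add[OF A(2) B(2)] add.assoc)
  also have "\<dots> = Act (Lev X (k + a + b)) (False, B)
      (Act (Lev X (k + a + b)) (False, block_sum (k + a) b A ?I) (stab X (k + a) b ?y (Some w)))"
    unfolding D_def by (rule Lev_act_compose[OF B(1) AI z, symmetric])
  also have "Act (Lev X (k + a + b)) (False, block_sum (k + a) b A ?I) (stab X (k + a) b ?y (Some w)) =
      stab X (k + a) b (Act (Lev X (k + a)) (False, A) ?y) (Some (?I (vconj False w)))"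
    by (rule stab_act[OF A(1) unitary_id y B(2), symmetric])
  also have "\<dots> = stab X (k + a) b (spectrum_mor X k l \<psi> x) (Some w)"
    using spectrum_mor_rep[OF P(3) x] B(2) by (simp add: P(1,2))
  also have "Act (Lev X (k + a + b)) (False, B) \<dots> = spectrum_mor X l n \<phi> (spectrum_mor X k l \<psi> x)"
    using spectrum_mor_rep[OF Q(3), of "spectrum_mor X k l \<psi> x"] spectrum_mor_in[OF p x] by (simp add: P(2) Q(1,2))
  finally show ?thesis .
qed

lemma spectrum_mor_act:
  assumes p: "\<phi> \<in> points (J_mor (CC k) (CC l))" and x: "x \<in> points (Lev X k)"
  shows "spectrum_mor X k l (J_act s (CC k) \<phi>) (Act (Lev X k) (s, \<lambda>v\<in>CC k. v) x) =
    Act (Lev X l) (s, \<lambda>v\<in>CC l. v) (spectrum_mor X k l \<phi> x)"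
  using p
proof (cases rule: J_mor_CC_cases)
  case 1
  then show ?thesis
    using spectrum_mor_None[OF x] spectrum_mor_None[OF Lev_act_in[OF unitary_id x]] Lev_act_Pt[OF unitary_id]
    by (simp add: J_act_def)
next
  case (2 m f y A v)
  have A: "A \<in> unitary (k + m)" "v \<in> CC m" "\<And>u. u \<in> CC k \<Longrightarrow> A u = f u" "A (shift k v) = y"
    using 2(3) by (auto simp: is_rep_def)
  \<comment> \<open>Conjugating a representative represents the conjugated morphism, as
    \<open>shift\<close> commutes with \<open>vconj\<close>.\<close>
  let ?M = "mconj s (CC (k + m)) A"
  have M: "?M \<in> unitary (k + m)" by (rule mconj_unitary[OF A(1)])
  have sv: "shift k v \<in> CC (k + m)" by (rule shift_in_CC[OF A(2)])
  have sub: "u \<in> CC (k + m)" if "u \<in> CC k" for u using that CC_mono[of k "k + m"] by auto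
  have rep: "is_rep k m (mconj s (CC k) f) (vconj s y) ?M (vconj s v)"
    using A M sv sub by (simp add: is_rep_def mconj_apply vconj_shift[symmetric])
  let ?z = "stab X k m x (Some v)" and ?sx = "Act (Lev X k) (s, \<lambda>v\<in>CC k. v) x"
  have z: "?z \<in> points (Lev X (k + m))" using A(2) by (intro stab_in x) auto
  have sx: "?sx \<in> points (Lev X k)" by (rule Lev_act_in[OF unitary_id x])
  have "spectrum_mor X k l (J_act s (CC k) \<phi>) ?sx =
      Act (Lev X (k + m)) (False, ?M) (stab X k m ?sx (Some (vconj s v)))"
    using spectrum_mor_rep[OF rep sx] by (simp add: 2(1,2) J_act_def)
  also have "stab X k m ?sx (Some (vconj s v)) = Act (Lev X (k + m)) (s, \<lambda>v\<in>CC (k + m). v) ?z"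
    using stab_act[OF unitary_id unitary_id[of m] x A(2), of s] A(2) by (simp add: block_sum_id)
  \<comment> \<open>In the semidirect product
    \<open>(1, s A s) (s, 1) = (s, s A s) = (s, 1) (1, A)\<close>; this step and the next are the
    two halves.\<close>
  also have "Act (Lev X (k + m)) (False, ?M) \<dots> = Act (Lev X (k + m)) (s, ?M) ?z"
  proof -
    have "compose (CC (k + m)) ?M (\<lambda>v\<in>CC (k + m). v) = ?M"
      using unitaryD(1,2)[OF M] by (intro compose_Id) auto
    then show ?thesis using Lev_act_compose[OF M unitary_id z, of s] by simp
  qed
  also have "\<dots> = Act (Lev X (k + m)) (s, \<lambda>v\<in>CC (k + m). v) (Act (Lev X (k + m)) (False, A) ?z)"
  proof -
    have "compose (CC (k + m)) (\<lambda>v\<in>CC (k + m). v) ?M = ?M"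
      using unitaryD(1,2)[OF M] by (intro Id_compose) auto
    then show ?thesis using Lev_act_act[OF unitary_id A(1) z, of s False] by simp
  qed
  also have "Act (Lev X (k + m)) (False, A) ?z = spectrum_mor X k l \<phi> x"
    using spectrum_mor_rep[OF 2(3) x] by (simp add: 2(1,2))
  finally show ?thesis unfolding 2(2) .
qed

lemma continuous_map_Lev_act:
  assumes K: "compact_Hausdorff K" and p: "continuous_map K (top_of_set (unitary k)) p"
    and s: "continuous_map K (discrete_topology UNIV) s" and a: "continuous_map K (Sp (Lev X k)) a"
  shows "continuous_map K (Sp (Lev X k)) (\<lambda>z. Act (Lev X k) (s z, p z) (a z))"
proof -
  note b = based_gspaceD[OF real_spectrumD(1)[OF X]]
  have "Hausdorff_space (gtop (C2U k))"
    using compact_Hausdorff_unitary[of k]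
    by (simp add: C2U_def Hausdorff_space_prod_topology compact_Hausdorff_def)
  then have "weak_Hausdorff (gtop (C2U k))" by (rule Hausdorff_imp_weak_Hausdorff)
  moreover have "continuous_map K (gtop (C2U k)) (\<lambda>z. (s z, p z))"
    using s p by (simp add: C2U_def continuous_map_paired)
  ultimately show ?thesis
    using continuous_map_kprod_comp[OF b(6) K _ _ b(2) a] by fastforce
qed

text \<open>On U(k+m) x S^2m the map becomes \<open>h\<close>, with \<open>A\<close> and
  \<open>z\<close> as variables, and is jointly continuous. Currying gives continuity into the
  mapping space, and the result descends because \<open>thom_map\<close> is a quotient map.\<close>

lemma continuous_map_spectrum_mor:
  "continuous_map (Sp (J_mor (CC k) (CC l))) (kify (compact_open (Lev X k) (Lev X l))) (spectrum_mor X k l)"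
  and spectrum_mor_based: "\<phi> \<in> points (J_mor (CC k) (CC l)) \<Longrightarrow> spectrum_mor X k l \<phi> \<in> based_maps (Lev X k) (Lev X l)"
proof -
  note b = based_gspaceD[OF real_spectrumD(1)[OF X]]
  have const: "spectrum_mor X k l None \<in> based_maps (Lev X k) (Lev X l)" for l
  proof -
    have "continuous_map (Sp (Lev X k)) (Sp (Lev X l)) (\<lambda>x\<in>points (Lev X k). Pt (Lev X l))"
      by (rule continuous_map_eq[of _ _ "\<lambda>x. Pt (Lev X l)"]) (simp_all add: Pt_in)
    then show ?thesis by (simp add: spectrum_mor_def based_maps_def Pt_in)
  qed
  have main: "continuous_map (Sp (J_mor (CC k) (CC (k + m)))) (kify (compact_open (Lev X k) (Lev X (k + m)))) (spectrum_mor X k (k + m)) \<and>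
    (\<forall>\<phi>\<in>points (J_mor (CC k) (CC (k + m))). spectrum_mor X k (k + m) \<phi> \<in> based_maps (Lev X k) (Lev X (k + m)))" for m
  proof -
    let ?P = "prod_topology (top_of_set (unitary (k + m))) (Sp (sphere_of (CC m)))"
    let ?Y = "Lev X (k + m)"
    have P: "compact_Hausdorff ?P"
      using compact_Hausdorff_unitary[of "k + m"] compact_Hausdorff_sphere[of m]
      by (simp add: compact_Hausdorff_def compact_space_prod_topology Hausdorff_space_prod_topology)
    then have wP: "weak_Hausdorff ?P" using Hausdorff_imp_weak_Hausdorff compact_Hausdorff_def by blast
    define h where "h = (\<lambda>((A, z), x). Act ?Y (False, A) (stab X k m x z))"
    have h: "continuous_map (kprod ?P (Sp (Lev X k))) (Sp ?Y) h"
    proof (rule continuous_map_from_kprod)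
      fix K :: "(((vec \<Rightarrow> vec) \<times> vec option) \<times> 'a) set set topology" and p a
      assume K: "compact_Hausdorff K" and p: "continuous_map K ?P p" and a: "continuous_map K (Sp (Lev X k)) a"
      have p1: "continuous_map K (top_of_set (unitary (k + m))) (\<lambda>z. fst (p z))"
        and p2: "continuous_map K (Sp (sphere_of (CC m))) (\<lambda>z. snd (p z))"
        using p by (simp_all add: continuous_map_pairwise o_def)
      have "continuous_map K (Sp ?Y) (\<lambda>z. Act ?Y (False, fst (p z)) (stab X k m (a z) (snd (p z))))"
        by (rule continuous_map_Lev_act[OF K p1 _ continuous_map_stab[OF K a p2]]) simp
      then show "continuous_map K (Sp ?Y) (\<lambda>z. h (p z, a z))"
        by (simp add: h_def case_prod_unfold)
    next
      fix p x assume p: "p \<in> topspace ?P" and x: "x \<in> topspace (Sp (Lev X k))"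
      obtain A z where "p = (A, z)" by (cases p)
      then show "h (p, x) \<in> topspace (Sp ?Y)"
        using p Lev_act_in[OF _ stab_in[OF x]] by (auto simp: h_def)
    qed
    have eq: "spectrum_mor X k (k + m) (thom_map k p) x = h (p, x)" if p: "p \<in> topspace ?P" and x: "x \<in> points (Lev X k)" for p x
    proof -
      obtain A z where Az: "p = (A, z)" by (cases p)
      then have "A \<in> unitary (k + m)" "z \<in> points (sphere_of (CC m))" using p by auto
      from spectrum_mor_thom[OF this x] show ?thesis by (simp add: h_def Az)
    qed
    have surj: "thom_map k ` topspace ?P = points (J_mor (CC k) (CC (k + m)))"
      using thom_map_surj[of k m] by simp
    have based: "spectrum_mor X k (k + m) (thom_map k p) \<in> based_maps (Lev X k) ?Y" if p: "p \<in> topspace ?P" for p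
    proof -
      have "continuous_map (Sp (Lev X k)) (Sp ?Y) (spectrum_mor X k (k + m) (thom_map k p))"
        by (rule continuous_map_eq[OF continuous_map_kprod_slice[OF b(1) wP h p]]) (rule eq[OF p, symmetric])
      moreover have "thom_map k p \<in> points (J_mor (CC k) (CC (k + m)))"
        unfolding surj[symmetric] using p by (rule imageI)
      ultimately show ?thesis
        using spectrum_mor_Pt by (simp add: based_maps_def spectrum_mor_def del: points_J_mor)
    qed
    have "continuous_map ?P (kify (compact_open (Lev X k) ?Y)) (\<lambda>p. spectrum_mor X k (k + m) (thom_map k p))"
      by (rule continuous_map_curry[OF b(2) b(2) P h based eq])
    then have "continuous_map (Sp (J_mor (CC k) (CC (k + m)))) (kify (compact_open (Lev X k) ?Y)) (spectrum_mor X k (k + m))"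
      using P compact_Hausdorff_J_mor[of k m] surj
      by (intro continuous_map_from_surjection[OF _ _ continuous_map_thom_map]) (auto simp: compact_Hausdorff_def)
    moreover have "\<forall>\<phi>\<in>points (J_mor (CC k) (CC (k + m))). spectrum_mor X k (k + m) \<phi> \<in> based_maps (Lev X k) ?Y"
      unfolding surj[symmetric] using based by blast
    ultimately show ?thesis by blast
  qed
  \<comment> \<open>For \<open>k > l\<close> there are no isometries and the Thom space is a
    point.\<close>
  have small: "points (J_mor (CC k) (CC l)) = {None}" if "\<not> k \<le> l"
    using that isometry_CC_le[of _ k l] by (auto simp: J_bundle_def)
  show "continuous_map (Sp (J_mor (CC k) (CC l))) (kify (compact_open (Lev X k) (Lev X l))) (spectrum_mor X k l)"
  proof (cases "k \<le> l")
    case True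
    then obtain m where "l = k + m" using le_Suc_ex by blast
    then show ?thesis using main by blast
  next
    case False
    show ?thesis
      by (rule continuous_map_eq[of _ _ "\<lambda>\<phi>. spectrum_mor X k l None"]) (use const small[OF False] in auto)
  qed
  show "spectrum_mor X k l \<phi> \<in> based_maps (Lev X k) (Lev X l)" if "\<phi> \<in> points (J_mor (CC k) (CC l))"
  proof (cases "k \<le> l")
    case True
    then obtain m where "l = k + m" using le_Suc_ex by blast
    then show ?thesis using main that by blast
  next
    case False
    then show ?thesis using const small[OF False] that by (metis singletonD)
  qed
qed

end

section \<open>The enriched functor of a Real spectrum\<close>

definition efunctor_of :: "'a rspectrum \<Rightarrow> 'a efunctor" where
  "efunctor_of X = \<lparr>
     FOb = (\<lambda>U\<in>J_obj. \<lparr>Sp = Sp (Lev X (jdim U)), Pt = Pt (Lev X (jdim U)),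
       Act = (\<lambda>s. Act (Lev X (jdim U)) (s, \<lambda>v\<in>CC (jdim U). v))\<rparr>),
     FMor = (\<lambda>U V. if U \<in> J_obj \<and> V \<in> J_obj
       then \<lambda>\<phi>\<in>points (J_mor U V). spectrum_mor X (jdim U) (jdim V) (J_std U V \<phi>) else undefined)\<rparr>"

lemma FOb_efunctor_of [simp]:
  assumes "U \<in> J_obj"
  shows "Sp (FOb (efunctor_of X) U) = Sp (Lev X (jdim U))" "Pt (FOb (efunctor_of X) U) = Pt (Lev X (jdim U))"
    "Act (FOb (efunctor_of X) U) s = Act (Lev X (jdim U)) (s, \<lambda>v\<in>CC (jdim U). v)"
  using assms by (simp_all add: efunctor_of_def)

lemma FMor_efunctor_of:
  "U \<in> J_obj \<Longrightarrow> V \<in> J_obj \<Longrightarrow> \<phi> \<in> points (J_mor U V) \<Longrightarrow>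
    FMor (efunctor_of X) U V \<phi> = spectrum_mor X (jdim U) (jdim V) (J_std U V \<phi>)"
  by (simp add: efunctor_of_def)

lemma based_maps_efunctor_of:
  assumes "U \<in> J_obj" "V \<in> J_obj"
  shows "based_maps (FOb (efunctor_of X) U) (FOb (efunctor_of Y) V) = based_maps (Lev X (jdim U)) (Lev Y (jdim V))"
  using assms by (simp add: based_maps_def)

lemma compact_open_efunctor_of:
  assumes "U \<in> J_obj" "V \<in> J_obj"
  shows "compact_open (FOb (efunctor_of X) U) (FOb (efunctor_of X) V) = compact_open (Lev X (jdim U)) (Lev X (jdim V))"
  using assms by (simp add: compact_open_def based_maps_efunctor_of)

context
  fixes X :: "'a rspectrum" assumes X: "real_spectrum X"
begin

lemma based_gspace_efunctor_of:
  assumes U: "U \<in> J_obj" shows "based_gspace C2 (FOb (efunctor_of X) U)"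
proof -
  let ?k = "jdim U" and ?F = "FOb (efunctor_of X) U"
  let ?L = "Lev X ?k" and ?I = "\<lambda>v\<in>CC ?k. v"
  note b = based_gspaceD[OF real_spectrumD(1)[OF X, of ?k]]
  have I: "(s, ?I) \<in> carrier (C2U ?k)" for s by (simp add: carrier_C2U unitary_id)
  have "group_action C2 (points ?F) (Act ?F)"
  proof (rule group_actionI[OF group_C2])
    fix s :: bool
    show "Act ?F s \<in> extensional (points ?F)" using b(11)[OF I] U by simp
  next
    fix s :: bool and x assume x: "x \<in> points ?F"
    then show "Act ?F s x \<in> points ?F" using b(8)[OF I] U by simp
  next
    fix s t :: bool and x assume "x \<in> points ?F"
    then have x: "x \<in> points ?L" using U by simp
    have "compose (CC ?k) ?I (mconj s (CC ?k) ?I) = ?I"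
      by (auto simp: mconj_id compose_def)
    then show "Act ?F (s \<otimes>\<^bsub>C2\<^esub> t) x = Act ?F s (Act ?F t x)"
      using Lev_act_act[OF X unitary_id unitary_id x, of s t] U by simp
  next
    fix x assume "x \<in> points ?F"
    then show "Act ?F \<one>\<^bsub>C2\<^esub> x = x" using Lev_act_id[OF X] U by simp
  qed
  moreover have "continuous_map (kprod (gtop C2) (Sp ?F)) (Sp ?F) (\<lambda>(s, x). Act ?F s x)"
  proof (rule continuous_map_from_kprod)
    fix K :: "(bool \<times> 'a) set set topology" and s a
    assume K: "compact_Hausdorff K" and s: "continuous_map K (gtop C2) s" and a: "continuous_map K (Sp ?F) a"
    have "continuous_map K (Sp ?L) (\<lambda>z. Act ?L (s z, ?I) (a z))"
      by (rule continuous_map_Lev_act[OF X K]) (use s a U unitary_id in auto)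
    then show "continuous_map K (Sp ?F) (\<lambda>z. case (s z, a z) of (s, x) \<Rightarrow> Act ?F s x)"
      using U by simp
  next
    fix s :: bool and x assume "x \<in> topspace (Sp ?F)"
    then show "(case (s, x) of (s, x) \<Rightarrow> Act ?F s x) \<in> topspace (Sp ?F)" using b(8)[OF I] U by simp
  qed
  moreover have "cgwh (Sp ?F)" "Pt ?F \<in> points ?F" "\<forall>s\<in>carrier C2. Act ?F s (Pt ?F) = Pt ?F"
    using b(1,3) b(7)[OF I] U by simp_all
  moreover have "Act ?F \<in> extensional (carrier C2)" by simp
  ultimately show ?thesis
    unfolding based_gspace_def by blast
qed

lemma enriched_functor_efunctor_of: "enriched_functor (efunctor_of X)"
proof -
  let ?F = "efunctor_of X"
  have mor: "FMor ?F U V \<in> gmaps C2 (J_mor U V) (map_space (FOb ?F U) (FOb ?F V))"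
    if U: "U \<in> J_obj" and V: "V \<in> J_obj" for U V
  proof -
    let ?k = "jdim U" and ?l = "jdim V"
    have c: "continuous_map (Sp (J_mor U V)) (kify (compact_open (Lev X ?k) (Lev X ?l))) (FMor ?F U V)"
      using continuous_map_compose[OF continuous_map_J_std[OF U V] continuous_map_spectrum_mor[OF X]]
      by (rule continuous_map_eq) (simp add: FMor_efunctor_of[OF U V] del: points_J_mor)
    have n: "FMor ?F U V None = (\<lambda>x\<in>points (Lev X ?k). Pt (Lev X ?l))"
      using FMor_efunctor_of[OF U V, of None X] by (simp add: J_std_def spectrum_mor_def)
    have "FMor ?F U V (Act (J_mor U V) s \<phi>) = Act (map_space (FOb ?F U) (FOb ?F V)) s (FMor ?F U V \<phi>)"
      if p: "\<phi> \<in> points (J_mor U V)" for s \<phi>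
    proof -
      note sp = J_std_in[OF U V p]
      let ?f = "spectrum_mor X ?k ?l"
      have f: "?f (J_std U V \<phi>) \<in> based_maps (Lev X ?k) (Lev X ?l)" by (rule spectrum_mor_based[OF X sp])
      have "FMor ?F U V (Act (J_mor U V) s \<phi>) = ?f (J_act s (CC ?k) (J_std U V \<phi>))"
        using FMor_efunctor_of[OF U V J_act_in[OF p J_obj_fd[OF U] J_obj_fd[OF V]]]
        by (simp only: Act_J_mor[OF p] J_std_act[OF U V p])
      also have "\<dots> = (\<lambda>x\<in>points (Lev X ?k). Act (Lev X ?l) (s, \<lambda>v\<in>CC ?l. v) (?f (J_std U V \<phi>) (Act (Lev X ?k) (s, \<lambda>v\<in>CC ?k. v) x)))"
      proof (rule extensionalityI[of _ "points (Lev X ?k)"])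
        fix x assume x: "x \<in> points (Lev X ?k)"
        \<comment> \<open>\<open>spectrum_mor_act\<close> is applied at \<open>s x\<close> instead
          of \<open>x\<close>, and \<open>s s x = x\<close> brings it into the conjugation form used
          by \<open>map_space\<close>.\<close>
        let ?sx = "Act (Lev X ?k) (s, \<lambda>v\<in>CC ?k. v) x"
        have sx: "?sx \<in> points (Lev X ?k)" by (rule Lev_act_in[OF X unitary_id x])
        have "compose (CC ?k) (\<lambda>v\<in>CC ?k. v) (mconj s (CC ?k) (\<lambda>v\<in>CC ?k. v)) = (\<lambda>v\<in>CC ?k. v)"
          by (auto simp: mconj_id compose_def)
        then have "Act (Lev X ?k) (s, \<lambda>v\<in>CC ?k. v) ?sx = x"
          using Lev_act_act[OF X unitary_id unitary_id x, of s s] Lev_act_id[OF X x] by simp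
        then show "?f (J_act s (CC ?k) (J_std U V \<phi>)) x =
            (\<lambda>x\<in>points (Lev X ?k). Act (Lev X ?l) (s, \<lambda>v\<in>CC ?l. v) (?f (J_std U V \<phi>) (Act (Lev X ?k) (s, \<lambda>v\<in>CC ?k. v) x))) x"
          using spectrum_mor_act[OF X sp sx, of s] x by simp
      qed (simp_all add: spectrum_mor_def)
      also have "\<dots> = Act (map_space (FOb ?F U) (FOb ?F V)) s (?f (J_std U V \<phi>))"
        using f U V by (simp add: map_space_def based_maps_efunctor_of)
      finally show ?thesis by (simp only: FMor_efunctor_of[OF U V p])
    qed
    moreover have "FMor ?F U V \<in> extensional (points (J_mor U V))" using U V by (simp add: efunctor_of_def)
    ultimately show ?thesis
      unfolding gmaps_def based_maps_def[of "J_mor U V"]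
      using c n U V by (simp add: map_space_def compact_open_efunctor_of del: points_J_mor)
  qed
  have id: "FMor ?F U U (J_id U) = (\<lambda>x\<in>points (FOb ?F U). x)" if U: "U \<in> J_obj" for U
  proof -
    have "spectrum_mor X (jdim U) (jdim U) (J_id (CC (jdim U))) = (\<lambda>x\<in>points (Lev X (jdim U)). x)"
      by (rule extensionalityI[of _ "points (Lev X (jdim U))"])
        (simp_all add: spectrum_mor_id[OF X], simp add: spectrum_mor_def)
    then show ?thesis
      unfolding FMor_efunctor_of[OF U U J_id_in[OF J_obj_fd(1)[OF U]]] J_std_id[OF U] FOb_efunctor_of(1)[OF U] .
  qed
  have comp: "FMor ?F U W (J_comp U \<phi> \<psi>) = compose (points (FOb ?F U)) (FMor ?F V W \<phi>) (FMor ?F U V \<psi>)"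
    if U: "U \<in> J_obj" and V: "V \<in> J_obj" and W: "W \<in> J_obj"
      and q: "\<psi> \<in> points (J_mor U V)" and p: "\<phi> \<in> points (J_mor V W)" for U V W \<phi> \<psi>
  proof -
    have "spectrum_mor X (jdim U) (jdim W) (J_comp (CC (jdim U)) (J_std V W \<phi>) (J_std U V \<psi>)) =
        compose (points (Lev X (jdim U))) (spectrum_mor X (jdim V) (jdim W) (J_std V W \<phi>))
          (spectrum_mor X (jdim U) (jdim V) (J_std U V \<psi>))"
      by (rule extensionalityI[OF _ compose_extensional])
        (simp add: spectrum_mor_def, simp only: compose_eq spectrum_mor_comp[OF X J_std_in[OF U V q] J_std_in[OF V W p]])
    then show ?thesis
      unfolding FMor_efunctor_of[OF U W J_comp_in[OF p q J_obj_fd(1)[OF U] J_obj_fd(1)[OF W]]]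
        FMor_efunctor_of[OF U V q] FMor_efunctor_of[OF V W p] J_std_comp[OF U V W q p] FOb_efunctor_of(1)[OF U] .
  qed
  have "FOb ?F \<in> extensional J_obj" by (simp add: efunctor_of_def)
  moreover have "FMor ?F U V = undefined" if "U \<notin> J_obj \<or> V \<notin> J_obj" for U V
    using that by (auto simp: efunctor_of_def)
  ultimately show ?thesis
    unfolding enriched_functor_def using based_gspace_efunctor_of mor id comp by blast
qed

text \<open>\<open>jdim (CC k)\<close> is \<open>k\<close> and \<open>J_std\<close> is the identity
  between the spaces \<open>CC k\<close>, so both sides agree on points; actions and structure maps
  being extensional, the records are equal.\<close>

lemma spectrum_of_efunctor_of: "spectrum_of (efunctor_of X) = X"
proof -
  let ?F = "efunctor_of X"
  note J = CC_in_J_obj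
  have sm: "smash (FOb ?F (CC k)) Y = smash (Lev X k) Y" for k and Y :: "vec option bspace"
    by (simp add: smash_def smash_pt_def J fun_eq_iff)
  have mor: "FMor ?F (CC k) (CC l) \<phi> = spectrum_mor X k l \<phi>" if "\<phi> \<in> points (J_mor (CC k) (CC l))" for k l \<phi>
    using FMor_efunctor_of[OF J J that] J_std_CC[OF that] by simp
  have act: "Act (Lev (spectrum_of ?F) k) = Act (Lev X k)" for k
  proof (rule extensionalityI[of _ "carrier (C2U k)"])
    show "Act (Lev (spectrum_of ?F) k) \<in> extensional (carrier (C2U k))" by (simp add: spectrum_of_def)
    show "Act (Lev X k) \<in> extensional (carrier (C2U k))"
      by (rule based_gspaceD(5)[OF real_spectrumD(1)[OF X]])
    fix p assume p: "p \<in> carrier (C2U k)"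
    obtain s A where sA: "p = (s, A)" by (cases p)
    have A: "A \<in> unitary k" using p by (simp add: sA carrier_C2U)
    show "Act (Lev (spectrum_of ?F) k) p = Act (Lev X k) p"
    proof (rule extensionalityI[of _ "points (Lev X k)"])
      show "Act (Lev (spectrum_of ?F) k) p \<in> extensional (points (Lev X k))"
        using p by (simp add: spectrum_of_def J)
      show "Act (Lev X k) p \<in> extensional (points (Lev X k))"
        by (rule based_gspaceD(11)[OF real_spectrumD(1)[OF X] p])
      fix x assume x: "x \<in> points (Lev X k)"
      have sx: "Act (Lev X k) (s, \<lambda>v\<in>CC k. v) x \<in> points (Lev X k)" by (rule Lev_act_in[OF X unitary_id x])
      have rep: "is_rep k 0 A 0 A 0" using A unitaryD(6)[OF A] by (simp add: is_rep_def)
      have "Act (Lev (spectrum_of ?F) k) p x = spectrum_mor X k k (Some (A, 0)) (Act (Lev X k) (s, \<lambda>v\<in>CC k. v) x)"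
        using Act_spectrum_of[OF A, of x ?F s] x mor[OF J_unitary_in[OF A]] by (simp add: sA J)
      also have "\<dots> = Act (Lev X k) (False, A) (Act (Lev X k) (s, \<lambda>v\<in>CC k. v) x)"
        using spectrum_mor_rep[OF X rep sx] by (simp add: stab_0[OF X])
      also have "\<dots> = Act (Lev X k) (s, A) x"
      proof -
        have "compose (CC k) A (\<lambda>v\<in>CC k. v) = A"
          using unitaryD(1,2)[OF A] by (intro compose_Id) auto
        then show ?thesis using Lev_act_compose[OF X A unitary_id x, of s] by simp
      qed
      finally show "Act (Lev (spectrum_of ?F) k) p x = Act (Lev X k) p x" by (simp add: sA)
    qed
  qed
  have lev: "Lev (spectrum_of ?F) = Lev X"
  proof
    fix k
    show "Lev (spectrum_of ?F) k = Lev X k"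
      using act[of k] J by (intro gspace.equality) simp_all
  qed
  have str: "Str (spectrum_of ?F) = Str X"
  proof
    fix k
    let ?S = "sphere_of (CC 1)"
    show "Str (spectrum_of ?F) k = Str X k"
    proof (rule extensionalityI[of _ "points (smash (Lev X k) ?S)"])
      show "Str (spectrum_of ?F) k \<in> extensional (points (smash (Lev X k) ?S))"
        unfolding sm[symmetric] by (simp add: spectrum_of_def)
      show "Str X k \<in> extensional (points (smash (Lev X k) ?S))"
        by (rule based_mapsD(1)[OF real_spectrumD(2)[OF X]])
      fix z assume "z \<in> points (smash (Lev X k) ?S)"
      then obtain x v where x: "x \<in> points (Lev X k)" and v: "v \<in> points ?S" and z: "z = smash_pt (Lev X k) ?S x v"
        by auto
      have spt: "smash_pt (FOb ?F (CC k)) ?S = smash_pt (Lev X k) ?S" by (simp add: smash_pt_def J fun_eq_iff)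
      show "Str (spectrum_of ?F) k z = Str X k z"
      proof (cases v)
        case None
        then have "z = None" by (simp add: z smash_pt_def)
        then show ?thesis
          using Str_None[OF X] Str_None_spectrum_of[OF enriched_functor_efunctor_of] by (simp add: J)
      next
        case (Some w)
        then have w: "w \<in> CC 1" using v by auto
        have iJ: "Some (\<lambda>u\<in>CC k. u, shift k w) \<in> points (J_mor (CC k) (CC (Suc k)))"
          using J_incl_in[OF w, of k] by simp
        let ?I = "\<lambda>u\<in>CC (k + 1). u"
        have rep: "is_rep k 1 (\<lambda>u\<in>CC k. u) (shift k w) ?I w"
          using w unitary_id[of "k + 1"] shift_in_CC[OF w, of k] CC_mono[of k "k + 1"]
          unfolding is_rep_def by auto
        have st: "stab X k 1 x (Some w) \<in> points (Lev X (k + 1))" by (rule stab_in[OF X x]) (use w in auto)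
        have "Str (spectrum_of ?F) k z = spectrum_mor X k (Suc k) (Some (\<lambda>u\<in>CC k. u, shift k w)) x"
          using Str_spectrum_of(1)[OF enriched_functor_efunctor_of _ w, of x k] x mor[OF iJ]
          by (simp add: z Some J spt del: One_nat_def)
        also have "\<dots> = stab X k 1 x (Some w)"
          using spectrum_mor_rep[OF X rep x] Lev_act_id[OF X st] by simp
        \<comment> \<open>\<open>stab_Suc\<close> at \<open>m = 0\<close> with first vector 0: since
          \<open>w = 0 + shift 0 w\<close>, a single structure map remains.\<close>
        also have "\<dots> = Str X k z"
          using stab_Suc[OF X _ w, of 0 0 k x] stab_0[OF X, of k x 0]
          by (simp add: z Some shift_def)
        finally show ?thesis .
      qed
    qed
  qed
  show ?thesis using lev str by (intro rspectrum.equality) simp_all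
qed

end

section \<open>Maps of spectra induce natural transformations\<close>

lemma rspectrum_maps_stab:
  assumes X: "real_spectrum X" and Y: "real_spectrum Y" and f: "f \<in> rspectrum_maps X Y"
    and x: "x \<in> points (Lev X k)" and v: "v \<in> CC m"
  shows "f (k + m) (stab X k m x (Some v)) = stab Y k m (f k x) (Some v)"
  using v
proof (induction m arbitrary: v)
  case 0
  show "f (k + 0) (stab X k 0 x (Some v)) = stab Y k 0 (f k x) (Some v)"
    by (simp add: stab_0[OF X] stab_0[OF Y])
next
  case (Suc m)
  have d: "vdrop m v \<in> CC 1" using vdrop_in_CC[of v m 1] Suc.prems by simp
  have s: "stab X k m x (Some (vtake m v)) \<in> points (Lev X (k + m))" by (rule stab_in[OF X x]) simp
  have dp: "Some (vdrop m v) \<in> points (sphere_of (CC 1))" using d by simp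
  have "f (k + Suc m) (stab X k (Suc m) x (Some (vtake m v + shift m (vdrop m v)))) =
      stab Y k (Suc m) (f k x) (Some (vtake m v + shift m (vdrop m v)))"
    unfolding stab_Suc[OF X vtake_in_CC d] stab_Suc[OF Y vtake_in_CC d] Suc.IH[OF vtake_in_CC, symmetric]
    using rspectrum_mapsD(2)[OF f s dp] by (simp only: add_Suc_right)
  then show "f (k + Suc m) (stab X k (Suc m) x (Some v)) = stab Y k (Suc m) (f k x) (Some v)"
    by (simp only: vtake_plus_shift_vdrop)
qed

text \<open>A map of spectra commutes with iterated structure maps by
  \<open>rspectrum_maps_stab\<close> and with unitaries by equivariance, and
  \<open>spectrum_mor\<close> is composed of these two.\<close>

lemma rspectrum_maps_spectrum_mor:
  assumes X: "real_spectrum X" and Y: "real_spectrum Y" and f: "f \<in> rspectrum_maps X Y"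
    and p: "\<phi> \<in> points (J_mor (CC k) (CC l))" and x: "x \<in> points (Lev X k)"
  shows "f l (spectrum_mor X k l \<phi> x) = spectrum_mor Y k l \<phi> (f k x)"
proof -
  note g = rspectrum_mapsD(1)[OF f]
  have fx: "f k x \<in> points (Lev Y k)" by (rule based_mapsD(4)[OF gmapsD(1)[OF g] x])
  show ?thesis
    using p
  proof (cases rule: J_mor_CC_cases)
    case 1
    then show ?thesis
      using spectrum_mor_None[OF X x] spectrum_mor_None[OF Y fx] based_mapsD(3)[OF gmapsD(1)[OF g]] by simp
  next
    case (2 m h y A v)
    then have A: "A \<in> unitary (k + m)" "v \<in> CC m" by (auto simp: is_rep_def)
    have s: "stab X k m x (Some v) \<in> points (Lev X (k + m))" by (rule stab_in[OF X x]) (use A in simp)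
    have "f (k + m) (Act (Lev X (k + m)) (False, A) (stab X k m x (Some v))) =
        Act (Lev Y (k + m)) (False, A) (stab Y k m (f k x) (Some v))"
      using gmapsD(2)[OF g _ s, of "(False, A)"] A rspectrum_maps_stab[OF X Y f x A(2)]
      by (simp add: carrier_C2U)
    then show ?thesis
      using spectrum_mor_rep[OF X 2(3) x] spectrum_mor_rep[OF Y 2(3) fx] by (simp add: 2(1,2))
  qed
qed

lemma enriched_nats_of_rspectrum_map:
  assumes X: "real_spectrum X" and Y: "real_spectrum Y" and f: "f \<in> rspectrum_maps X Y"
  shows "(\<lambda>U\<in>J_obj. f (jdim U)) \<in> enriched_nats (efunctor_of X) (efunctor_of Y)"
  unfolding enriched_nats_def
proof (intro CollectI conjI ballI)
  note g = rspectrum_mapsD(1)[OF f]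
  fix U assume U: "U \<in> J_obj"
  have "f (jdim U) (Act (Lev X (jdim U)) (s, \<lambda>v\<in>CC (jdim U). v) x) = Act (Lev Y (jdim U)) (s, \<lambda>v\<in>CC (jdim U). v) (f (jdim U) x)"
    if "x \<in> points (Lev X (jdim U))" for s x
    by (rule gmapsD(2)[OF g _ that]) (simp add: carrier_C2U unitary_id)
  then show "(\<lambda>U\<in>J_obj. f (jdim U)) U \<in> gmaps C2 (FOb (efunctor_of X) U) (FOb (efunctor_of Y) U)"
    using gmapsD(1)[OF g] U by (simp add: gmaps_def based_maps_efunctor_of)
  fix V \<phi> assume V: "V \<in> J_obj" and p: "\<phi> \<in> points (J_mor U V)"
  have "compose (points (Lev X (jdim U))) (f (jdim V)) (spectrum_mor X (jdim U) (jdim V) (J_std U V \<phi>)) =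
      compose (points (Lev X (jdim U))) (spectrum_mor Y (jdim U) (jdim V) (J_std U V \<phi>)) (f (jdim U))"
    unfolding compose_def
    by (rule restrict_ext) (rule rspectrum_maps_spectrum_mor[OF X Y f J_std_in[OF U V p]])
  then show "compose (points (FOb (efunctor_of X) U)) ((\<lambda>U\<in>J_obj. f (jdim U)) V) (FMor (efunctor_of X) U V \<phi>) =
      compose (points (FOb (efunctor_of X) U)) (FMor (efunctor_of Y) U V \<phi>) ((\<lambda>U\<in>J_obj. f (jdim U)) U)"
    using U V by (simp add: FMor_efunctor_of[OF U V p])
qed simp

definition efunctor_ftor :: "('a rspectrum, nat \<Rightarrow> 'a \<Rightarrow> 'a, 'a efunctor, vec set \<Rightarrow> 'a \<Rightarrow> 'a) ftor" where
  "efunctor_ftor = \<lparr>onObj = efunctor_of, onHom = (\<lambda>X Y f. \<lambda>U\<in>J_obj. f (jdim U))\<rparr>"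

lemma is_functor_efunctor_ftor: "is_functor Real_Spectra C2_E1 efunctor_ftor"
  unfolding is_functor_def
  using enriched_functor_efunctor_of enriched_nats_of_rspectrum_map
  by (auto simp: C2_E1_def Real_Spectra_def efunctor_ftor_def intro!: restrict_ext)

section \<open>The equivalence\<close>

lemma natural_iso_id:
  "natural_iso Real_Spectra Real_Spectra id_ftor (comp_ftor spectrum_ftor efunctor_ftor)
    (Idt (Real_Spectra :: ('a rspectrum, nat \<Rightarrow> 'a \<Rightarrow> 'a) cat))"
proof -
  let ?R = "Real_Spectra :: ('a rspectrum, nat \<Rightarrow> 'a \<Rightarrow> 'a) cat"
  let ?GF = "comp_ftor spectrum_ftor efunctor_ftor :: ('a rspectrum, nat \<Rightarrow> 'a \<Rightarrow> 'a, 'a rspectrum, nat \<Rightarrow> 'a \<Rightarrow> 'a) ftor"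
  have cat: "is_category ?R" by (rule is_category_Real_Spectra)
  have ob: "onObj ?GF X = X" if "X \<in> Obj ?R" for X
    using that spectrum_of_efunctor_of by (simp add: comp_ftor_def spectrum_ftor_def efunctor_ftor_def Real_Spectra_def)
  have hom: "onHom ?GF X Y f = f" for X Y f
    by (simp add: comp_ftor_def spectrum_ftor_def efunctor_ftor_def CC_in_J_obj)
  have "is_iso ?R X X (Idt ?R X)" if "X \<in> Obj ?R" for X
    using cat that unfolding is_category_def is_iso_def by metis
  moreover have "Cmp ?R X Y Y (Idt ?R Y) f = Cmp ?R X X Y f (Idt ?R X)"
    if "X \<in> Obj ?R" "Y \<in> Obj ?R" "f \<in> Hom ?R X Y" for X Y f
    using cat that unfolding is_category_def by metis
  ultimately show ?thesis
    unfolding natural_iso_def by (simp add: id_ftor_def ob hom)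
qed

section \<open>The counit and its inverse\<close>

definition counit :: "'a efunctor \<Rightarrow> vec set \<Rightarrow> 'a \<Rightarrow> 'a" where
  "counit E = (\<lambda>U\<in>J_obj. FMor E (CC (jdim U)) U (J_up U))"

definition counit_inv :: "'a efunctor \<Rightarrow> vec set \<Rightarrow> 'a \<Rightarrow> 'a" where
  "counit_inv E = (\<lambda>U\<in>J_obj. FMor E U (CC (jdim U)) (J_dn U))"

context
  fixes E :: "'a efunctor" assumes E: "enriched_functor E"
begin

text \<open>The element \<open>(s, 1)\<close> acts on the spectrum as \<open>s\<close> followed by
  \<open>E\<close> of an identity morphism, so the original C_2-action returns.\<close>

lemma FOb_counit:
  assumes U: "U \<in> J_obj" and x: "x \<in> points (FOb E (CC (jdim U)))"
  shows "Act (FOb (efunctor_of (spectrum_of E)) U) s x = Act (FOb E (CC (jdim U))) s x"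
proof -
  note J = CC_in_J_obj
  have "Act (Lev (spectrum_of E) (jdim U)) (s, \<lambda>v\<in>CC (jdim U). v) x =
      FMor E (CC (jdim U)) (CC (jdim U)) (J_id (CC (jdim U))) (Act (FOb E (CC (jdim U))) s x)"
    using Act_spectrum_of[OF unitary_id x] by (simp add: J_id_def)
  then show ?thesis using FMor_id[OF E J Act_FOb(1)[OF E J x]] U by simp
qed

text \<open>A morphism \<open>(f, y)\<close> between the spaces \<open>CC k\<close> and
  \<open>CC l\<close> factors as the inclusion with vector \<open>shift k v\<close> followed by
  \<open>(A, 0)\<close>, and \<open>spectrum_mor\<close> of \<open>spectrum_of E\<close> applies
  \<open>E\<close> to the two factors.\<close>

lemma spectrum_mor_spectrum_of:
  assumes p: "\<phi> \<in> points (J_mor (CC k) (CC l))" and x: "x \<in> points (FOb E (CC k))"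
  shows "spectrum_mor (spectrum_of E) k l \<phi> x = FMor E (CC k) (CC l) \<phi> x"
  using p
proof (cases rule: J_mor_CC_cases)
  case 1
  then show ?thesis
    using spectrum_mor_None[OF real_spectrum_spectrum_of[OF E], of x k l] x FMor_None[OF E CC_in_J_obj CC_in_J_obj x]
    by simp
next
  case (2 m f y A v)
  note J = CC_in_J_obj and S = real_spectrum_spectrum_of[OF E]
  have A: "A \<in> unitary (k + m)" "v \<in> CC m" "\<And>u. u \<in> CC k \<Longrightarrow> A u = f u" "A (shift k v) = y"
    using 2(3) by (auto simp: is_rep_def)
  note iv = J_incl_in[OF A(2), of k]
  let ?y = "FMor E (CC k) (CC (k + m)) (Some (\<lambda>u\<in>CC k. u, shift k v)) x"
  have y: "?y \<in> points (FOb E (CC (k + m)))" by (rule FMor_in[OF E J J iv x])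
  have st: "stab (spectrum_of E) k m x (Some v) = ?y"
    using iter_str_spectrum_of[OF E x A(2)] stab_Some[OF S, of k m x v] by simp
  have "spectrum_mor (spectrum_of E) k l \<phi> x = Act (Lev (spectrum_of E) (k + m)) (False, A) ?y"
    using spectrum_mor_rep[OF S 2(3), of x] x by (simp add: 2(1,2) st)
  also have "\<dots> = FMor E (CC (k + m)) (CC (k + m)) (Some (A, 0)) ?y"
    using Act_spectrum_of[OF A(1) y, of False] Act_FOb(3)[OF E J y] by simp
  also have "\<dots> = FMor E (CC k) (CC (k + m)) (J_comp (CC k) (Some (A, 0)) (Some (\<lambda>u\<in>CC k. u, shift k v))) x"
    by (rule FMor_comp[OF E J J J iv J_unitary_in[OF A(1)] x, symmetric])
  also have "J_comp (CC k) (Some (A, 0)) (Some (\<lambda>u\<in>CC k. u, shift k v)) = \<phi>"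
  proof -
    obtain g w where gw: "\<phi> = Some (g, w)" "(g, w) \<in> J_bundle (CC k) (CC l)" using p 2(1) by auto
    then have "f \<in> extensional (CC k)" using isometriesD(2)[OF J_bundleD(1)[OF gw(2)]] 2(1) by simp
    then have "compose (CC k) A (\<lambda>u\<in>CC k. u) = f"
      using A(3) by (intro extensionalityI[OF compose_extensional]) (auto simp: compose_eq)
    then show ?thesis by (simp add: 2(1) A(4))
  qed
  finally show ?thesis by (simp only: 2(2))
qed

lemma FMor_counit:
  assumes U: "U \<in> J_obj" and V: "V \<in> J_obj" and p: "\<phi> \<in> points (J_mor U V)" and x: "x \<in> points (FOb E (CC (jdim U)))"
  shows "FMor (efunctor_of (spectrum_of E)) U V \<phi> x = FMor E (CC (jdim U)) (CC (jdim V)) (J_std U V \<phi>) x"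
  by (simp only: FMor_efunctor_of[OF U V p] spectrum_mor_spectrum_of[OF J_std_in[OF U V p] x])

lemma counit_inverse:
  assumes U: "U \<in> J_obj"
  shows "x \<in> points (FOb E (CC (jdim U))) \<Longrightarrow> FMor E U (CC (jdim U)) (J_dn U) (FMor E (CC (jdim U)) U (J_up U) x) = x"
    "x \<in> points (FOb E U) \<Longrightarrow> FMor E (CC (jdim U)) U (J_up U) (FMor E U (CC (jdim U)) (J_dn U) x) = x"
  using FMor_comp[OF E CC_in_J_obj U CC_in_J_obj J_up_in[OF U] J_dn_in[OF U]] J_dn_up[OF U] FMor_id[OF E CC_in_J_obj]
    FMor_comp[OF E U CC_in_J_obj U J_dn_in[OF U] J_up_in[OF U]] J_up_dn[OF U] FMor_id[OF E U] by metis+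

text \<open>Naturality is \<open>E\<close> applied to \<open>J_up_std\<close>; equivariance holds
  because \<open>J_up U\<close> is fixed by conjugation.\<close>

lemma counit_nat: "counit E \<in> enriched_nats (efunctor_of (spectrum_of E)) E"
  unfolding enriched_nats_def
proof (intro CollectI conjI ballI)
  let ?E = "efunctor_of (spectrum_of E)"
  note J = CC_in_J_obj
  fix U assume U: "U \<in> J_obj"
  let ?k = "CC (jdim U)"
  have pt: "points (FOb ?E U) = points (FOb E ?k)" using U by simp
  have "FMor E ?k U (J_up U) \<in> based_maps (FOb ?E U) (FOb E U)"
    using FMor_based_map[OF E J U J_up_in[OF U]] U by (simp add: based_maps_def)
  moreover have "FMor E ?k U (J_up U) (Act (FOb ?E U) s x) = Act (FOb E U) s (FMor E ?k U (J_up U) x)"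
    if "x \<in> points (FOb ?E U)" for s x
    using FMor_act[OF E J U J_up_in[OF U], of x s] FOb_counit[OF U, of x s] that J_act_up[OF U] unfolding pt by simp
  ultimately show "counit E U \<in> gmaps C2 (FOb ?E U) (FOb E U)"
    unfolding gmaps_def counit_def using U by simp
  fix V \<phi> assume V: "V \<in> J_obj" and p: "\<phi> \<in> points (J_mor U V)"
  have "FMor E (CC (jdim V)) V (J_up V) (FMor ?E U V \<phi> x) = FMor E U V \<phi> (FMor E ?k U (J_up U) x)"
    if x: "x \<in> points (FOb E ?k)" for x
    using FMor_counit[OF U V p x] J_up_std[OF U V p]
      FMor_comp[OF E J J V J_std_in[OF U V p] J_up_in[OF V] x] FMor_comp[OF E J U V J_up_in[OF U] p x] by simp
  then show "compose (points (FOb ?E U)) (counit E V) (FMor ?E U V \<phi>) = compose (points (FOb ?E U)) (FMor E U V \<phi>) (counit E U)"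
    unfolding pt compose_def counit_def using U V by (intro restrict_ext) simp
qed (simp add: counit_def)

lemma counit_inv_nat: "counit_inv E \<in> enriched_nats E (efunctor_of (spectrum_of E))"
  unfolding enriched_nats_def
proof (intro CollectI conjI ballI)
  let ?E = "efunctor_of (spectrum_of E)"
  note J = CC_in_J_obj
  fix U assume U: "U \<in> J_obj"
  let ?k = "CC (jdim U)"
  have "FMor E U ?k (J_dn U) \<in> based_maps (FOb E U) (FOb ?E U)"
    using FMor_based_map[OF E U J J_dn_in[OF U]] U by (simp add: based_maps_def)
  moreover have "FMor E U ?k (J_dn U) (Act (FOb E U) s x) = Act (FOb ?E U) s (FMor E U ?k (J_dn U) x)"
    if x: "x \<in> points (FOb E U)" for s x
    using FMor_act[OF E U J J_dn_in[OF U] x, of s] FOb_counit[OF U FMor_in[OF E U J J_dn_in[OF U] x], of s] J_act_dn[OF U] by simp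
  ultimately show "counit_inv E U \<in> gmaps C2 (FOb E U) (FOb ?E U)"
    unfolding gmaps_def counit_inv_def using U by simp
  fix V \<phi> assume V: "V \<in> J_obj" and p: "\<phi> \<in> points (J_mor U V)"
  have "FMor E V (CC (jdim V)) (J_dn V) (FMor E U V \<phi> x) = FMor ?E U V \<phi> (FMor E U ?k (J_dn U) x)"
    if x: "x \<in> points (FOb E U)" for x
  proof -
    let ?y = "FMor E U ?k (J_dn U) x"
    have y: "?y \<in> points (FOb E ?k)" by (rule FMor_in[OF E U J J_dn_in[OF U] x])
    note sp = J_std_in[OF U V p]
    have z: "FMor E ?k (CC (jdim V)) (J_std U V \<phi>) ?y \<in> points (FOb E (CC (jdim V)))"
      by (rule FMor_in[OF E J J sp y])
    \<comment> \<open>Writing \<open>x\<close> as the image of \<open>?y\<close> under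
      \<open>E\<close> of \<open>J_up U\<close> reduces naturality of the inverse to that of the
      counit.\<close>
    have "FMor E U V \<phi> x = FMor E U V \<phi> (FMor E ?k U (J_up U) ?y)"
      using counit_inverse(2)[OF U x] by simp
    also have "\<dots> = FMor E (CC (jdim V)) V (J_up V) (FMor E ?k (CC (jdim V)) (J_std U V \<phi>) ?y)"
      using J_up_std[OF U V p] FMor_comp[OF E J J V sp J_up_in[OF V] y] FMor_comp[OF E J U V J_up_in[OF U] p y] by simp
    finally show ?thesis using counit_inverse(1)[OF V z] FMor_counit[OF U V p y] by simp
  qed
  then show "compose (points (FOb E U)) (counit_inv E V) (FMor E U V \<phi>) = compose (points (FOb E U)) (FMor ?E U V \<phi>) (counit_inv E U)"
    unfolding compose_def counit_inv_def using U V by (intro restrict_ext) simp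
qed (simp add: counit_inv_def)

lemma counit_iso: "is_iso C2_E1 (efunctor_of (spectrum_of E)) E (counit E)"
proof -
  let ?E = "efunctor_of (spectrum_of E)"
  have "compose (points (FOb ?E U)) (counit_inv E U) (counit E U) = (\<lambda>x\<in>points (FOb ?E U). x)"
    and "compose (points (FOb E U)) (counit E U) (counit_inv E U) = (\<lambda>x\<in>points (FOb E U). x)"
    if U: "U \<in> J_obj" for U
    using U counit_inverse[OF U] by (auto simp: compose_def counit_def counit_inv_def intro!: restrict_ext)
  then show ?thesis
    unfolding is_iso_def using counit_nat counit_inv_nat
    by (auto simp: C2_E1_def intro!: bexI[of _ "counit_inv E"] restrict_ext)
qed

end

text \<open>Naturality in \<open>E\<close> is the naturality square of \<alpha> at the morphism
  \<open>J_up U\<close>.\<close>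

lemma natural_iso_counit:
  "natural_iso C2_E1 C2_E1 (comp_ftor efunctor_ftor spectrum_ftor) id_ftor counit"
  unfolding natural_iso_def
proof (intro conjI ballI)
  fix E assume "E \<in> Obj C2_E1"
  then have E: "enriched_functor E" by (simp add: C2_E1_def)
  show "is_iso C2_E1 (onObj (comp_ftor efunctor_ftor spectrum_ftor) E) (onObj id_ftor E) (counit E)"
    using counit_iso[OF E] by (simp add: comp_ftor_def efunctor_ftor_def spectrum_ftor_def id_ftor_def)
  fix E' \<alpha> assume "E' \<in> Obj C2_E1" and "\<alpha> \<in> Hom C2_E1 E E'"
  then have E': "enriched_functor E'" and a: "\<alpha> \<in> enriched_nats E E'" by (simp_all add: C2_E1_def)
  note J = CC_in_J_obj
  have "compose (points (FOb E (CC (jdim U)))) (counit E' U) (\<alpha> (CC (jdim U))) =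
      compose (points (FOb E (CC (jdim U)))) (\<alpha> U) (counit E U)" if U: "U \<in> J_obj" for U
    using enriched_natsD(3)[OF a J U J_up_in[OF U]] U by (simp add: counit_def)
  then show "Cmp C2_E1 (onObj (comp_ftor efunctor_ftor spectrum_ftor) E) (onObj (comp_ftor efunctor_ftor spectrum_ftor) E')
        (onObj id_ftor E') (counit E') (onHom (comp_ftor efunctor_ftor spectrum_ftor) E E' \<alpha>) =
      Cmp C2_E1 (onObj (comp_ftor efunctor_ftor spectrum_ftor) E) (onObj id_ftor E) (onObj id_ftor E')
        (onHom id_ftor E E' \<alpha>) (counit E)"
    by (auto simp: C2_E1_def comp_ftor_def efunctor_ftor_def spectrum_ftor_def id_ftor_def intro!: restrict_ext)
qed

theorem proposition0p4:
  shows "equivalent_categories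
    (Real_Spectra :: ('a rspectrum, nat \<Rightarrow> 'a \<Rightarrow> 'a) cat)
    (C2_E1 :: ('a efunctor, vec set \<Rightarrow> 'a \<Rightarrow> 'a) cat)"
  unfolding equivalent_categories_def
  using is_category_Real_Spectra is_category_C2_E1 is_functor_efunctor_ftor is_functor_spectrum_ftor
    natural_iso_id natural_iso_counit by blast

end
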